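(* Let $K/F$ be a fully computable infinite Galois extension, with associated sub-extensions $\{K_i\}_{i\in\omega}$, and let $C\subseteq\omega$ be a cohesive set. Then $\mathrm{INF}(\prod_CK/\prod_CF)$ is a normal subgroup of $\mathrm{HAut}(\prod_CK/\prod_CF)$. Furthermore, it consists of exactly the hyper-automorphisms that fix $K$ (pointwise). Thus, the quotient $\mathrm{HAut}(\prod_CK/\prod_CF)/\mathrm{INF}(\prod_CK/\prod_CF)$ is isometrically isomorphic to a dense subgroup of $\mathrm{Gal}(K/F)$.
   Context: For $A,B\subseteq\omega$, $A\subseteq^* B$ means $A\setminus B$ is finite. A set $C\subseteq\omega$ is cohesive if it is infinite and for every c.e. set $W$ either $C\subseteq^*W$ or $C\subseteq^*\overline{W}$. A sequence of structures is uniformly computable if their domains $\subseteq\omega$ and atomic diagrams are computable uniformly in $i$; for finite groups $G_i$ this is understood to mean that the complete finite list of elements and the multiplication table of $G_i$ are computable from $i$. The cohesive product $\prod_C\mathcal A_i$ has as domain the classes $[\varphi]$ of partial computable functions $\varphi$ with $\varphi(i)\in\mathcal A_i$ whenever $\varphi(i){\downarrow}$ and $C\subseteq^*\mathrm{dom}(\varphi)$, where $[\varphi]=[\psi]$ iff $C\subseteq^*\{i:\varphi(i){\downarrow}=\psi(i){\downarrow}\}$; operations are pointwise and a relation holds iff it holds at $i$ for almost every $i\in C$. The same definition is used for partial sequences $\{\mathcal A_i\}_{i\in W}$ with $W$ c.e. and $C\subseteq^*W$. The product of a constant sequence is the cohesive power, into which the structure embeds via constant functions (so $K\subseteq\prod_CK$,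 $\mathbb{N}\subseteq\prod_C\mathbb{N}$). Brackets are omitted from elements. For $N\in\prod_C\mathbb{N}$, $\prod_{C,N}\mathcal A_i:=\prod_C\mathcal A_{N(i)}$. Field extensions are presented as triples $(K,F,\Psi)$ with $\Psi:F\to K$ a computable ring homomorphism between computable fields. A Galois extension $K/F$ is fully computable if: (1) $(K,F,\Psi)$ is a computable Galois extension; (2) there are uniformly computable finite Galois sub-extensions $K_i\subseteq K$ of $F$, with $(K,K_i,\Psi_i)$ and $(K_{i+1},K_i,\Phi_i)$ uniformly computable and $K=\bigcup_iK_i$; (3) the groups $G_i=\mathrm{Gal}(K_i/F)$ are uniformly computable; (4) the quotient (restriction) maps $G_m\to G_n$, $n<m$, are uniformly computable; (5) the actions $G_i\curvearrowright K_i$ are uniformly computable; (6) $K_i\subsetneq K_{i+1}$. Then $\prod_{C,N}K_i\subseteq\prod_CK$. For a structure $\mathcal A$, $\mathcal T_{\mathcal A}=(\mathcal A^{<\omega},\preceq,{}^\wedge)$ is the tree of finite tuples with extension order and concatenation. For $\vec a\in\prod_C\mathcal T_K$, the arity $|\vec a|\in\prod_C\mathbb{N}$ is $i\mapsto|\vec a(i)|$. Elements of $\prod_CK$ are identified with elements of $\prod_C\mathcal T_K$ of arity $1$. Elements $p\in\prod_C(\mathbb{Z}[x_1,x_2,\dots])$ are integral hyper-polynomials ($\mathbb{Z}[x_1,x_2,\dots]$ being presented so that degrees and coefficients are computable); $\mathrm{var}(p)\in\prod_C\mathbb{N}$ is $i\mapsto$ the largest index of a variable occurring in $p(i)$, and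 if $|\vec a|=\mathrm{var}(p)$ then $p(\vec a)\in\prod_CK$ is $i\mapsto p(i)(\vec a(i))$. $\mathrm{HAut}(\prod_CK/\prod_CF)$ is the group of automorphisms $\sigma$ of $(\prod_C\mathcal T_K,\preceq,{}^\wedge)$ such that $|\sigma\vec a|=|\vec a|$ for all $\vec a$, $p(\sigma(\vec a))=\sigma(p(\vec a))$ for all integral hyper-polynomials $p$ and $\vec a$ with $|\vec a|=\mathrm{var}(p)$, and $\sigma(\vec a)=\vec a$ for all $\vec a\in\prod_C\mathcal T_F$. Hyper-metric: for $\sigma,\tau\in\mathrm{HAut}(\prod_CK/\prod_CF)$, $d(\sigma,\tau)=0$ if $\sigma=\tau$, and otherwise $d(\sigma,\tau)=\frac1{2^N}\in\prod_C\mathbb{Q}$ where $N$ is the least element of $\prod_C\mathbb{N}$ (it exists) with $\sigma\upharpoonright\prod_{C,N}K_i\ne\tau\upharpoonright\prod_{C,N}K_i$. $\mathrm{INF}(\prod_CK/\prod_CF)$ is the set of infinitesimals: those $\sigma$ with $\sigma=\mathrm{id}$ or $d(\mathrm{id},\sigma)=\frac1{2^N}$ for some $N\in\prod_C\mathbb{N}\setminus\mathbb{N}$. Metric on $\mathrm{Gal}(K/F)$: $d(\sigma,\tau)=0$ if $\sigma=\tau$, and otherwise $2^{-n}$ for the least $n$ with $\sigma\upharpoonright K_n\neq\tau\upharpoonright K_n$. "Dense" is with respect to the Krull topology. The metric on the quotient is the one induced by the hyper-metric: two distinct cosets of $\mathrm{INF}$ have distance $d(\sigma,\tau)=2^{-n}$,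 $n\in\mathbb{N}$ standard, for any representatives $\sigma,\tau$. *)

theory Defs
  imports
    "HOL-Analysis.Abstract_Topology"
    "HOL-Algebra.Algebra"
    "HOL-Library.Nat_Bijection"
    "HOL-Library.Sublist"
begin

section \<open>Computability on the natural numbers\<close>

text \<open>
  Unary partial recursive functions over the standard pairing function: the closure of the basic
  functions under pairing, composition, primitive recursion and unbounded search. Functions of
  several arguments are handled by pairing the arguments. A value None means divergence.
\<close>

inductive partrec :: "(nat \<rightharpoonup> nat) \<Rightarrow> bool" where
  zero: "partrec (\<lambda>_. Some 0)"
| succ: "partrec (\<lambda>n. Some (Suc n))"
| left: "partrec (\<lambda>n. Some (fst (prod_decode n)))"
| right: "partrec (\<lambda>n. Some (snd (prod_decode n)))"
| pair: "partrec f \<Longrightarrow> partrec g \<Longrightarrow>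
    partrec (\<lambda>n. Option.bind (f n) (\<lambda>a. Option.bind (g n) (\<lambda>b. Some (prod_encode (a, b)))))"
| comp: "partrec f \<Longrightarrow> partrec g \<Longrightarrow> partrec (\<lambda>n. Option.bind (g n) f)"
| prec: "partrec f \<Longrightarrow> partrec g \<Longrightarrow>
    partrec (\<lambda>n. rec_nat (f (fst (prod_decode n)))
      (\<lambda>y r. Option.bind r (\<lambda>v. g (prod_encode (fst (prod_decode n), prod_encode (y, v)))))
      (snd (prod_decode n)))"
| search: "partrec f \<Longrightarrow>
    partrec (\<lambda>a. if \<exists>m. f (prod_encode (a, m)) = Some 0 \<and>
                      (\<forall>k<m. f (prod_encode (a, k)) \<noteq> None)
                 then Some (LEAST m. f (prod_encode (a, m)) = Some 0) else None)"

definition ce_set :: "nat set \<Rightarrow> bool" where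
  "ce_set W \<longleftrightarrow> (\<exists>\<phi>. partrec \<phi> \<and> W = dom \<phi>)"

text \<open>In the next two definitions the first argument is the coding of the inputs as numbers.\<close>

definition computable_on :: "('a \<Rightarrow> nat) \<Rightarrow> 'a set \<Rightarrow> ('a \<Rightarrow> nat) \<Rightarrow> bool" where
  "computable_on e D f \<longleftrightarrow> (\<exists>\<phi>. partrec \<phi> \<and> (\<forall>x\<in>D. \<phi> (e x) = Some (f x)))"

definition computable_set :: "('a \<Rightarrow> nat) \<Rightarrow> 'a set \<Rightarrow> bool" where
  "computable_set e D \<longleftrightarrow> computable_on e UNIV (\<lambda>x. if x \<in> D then 1 else 0)"

definition triple_encode :: "nat \<times> nat \<times> nat \<Rightarrow> nat" where
  "triple_encode = (\<lambda>(x, y, z). prod_encode (x, prod_encode (y, z)))"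

definition almost_subset :: "nat set \<Rightarrow> nat set \<Rightarrow> bool"  (infix \<open>\<subseteq>\<^sup>*\<close> 50) where
  "A \<subseteq>\<^sup>* B \<longleftrightarrow> finite (A - B)"

definition cohesive :: "nat set \<Rightarrow> bool" where
  "cohesive C \<longleftrightarrow> infinite C \<and> (\<forall>W. ce_set W \<longrightarrow> C \<subseteq>\<^sup>* W \<or> C \<subseteq>\<^sup>* - W)"


section \<open>Galois extensions and Galois groups\<close>

text \<open>
  The base field is given as a subfield k of R. Algebraic, normal and separable are expressed
  together: the minimal polynomial of every element of R over k is a product of pairwise distinct
  linear factors over R.
\<close>

definition galois_extension :: "('a, 'b) ring_scheme \<Rightarrow> 'a set \<Rightarrow> bool" where
  "galois_extension R k \<longleftrightarrow> field R \<and> subfield k R \<and>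
    (\<forall>x\<in>carrier R. ring.algebraic R k x \<and>
       ring.splitted R (ring.Irr R k x) \<and>
       (\<forall>y\<in>carrier R. count (ring.roots R (ring.Irr R k x)) y \<le> 1))"

definition gal :: "('a, 'b) ring_scheme \<Rightarrow> 'a set \<Rightarrow> ('a \<Rightarrow> 'a) monoid" where
  "gal R k = BijGroup (carrier R)
     \<lparr>carrier := {\<sigma> \<in> Bij (carrier R). \<sigma> \<in> ring_hom R R \<and> (\<forall>x\<in>k. \<sigma> x = x)}\<rparr>"

definition krull_topology :: "('a, 'b) ring_scheme \<Rightarrow> 'a set \<Rightarrow> ('a \<Rightarrow> 'a) topology" where
  "krull_topology R k = topology_generated_by
     {{\<tau> \<in> carrier (gal R k). \<forall>x\<in>L. \<tau> x = \<sigma> x} | \<sigma> L.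
        \<sigma> \<in> carrier (gal R k) \<and> subfield L R \<and> k \<subseteq> L \<and> ring.finite_dimension R k L}"


section \<open>Fully computable Galois extensions\<close>

definition uniformly_computable_fields :: "(nat \<Rightarrow> nat ring) \<Rightarrow> bool" where
  "uniformly_computable_fields R \<longleftrightarrow>
    (\<forall>i. field (R i)) \<and>
    computable_set prod_encode {(i, x). x \<in> carrier (R i)} \<and>
    computable_on triple_encode {(i, x, y). x \<in> carrier (R i) \<and> y \<in> carrier (R i)}
      (\<lambda>(i, x, y). x \<oplus>\<^bsub>R i\<^esub> y) \<and>
    computable_on triple_encode {(i, x, y). x \<in> carrier (R i) \<and> y \<in> carrier (R i)}
      (\<lambda>(i, x, y). x \<otimes>\<^bsub>R i\<^esub> y) \<and>
    computable_on id UNIV (\<lambda>i. \<zero>\<^bsub>R i\<^esub>) \<and>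
    computable_on id UNIV (\<lambda>i. \<one>\<^bsub>R i\<^esub>)"

definition computable_field :: "nat ring \<Rightarrow> bool" where
  "computable_field R \<longleftrightarrow> uniformly_computable_fields (\<lambda>_. R)"

definition uniformly_computable_finite_groups :: "(nat \<Rightarrow> nat monoid) \<Rightarrow> bool" where
  "uniformly_computable_finite_groups G \<longleftrightarrow>
    (\<forall>i. group (G i)) \<and>
    (\<exists>elems. (\<forall>i. set (elems i) = carrier (G i)) \<and>
       computable_on id UNIV (\<lambda>i. list_encode (elems i))) \<and>
    computable_on triple_encode {(i, g, h). g \<in> carrier (G i) \<and> h \<in> carrier (G i)}
      (\<lambda>(i, g, h). g \<otimes>\<^bsub>G i\<^esub> h)"

text \<open>
  The sub-extension K_i is presented as a field Ks i on its own set of numbers, with embeddings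
  Psis i into K and Phis i into Ks (Suc i); as a subset of K it is the image of Psis i. Inside
  Ks i the base field is the following preimage of the image of F.
\<close>

definition base_in :: "nat ring \<Rightarrow> (nat \<Rightarrow> nat) \<Rightarrow> nat ring \<Rightarrow> (nat \<Rightarrow> nat) \<Rightarrow> nat set" where
  "base_in F Psi L \<iota> = {x \<in> carrier L. \<iota> x \<in> Psi ` carrier F}"

text \<open>
  G i acts on Ks i by act i and is thereby identified with the Galois group of Ks i over F;
  res m n is the restriction map from G m to G n.
\<close>

definition fully_computable_galois ::
    "nat ring \<Rightarrow> nat ring \<Rightarrow> (nat \<Rightarrow> nat) \<Rightarrow>
     (nat \<Rightarrow> nat ring) \<Rightarrow> (nat \<Rightarrow> nat \<Rightarrow> nat) \<Rightarrow> (nat \<Rightarrow> nat \<Rightarrow> nat) \<Rightarrow>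
     (nat \<Rightarrow> nat monoid) \<Rightarrow> (nat \<Rightarrow> nat \<Rightarrow> nat \<Rightarrow> nat) \<Rightarrow> (nat \<Rightarrow> nat \<Rightarrow> nat \<Rightarrow> nat) \<Rightarrow> bool" where
  "fully_computable_galois K F Psi Ks Psis Phis G res act \<longleftrightarrow>
    computable_field K \<and> computable_field F \<and>
    Psi \<in> ring_hom F K \<and> computable_on id (carrier F) Psi \<and>
    galois_extension K (Psi ` carrier F) \<and>
    uniformly_computable_fields Ks \<and>
    (\<forall>i. Psis i \<in> ring_hom (Ks i) K \<and> Phis i \<in> ring_hom (Ks i) (Ks (Suc i)) \<and>
       (\<forall>x\<in>carrier (Ks i). Psis (Suc i) (Phis i x) = Psis i x)) \<and>
    computable_on prod_encode {(i, x). x \<in> carrier (Ks i)} (\<lambda>(i, x). Psis i x) \<and>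
    computable_on prod_encode {(i, x). x \<in> carrier (Ks i)} (\<lambda>(i, x). Phis i x) \<and>
    (\<forall>i. Psi ` carrier F \<subseteq> Psis i ` carrier (Ks i) \<and>
       galois_extension (Ks i) (base_in F Psi (Ks i) (Psis i)) \<and>
       ring.finite_dimension (Ks i) (base_in F Psi (Ks i) (Psis i)) (carrier (Ks i))) \<and>
    carrier K = (\<Union>i. Psis i ` carrier (Ks i)) \<and>
    uniformly_computable_finite_groups G \<and>
    (\<forall>i. (\<lambda>g. restrict (act i g) (carrier (Ks i)))
           \<in> iso (G i) (gal (Ks i) (base_in F Psi (Ks i) (Psis i)))) \<and>
    (\<forall>m n. n < m \<longrightarrow> (\<forall>g\<in>carrier (G m). res m n g \<in> carrier (G n) \<and>
       (\<forall>x\<in>carrier (Ks n). \<forall>y\<in>carrier (Ks m). Psis m y = Psis n x \<longrightarrow>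
          Psis m (act m g y) = Psis n (act n (res m n g) x)))) \<and>
    computable_on triple_encode {(m, n, g). n < m \<and> g \<in> carrier (G m)}
      (\<lambda>(m, n, g). res m n g) \<and>
    computable_on triple_encode {(i, g, x). g \<in> carrier (G i) \<and> x \<in> carrier (Ks i)}
      (\<lambda>(i, g, x). act i g x) \<and>
    (\<forall>i. Psis i ` carrier (Ks i) \<subset> Psis (Suc i) ` carrier (Ks (Suc i)))"

definition gal_dist ::
    "(nat \<Rightarrow> nat ring) \<Rightarrow> (nat \<Rightarrow> nat \<Rightarrow> nat) \<Rightarrow> (nat \<Rightarrow> nat) \<Rightarrow> (nat \<Rightarrow> nat) \<Rightarrow> real" where
  "gal_dist Ks Psis \<sigma> \<tau> = (if \<sigma> = \<tau> then 0 else
     1 / 2 ^ (LEAST n. restrict \<sigma> (Psis n ` carrier (Ks n)) \<noteq> restrict \<tau> (Psis n ` carrier (Ks n))))"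


section \<open>Cohesive products\<close>

text \<open>
  A partial sequence of domains is a map A from indices to sets of numbers; a total sequence is
  one that is nowhere None.
\<close>

definition cfuns :: "nat set \<Rightarrow> (nat \<rightharpoonup> nat set) \<Rightarrow> (nat \<rightharpoonup> nat) set" where
  "cfuns C A = {\<phi>. partrec \<phi> \<and> C \<subseteq>\<^sup>* dom \<phi> \<and>
     (\<forall>i x. \<phi> i = Some x \<longrightarrow> (\<exists>D. A i = Some D \<and> x \<in> D))}"

definition crel :: "nat set \<Rightarrow> (nat \<rightharpoonup> nat set) \<Rightarrow> ((nat \<rightharpoonup> nat) \<times> (nat \<rightharpoonup> nat)) set" where
  "crel C A = {(\<phi>, \<psi>). \<phi> \<in> cfuns C A \<and> \<psi> \<in> cfuns C A \<and>
     C \<subseteq>\<^sup>* {i. \<phi> i \<noteq> None \<and> \<psi> i \<noteq> None \<and> \<phi> i = \<psi> i}}"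

definition cclass :: "nat set \<Rightarrow> (nat \<rightharpoonup> nat set) \<Rightarrow> (nat \<rightharpoonup> nat) \<Rightarrow> (nat \<rightharpoonup> nat) set" where
  "cclass C A \<phi> = crel C A `` {\<phi>}"

definition cprod :: "nat set \<Rightarrow> (nat \<rightharpoonup> nat set) \<Rightarrow> (nat \<rightharpoonup> nat) set set" where
  "cprod C A = cfuns C A // crel C A"

abbreviation const_seq :: "nat set \<Rightarrow> (nat \<rightharpoonup> nat set)" where
  "const_seq D \<equiv> (\<lambda>_. Some D)"

abbreviation cpow :: "nat set \<Rightarrow> nat set \<Rightarrow> (nat \<rightharpoonup> nat) set set" where
  "cpow C D \<equiv> cprod C (const_seq D)"

definition cconst :: "nat set \<Rightarrow> nat set \<Rightarrow> nat \<Rightarrow> (nat \<rightharpoonup> nat) set" where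
  "cconst C D x = cclass C (const_seq D) (\<lambda>_. Some x)"

text \<open>
  Pointwise operations into the cohesive power with domain D, and pointwise binary relations. The
  unions range over representatives of one class; the classes obtained all agree, except that a
  function that is not an element of the product has the empty class and contributes nothing.
\<close>

definition clift1 ::
    "nat set \<Rightarrow> nat set \<Rightarrow> (nat \<Rightarrow> nat) \<Rightarrow> (nat \<rightharpoonup> nat) set \<Rightarrow> (nat \<rightharpoonup> nat) set" where
  "clift1 C D f U = (\<Union>\<phi>\<in>U. cclass C (const_seq D) (\<lambda>i. map_option f (\<phi> i)))"

definition clift2 ::
    "nat set \<Rightarrow> nat set \<Rightarrow> (nat \<Rightarrow> nat \<Rightarrow> nat option) \<Rightarrow>
     (nat \<rightharpoonup> nat) set \<Rightarrow> (nat \<rightharpoonup> nat) set \<Rightarrow> (nat \<rightharpoonup> nat) set" where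
  "clift2 C D f U V = (\<Union>\<phi>\<in>U. \<Union>\<psi>\<in>V. cclass C (const_seq D)
     (\<lambda>i. Option.bind (\<phi> i) (\<lambda>x. Option.bind (\<psi> i) (f x))))"

definition clift_rel ::
    "nat set \<Rightarrow> (nat \<Rightarrow> nat \<Rightarrow> bool) \<Rightarrow> (nat \<rightharpoonup> nat) set \<Rightarrow> (nat \<rightharpoonup> nat) set \<Rightarrow> bool" where
  "clift_rel C P U V \<longleftrightarrow> (\<exists>\<phi>\<in>U. \<exists>\<psi>\<in>V.
     C \<subseteq>\<^sup>* {i. \<exists>x y. \<phi> i = Some x \<and> \<psi> i = Some y \<and> P x y})"

definition hyper_le :: "nat set \<Rightarrow> (nat \<rightharpoonup> nat) set \<Rightarrow> (nat \<rightharpoonup> nat) set \<Rightarrow> bool" where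
  "hyper_le C = clift_rel C (\<le>)"

definition standard_nats :: "nat set \<Rightarrow> (nat \<rightharpoonup> nat) set set" where
  "standard_nats C = range (cconst C UNIV)"


section \<open>The tree of finite tuples\<close>

definition tuples :: "nat set \<Rightarrow> nat set" where
  "tuples D = list_encode ` lists D"

definition tup_append :: "nat \<Rightarrow> nat \<Rightarrow> nat" where
  "tup_append a b = list_encode (list_decode a @ list_decode b)"

definition tup_prefix :: "nat \<Rightarrow> nat \<Rightarrow> bool" where
  "tup_prefix a b \<longleftrightarrow> prefix (list_decode a) (list_decode b)"

definition tup_arity :: "nat \<Rightarrow> nat" where
  "tup_arity a = length (list_decode a)"

abbreviation hyper_tuples :: "nat set \<Rightarrow> nat ring \<Rightarrow> (nat \<rightharpoonup> nat) set set" where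
  "hyper_tuples C K \<equiv> cpow C (tuples (carrier K))"

definition hyper_append ::
    "nat set \<Rightarrow> nat ring \<Rightarrow> (nat \<rightharpoonup> nat) set \<Rightarrow> (nat \<rightharpoonup> nat) set \<Rightarrow> (nat \<rightharpoonup> nat) set" where
  "hyper_append C K = clift2 C (tuples (carrier K)) (\<lambda>a b. Some (tup_append a b))"

definition hyper_prefix :: "nat set \<Rightarrow> (nat \<rightharpoonup> nat) set \<Rightarrow> (nat \<rightharpoonup> nat) set \<Rightarrow> bool" where
  "hyper_prefix C = clift_rel C tup_prefix"

definition hyper_arity :: "nat set \<Rightarrow> (nat \<rightharpoonup> nat) set \<Rightarrow> (nat \<rightharpoonup> nat) set" where
  "hyper_arity C = clift1 C UNIV tup_arity"

text \<open>Identification of elements of the power of K with hyper-tuples of arity 1.\<close>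

definition hyper_singleton :: "nat set \<Rightarrow> nat ring \<Rightarrow> (nat \<rightharpoonup> nat) set \<Rightarrow> (nat \<rightharpoonup> nat) set" where
  "hyper_singleton C K = clift1 C (tuples (carrier K)) (\<lambda>x. list_encode [x])"


section \<open>Integral hyper-polynomials\<close>

text \<open>
  Finitely supported sequences of numbers are numbered bijectively: a sequence is given by the
  list of its values up to the last non-zero one. This gives a bijective computable presentation
  of the polynomial ring over the integers on all of the natural numbers. A monomial m has the
  exponents fin_decode m, where position j holds the exponent of the variable number Suc j; a
  polynomial p has at the monomial m the coefficient int_decode (fin_decode p ! m). Note that
  int_decode maps 0 to 0.
\<close>

definition fin_decode :: "nat \<Rightarrow> nat list" where
  "fin_decode n = (let l = list_decode n in if l = [] then [] else butlast l @ [Suc (last l)])"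

lemma bij_betw_fin_decode: "bij_betw fin_decode UNIV {l. l = [] \<or> last l \<noteq> 0}"
proof (rule bij_betw_byWitness[where
      f' = "\<lambda>l. list_encode (if l = [] then [] else butlast l @ [last l - 1])"])
  show "\<forall>n\<in>UNIV. list_encode (if fin_decode n = [] then []
      else butlast (fin_decode n) @ [last (fin_decode n) - 1]) = n"
    by (auto simp: fin_decode_def Let_def) (metis list_decode_inverse list_encode.simps(1))
qed (auto simp: fin_decode_def Let_def)

definition poly_support :: "nat \<Rightarrow> nat set" where
  "poly_support p = {m. m < length (fin_decode p) \<and> fin_decode p ! m \<noteq> 0}"

definition poly_var :: "nat \<Rightarrow> nat" where
  "poly_var p = Max (insert 0 ((\<lambda>m. length (fin_decode m)) ` poly_support p))"

definition poly_eval :: "nat ring \<Rightarrow> nat \<Rightarrow> nat list \<Rightarrow> nat" where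
  "poly_eval K p a = (\<Oplus>\<^bsub>K\<^esub>m\<in>poly_support p.
     [int_decode (fin_decode p ! m)] \<cdot>\<^bsub>K\<^esub>
     (\<Otimes>\<^bsub>K\<^esub>j\<in>{..<length (fin_decode m)}. (a ! j) [^]\<^bsub>K\<^esub> (fin_decode m ! j)))"

definition hyper_var :: "nat set \<Rightarrow> (nat \<rightharpoonup> nat) set \<Rightarrow> (nat \<rightharpoonup> nat) set" where
  "hyper_var C = clift1 C UNIV poly_var"

definition hyper_eval ::
    "nat set \<Rightarrow> nat ring \<Rightarrow> (nat \<rightharpoonup> nat) set \<Rightarrow> (nat \<rightharpoonup> nat) set \<Rightarrow> (nat \<rightharpoonup> nat) set" where
  "hyper_eval C K = clift2 C (carrier K)
     (\<lambda>p a. if tup_arity a = poly_var p then Some (poly_eval K p (list_decode a)) else None)"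


section \<open>Hyper-automorphisms\<close>

text \<open>The hyper-tuples over F, as hyper-tuples over K.\<close>

definition hyper_tuples_base ::
    "nat set \<Rightarrow> nat ring \<Rightarrow> nat ring \<Rightarrow> (nat \<Rightarrow> nat) \<Rightarrow> (nat \<rightharpoonup> nat) set set" where
  "hyper_tuples_base C K F Psi =
     clift1 C (tuples (carrier K)) (\<lambda>a. list_encode (map Psi (list_decode a))) ` hyper_tuples C F"

definition HAut ::
    "nat set \<Rightarrow> nat ring \<Rightarrow> nat ring \<Rightarrow> (nat \<Rightarrow> nat) \<Rightarrow>
     ((nat \<rightharpoonup> nat) set \<Rightarrow> (nat \<rightharpoonup> nat) set) monoid" where
  "HAut C K F Psi = BijGroup (hyper_tuples C K)
     \<lparr>carrier := {\<sigma> \<in> Bij (hyper_tuples C K).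
        (\<forall>a\<in>hyper_tuples C K. \<forall>b\<in>hyper_tuples C K.
           (hyper_prefix C (\<sigma> a) (\<sigma> b) \<longleftrightarrow> hyper_prefix C a b) \<and>
           \<sigma> (hyper_append C K a b) = hyper_append C K (\<sigma> a) (\<sigma> b)) \<and>
        (\<forall>a\<in>hyper_tuples C K. hyper_arity C (\<sigma> a) = hyper_arity C a) \<and>
        (\<forall>p\<in>cpow C UNIV. \<forall>a\<in>hyper_tuples C K. hyper_arity C a = hyper_var C p \<longrightarrow>
           hyper_singleton C K (hyper_eval C K p (\<sigma> a))
             = \<sigma> (hyper_singleton C K (hyper_eval C K p a))) \<and>
        (\<forall>a\<in>hyper_tuples_base C K F Psi. \<sigma> a = a)}\<rparr>"


section \<open>The hyper-metric and infinitesimals\<close>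

text \<open>
  The product of the fields Ks (N i), as a subset of the power of K; N is an element of the power
  of the natural numbers. The sequence is partial, being defined where a representative of N is.
\<close>

definition hyper_subfield ::
    "nat set \<Rightarrow> nat ring \<Rightarrow> (nat \<Rightarrow> nat ring) \<Rightarrow> (nat \<Rightarrow> nat \<Rightarrow> nat) \<Rightarrow>
     (nat \<rightharpoonup> nat) set \<Rightarrow> (nat \<rightharpoonup> nat) set set" where
  "hyper_subfield C K Ks Psis N =
     {cclass C (const_seq (carrier K))
        (\<lambda>i. Option.bind (\<nu> i) (\<lambda>n. map_option (Psis n) (\<phi> i))) | \<nu> \<phi>.
        \<nu> \<in> N \<and> \<phi> \<in> cfuns C (\<lambda>i. map_option (\<lambda>n. carrier (Ks n)) (\<nu> i))}"

definition hyper_differ ::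
    "nat set \<Rightarrow> nat ring \<Rightarrow> (nat \<Rightarrow> nat ring) \<Rightarrow> (nat \<Rightarrow> nat \<Rightarrow> nat) \<Rightarrow>
     ((nat \<rightharpoonup> nat) set \<Rightarrow> (nat \<rightharpoonup> nat) set) \<Rightarrow> ((nat \<rightharpoonup> nat) set \<Rightarrow> (nat \<rightharpoonup> nat) set) \<Rightarrow>
     (nat \<rightharpoonup> nat) set \<Rightarrow> bool" where
  "hyper_differ C K Ks Psis \<sigma> \<tau> N \<longleftrightarrow>
     restrict \<sigma> (hyper_singleton C K ` hyper_subfield C K Ks Psis N)
       \<noteq> restrict \<tau> (hyper_singleton C K ` hyper_subfield C K Ks Psis N)"

text \<open>Rationals are presented by their reduced fractions.\<close>

definition rat_encode :: "rat \<Rightarrow> nat" where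
  "rat_encode q = (case quotient_of q of (a, b) \<Rightarrow> prod_encode (int_encode a, int_encode b))"

definition hyper_rat :: "nat set \<Rightarrow> rat \<Rightarrow> (nat \<rightharpoonup> nat) set" where
  "hyper_rat C q = cconst C (range rat_encode) (rat_encode q)"

text \<open>The element 1/2^N of the power of the rationals.\<close>

definition hyper_half_pow :: "nat set \<Rightarrow> (nat \<rightharpoonup> nat) set \<Rightarrow> (nat \<rightharpoonup> nat) set" where
  "hyper_half_pow C = clift1 C (range rat_encode) (\<lambda>n. rat_encode (1 / 2 ^ n))"

definition hyper_dist ::
    "nat set \<Rightarrow> nat ring \<Rightarrow> (nat \<Rightarrow> nat ring) \<Rightarrow> (nat \<Rightarrow> nat \<Rightarrow> nat) \<Rightarrow>
     ((nat \<rightharpoonup> nat) set \<Rightarrow> (nat \<rightharpoonup> nat) set) \<Rightarrow> ((nat \<rightharpoonup> nat) set \<Rightarrow> (nat \<rightharpoonup> nat) set) \<Rightarrow>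
     (nat \<rightharpoonup> nat) set" where
  "hyper_dist C K Ks Psis \<sigma> \<tau> = (if \<sigma> = \<tau> then hyper_rat C 0 else
     hyper_half_pow C (THE N. N \<in> cpow C UNIV \<and> hyper_differ C K Ks Psis \<sigma> \<tau> N \<and>
       (\<forall>M\<in>cpow C UNIV. hyper_differ C K Ks Psis \<sigma> \<tau> M \<longrightarrow> hyper_le C N M)))"

definition hyper_INF ::
    "nat set \<Rightarrow> nat ring \<Rightarrow> nat ring \<Rightarrow> (nat \<Rightarrow> nat) \<Rightarrow>
     (nat \<Rightarrow> nat ring) \<Rightarrow> (nat \<Rightarrow> nat \<Rightarrow> nat) \<Rightarrow> ((nat \<rightharpoonup> nat) set \<Rightarrow> (nat \<rightharpoonup> nat) set) set" where
  "hyper_INF C K F Psi Ks Psis = {\<sigma> \<in> carrier (HAut C K F Psi).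
     \<sigma> = \<one>\<^bsub>HAut C K F Psi\<^esub> \<or>
     (\<exists>N \<in> cpow C UNIV - standard_nats C.
        hyper_dist C K Ks Psis \<one>\<^bsub>HAut C K F Psi\<^esub> \<sigma> = hyper_half_pow C N)}"

text \<open>
  The metric induced on cosets: the hyper-distance of any two representatives of distinct cosets
  is one and the same standard value 1/2^n.
\<close>

definition is_coset_dist ::
    "nat set \<Rightarrow> nat ring \<Rightarrow> (nat \<Rightarrow> nat ring) \<Rightarrow> (nat \<Rightarrow> nat \<Rightarrow> nat) \<Rightarrow>
     ((nat \<rightharpoonup> nat) set \<Rightarrow> (nat \<rightharpoonup> nat) set) set \<Rightarrow> ((nat \<rightharpoonup> nat) set \<Rightarrow> (nat \<rightharpoonup> nat) set) set \<Rightarrow>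
     real \<Rightarrow> bool" where
  "is_coset_dist C K Ks Psis S T r \<longleftrightarrow>
     (if S = T then r = 0
      else \<exists>n::nat. r = 1 / 2 ^ n \<and>
             (\<forall>\<sigma>\<in>S. \<forall>\<tau>\<in>T. hyper_dist C K Ks Psis \<sigma> \<tau> = hyper_rat C (1 / 2 ^ n)))"

end

theory Submission
  imports Defs
begin

text \<open>
  A hyper-automorphism \<open>\<sigma>\<close> acts on the product of the fields \<open>K\<^bsub>N(i)\<^esub>\<close> like an element of
  the product of the finite groups \<open>G\<^bsub>N(i)\<^esub>\<close>. Indeed, at almost every index a generator of
  \<open>K\<^bsub>N(i)\<^esub>\<close> over F goes to one of its conjugates, because otherwise polynomials over F that
  vanish at the generator but not at its image could be found by search, and the hyper-polynomial
  formed by them would not be preserved; and every other element is a polynomial in the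
  generator. At a standard level cohesiveness makes the group element constant, so \<open>\<sigma>\<close>
  restricts to an element of Gal(K/F). The kernel of restriction is INF: if \<open>\<sigma>\<close> is not
  the identity, the first level at which its group element is nontrivial can be computed from the
  index and is the exponent of the distance to the identity, and this exponent is nonstandard
  precisely if \<open>\<sigma>\<close> fixes K. Two hyper-automorphisms with distinct restrictions first differ
  at a standard level, which makes the induced map on the quotient an isometry. Finally, the
  restriction maps between the groups \<open>G\<^bsub>n\<^esub>\<close> are onto, so an element of \<open>G\<^bsub>n\<^esub>\<close>
  extends, by successive search, to a computable automorphism of K. Applied pointwise to tuples
  it is a hyper-automorphism, whence the image of restriction is dense.
\<close>

section \<open>Closure properties of partial and total recursive functions and of decidable
  predicates\<close>

section \<open>Recursive functions\<close>

text \<open>Two obstacles shape the proof. The degrees of the fields vary with the index, so a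
  polynomial over F relating two elements has a coefficient list of possibly nonstandard length,
  while \<open>\<sigma>\<close> is only known to respect integral hyper-polynomials. The
  coefficients therefore become further entries of a tuple: \<open>\<sigma>\<close> respects
  concatenation and fixes tuples over F, so integral polynomials with the coefficients as extra
  variables replace polynomials over F. Moreover, everything used against \<open>\<sigma>\<close>
  must be a single partial recursive function. Each choice (generator, conjugating group element,
  polynomial, first nontrivial level, moved element) is thus an unbounded search for a decidable
  property, and cohesiveness gives the step from failing to hold at almost every index to failing at
  almost every index. For decidability the given operations get default values, the identity of a
  group is recognized as its only idempotent, and a generator is found as an element with trivial
  stabilizer, a condition on a computable finite list of group elements.\<close>

abbreviation pfst :: "nat \<Rightarrow> nat" where "pfst z \<equiv> fst (prod_decode z)"
abbreviation psnd :: "nat \<Rightarrow> nat" where "psnd z \<equiv> snd (prod_decode z)"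

definition trec :: "(nat \<Rightarrow> nat) \<Rightarrow> bool" where
  "trec f \<longleftrightarrow> partrec (\<lambda>n. Some (f n))"

definition tdec :: "(nat \<Rightarrow> bool) \<Rightarrow> bool" where
  "tdec P \<longleftrightarrow> trec (\<lambda>n. if P n then 1 else 0)"

text \<open>These closure rules follow the shape of the term, so recursiveness of a concrete
  expression is proved by applying them repeatedly. Extra arguments are packed into one number
  \<open>z\<close> and read back with \<open>pfst z\<close> and \<open>psnd z\<close>.\<close>

named_theorems rec_intros

lemma partrec_compose:
  assumes "partrec f" "trec g"
  shows "partrec (\<lambda>n. f (g n))"
  using partrec.comp[OF assms(1) assms(2)[unfolded trec_def]] by simp

lemma trec_compose:
  assumes "trec f" "trec g"
  shows "trec (\<lambda>n. f (g n))"
  using partrec_compose[of "\<lambda>n. Some (f n)" g] assms by (simp add: trec_def)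

lemma trec_pair [rec_intros]:
  assumes "trec f" "trec g"
  shows "trec (\<lambda>n. prod_encode (f n, g n))"
  using partrec.pair[of "\<lambda>n. Some (f n)" "\<lambda>n. Some (g n)"] assms by (simp add: trec_def)

lemma trec_pfst [rec_intros]: "trec f \<Longrightarrow> trec (\<lambda>n. pfst (f n))"
  by (rule trec_compose) (simp_all add: trec_def partrec.left)

lemma trec_psnd [rec_intros]: "trec f \<Longrightarrow> trec (\<lambda>n. psnd (f n))"
  by (rule trec_compose) (simp_all add: trec_def partrec.right)

lemma trec_Suc [rec_intros]: "trec f \<Longrightarrow> trec (\<lambda>n. Suc (f n))"
  by (rule trec_compose) (simp_all add: trec_def partrec.succ)

text \<open>The identity is not a basic function; it is the pairing of the two projections.\<close>

lemma trec_id [rec_intros]: "trec (\<lambda>n. n)"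
proof -
  have "trec (\<lambda>n. prod_encode (pfst n, psnd n))"
    using partrec.pair[OF partrec.left partrec.right] by (simp add: trec_def)
  then show ?thesis by simp
qed

lemma trec_const [rec_intros]: "trec (\<lambda>_. k)"
proof (induction k)
  case 0
  then show ?case by (simp add: trec_def partrec.zero)
next
  case (Suc k)
  then show ?case by (rule trec_Suc)
qed

text \<open>The recursion clause expects parameter and number of steps in one pair. Composing it
  with the map from \<open>n\<close> to the pair of \<open>n\<close> and \<open>a n\<close> lets the
  number of steps depend on the parameter.\<close>

lemma partrec_rec:
  assumes "partrec f" "partrec (\<lambda>z. g (pfst z) (pfst (psnd z)) (psnd (psnd z)))" "trec a"
  shows "partrec (\<lambda>n. rec_nat (f n) (\<lambda>y r. Option.bind r (g n y)) (a n))"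
  using partrec_compose[OF partrec.prec[OF assms(1,2)] trec_pair[OF trec_id assms(3)]]
  by (simp cong: Option.bind_cong)

lemma trec_rec [rec_intros]:
  assumes "trec f" "trec (\<lambda>z. g (pfst z) (pfst (psnd z)) (psnd (psnd z)))" "trec a"
  shows "trec (\<lambda>n. rec_nat (f n) (\<lambda>y v. g n y v) (a n))"
proof -
  have "rec_nat (Some (f n)) (\<lambda>y r. Option.bind r (\<lambda>v. Some (g n y v))) k
      = Some (rec_nat (f n) (\<lambda>y v. g n y v) k)" for n k
    by (induction k) auto
  then show ?thesis
    using partrec_rec[of "\<lambda>n. Some (f n)" "\<lambda>n y v. Some (g n y v)" a] assms
    by (simp add: trec_def)
qed

lemma trec_add [rec_intros]:
  assumes "trec f" "trec g"
  shows "trec (\<lambda>n. f n + g n)"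
proof -
  have "rec_nat a (\<lambda>y v. Suc v) b = a + b" for a b :: nat
    by (induction b) auto
  moreover have "trec (\<lambda>n. rec_nat (f n) (\<lambda>y v. Suc v) (g n))"
    by (intro rec_intros assms)
  ultimately show ?thesis by simp
qed

lemma trec_mult [rec_intros]:
  assumes "trec f" "trec g"
  shows "trec (\<lambda>n. f n * g n)"
proof -
  have "rec_nat 0 (\<lambda>y v. v + a) b = a * b" for a b :: nat
    by (induction b) auto
  moreover have "trec (\<lambda>n. rec_nat 0 (\<lambda>y v. v + f n) (g n))"
    by (intro rec_intros assms trec_compose[OF assms(1)])
  ultimately show ?thesis by simp
qed

lemma trec_diff [rec_intros]:
  assumes "trec f" "trec g"
  shows "trec (\<lambda>n. f n - g n)"
proof -
  have p: "rec_nat 0 (\<lambda>y v. y) b = b - 1" for b :: nat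
    by (cases b) auto
  have "trec (\<lambda>n. rec_nat 0 (\<lambda>y v. y) n)"
    by (intro rec_intros)
  then have pred: "trec (\<lambda>n. n - 1)" by (simp add: p)
  have "trec (\<lambda>n. rec_nat (f n) (\<lambda>y v. v - 1) (g n))"
    by (intro rec_intros assms trec_compose[OF pred])
  moreover have "rec_nat a (\<lambda>y v. v - 1) b = a - b" for a b :: nat
    by (induction b) auto
  ultimately show ?thesis by simp
qed

lemma tdec_not [rec_intros]: assumes "tdec P" shows "tdec (\<lambda>n. \<not> P n)"
proof -
  have "trec (\<lambda>n. 1 - (if P n then 1 else 0))"
    using assms unfolding tdec_def by (intro rec_intros)
  moreover have "(\<lambda>n. 1 - (if P n then 1 else 0)) = (\<lambda>n. if \<not> P n then 1 else (0::nat))"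
    by auto
  ultimately show ?thesis unfolding tdec_def by simp
qed

lemma tdec_conj [rec_intros]: assumes "tdec P" "tdec Q" shows "tdec (\<lambda>n. P n \<and> Q n)"
proof -
  have "trec (\<lambda>n. (if P n then 1 else 0) * (if Q n then 1 else 0))"
    using assms unfolding tdec_def by (intro rec_intros)
  moreover have "(\<lambda>n. (if P n then 1 else 0) * (if Q n then 1 else 0))
      = (\<lambda>n. if P n \<and> Q n then 1 else (0::nat))"
    by auto
  ultimately show ?thesis unfolding tdec_def by simp
qed

lemma tdec_disj [rec_intros]: assumes "tdec P" "tdec Q" shows "tdec (\<lambda>n. P n \<or> Q n)"
proof -
  have "tdec (\<lambda>n. \<not> (\<not> P n \<and> \<not> Q n))" by (intro rec_intros assms)
  then show ?thesis by simp
qed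

lemma tdec_imp [rec_intros]: assumes "tdec P" "tdec Q" shows "tdec (\<lambda>n. P n \<longrightarrow> Q n)"
proof -
  have "tdec (\<lambda>n. \<not> P n \<or> Q n)" by (intro rec_intros assms)
  then show ?thesis by (simp only: imp_conv_disj)
qed

lemma tdec_le [rec_intros]: assumes "trec f" "trec g" shows "tdec (\<lambda>n. f n \<le> g n)"
proof -
  have "trec (\<lambda>n. 1 - (f n - g n))" by (intro rec_intros assms)
  moreover have "(\<lambda>n. 1 - (f n - g n)) = (\<lambda>n. if f n \<le> g n then 1 else (0::nat))"
    by auto
  ultimately show ?thesis unfolding tdec_def by simp
qed

lemma tdec_less [rec_intros]: assumes "trec f" "trec g" shows "tdec (\<lambda>n. f n < g n)"
proof -
  have "tdec (\<lambda>n. \<not> g n \<le> f n)" by (intro rec_intros assms)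
  then show ?thesis by (simp add: not_le)
qed

lemma tdec_eq [rec_intros]: assumes "trec f" "trec g" shows "tdec (\<lambda>n. f n = g n)"
proof -
  have "tdec (\<lambda>n. f n \<le> g n \<and> g n \<le> f n)" by (intro rec_intros assms)
  then show ?thesis by (simp add: eq_iff)
qed

lemma tdec_const [rec_intros]: "tdec (\<lambda>_. b)"
  unfolding tdec_def by (rule trec_const)

lemma tdec_compose:
  assumes "tdec P" "trec g"
  shows "tdec (\<lambda>n. P (g n))"
  using trec_compose[OF assms(1)[unfolded tdec_def] assms(2)] unfolding tdec_def .

lemma tdec_compose2:
  assumes "tdec (\<lambda>z. P (pfst z) (psnd z))" "trec f" "trec g"
  shows "tdec (\<lambda>n. P (f n) (g n))"
  using tdec_compose[OF assms(1) trec_pair[OF assms(2,3)]] by simp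

lemma trec_compose2:
  assumes "trec (\<lambda>z. h (pfst z) (psnd z))" "trec f" "trec g"
  shows "trec (\<lambda>n. h (f n) (g n))"
  using trec_compose[OF assms(1) trec_pair[OF assms(2,3)]] by simp

text \<open>The branch not taken may diverge and must not be run. Each branch is therefore the step
  of a recursion of length 0 or 1 that starts from \<open>Some 0\<close>; length 0 returns 0, and
  the two results are added.\<close>

lemma partrec_if:
  assumes "tdec P" "partrec f" "partrec g"
  shows "partrec (\<lambda>n. if P n then f n else g n)"
proof -
  have P: "trec (\<lambda>n. if P n then 1 else 0)" using assms(1) by (simp add: tdec_def)
  have nP: "trec (\<lambda>n. if P n then 0 else 1)"
    using trec_diff[OF trec_const P, of 1] by (rule back_subst[of trec]) auto
  let ?h = "\<lambda>f a n. rec_nat (Some 0) (\<lambda>y r. Option.bind r (\<lambda>v. f n)) (a n)"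
  have h: "partrec (?h f a)" if "partrec f" "trec a" for f a
    by (intro partrec_rec partrec_compose[OF that(1)] rec_intros that(2) partrec.zero)
  have add: "partrec (\<lambda>z. Some (pfst z + psnd z))"
    using trec_add[OF trec_pfst[OF trec_id] trec_psnd[OF trec_id]] by (simp add: trec_def)
  have "partrec (\<lambda>n. Option.bind (Option.bind (?h f (\<lambda>n. if P n then 1 else 0) n)
     (\<lambda>a. Option.bind (?h g (\<lambda>n. if P n then 0 else 1) n) (\<lambda>b. Some (prod_encode (a, b)))))
     (\<lambda>z. Some (pfst z + psnd z)))"
    by (intro partrec.comp add partrec.pair h assms(2,3) P nP)
  then show ?thesis
  proof (rule back_subst[of partrec], intro ext)
    fix n
    show "Option.bind (Option.bind (?h f (\<lambda>n. if P n then 1 else 0) n)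
     (\<lambda>a. Option.bind (?h g (\<lambda>n. if P n then 0 else 1) n) (\<lambda>b. Some (prod_encode (a, b)))))
     (\<lambda>z. Some (pfst z + psnd z)) = (if P n then f n else g n)"
      by (cases "f n"; cases "g n"; cases "P n") simp_all
  qed
qed

lemma trec_if [rec_intros]:
  assumes "tdec P" "trec f" "trec g"
  shows "trec (\<lambda>n. if P n then f n else g n)"
  using partrec_if[OF assms(1), of "\<lambda>n. Some (f n)" "\<lambda>n. Some (g n)"] assms
  unfolding trec_def by (auto elim!: back_subst[of partrec])

lemma tdec_all_less [rec_intros]:
  assumes "tdec (\<lambda>z. P (pfst z) (psnd z))" "trec a"
  shows "tdec (\<lambda>n. \<forall>y<a n. P n y)"
proof -
  have "tdec (\<lambda>z. P (pfst z) (pfst (psnd z)))"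
    by (intro tdec_compose2[OF assms(1)] rec_intros)
  then have "trec (\<lambda>n. rec_nat 1 (\<lambda>y v. if P n y then v else 0) (a n))"
    by (intro rec_intros assms)
  moreover have "rec_nat (1::nat) (\<lambda>y v. if P n y then v else 0) k = (if \<forall>y<k. P n y then 1 else 0)" for n k
    by (induction k) (auto simp: less_Suc_eq)
  ultimately show ?thesis unfolding tdec_def by (simp only:)
qed

lemma tdec_ex_less [rec_intros]:
  assumes "tdec (\<lambda>z. P (pfst z) (psnd z))" "trec a"
  shows "tdec (\<lambda>n. \<exists>y<a n. P n y)"
proof -
  have "tdec (\<lambda>n. \<not> (\<forall>y<a n. \<not> P n y))" by (intro rec_intros assms)
  then show ?thesis by simp
qed

lemma partrec_search:
  assumes "tdec (\<lambda>z. P (pfst z) (psnd z))"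
  shows "partrec (\<lambda>n. if \<exists>m. P n m then Some (LEAST m. P n m) else None)"
proof -
  \<comment> \<open>\<open>search\<close> looks for the value 0, so truth is coded by 0 here,
    contrary to \<open>tdec\<close>.\<close>
  define c where "c z = (if P (pfst z) (psnd z) then 0 else 1 :: nat)" for z
  have c: "c (prod_encode (a, m)) = 0 \<longleftrightarrow> P a m" for a m
    by (simp add: c_def)
  have "partrec (\<lambda>z. Some (c z))"
    using trec_if[OF assms trec_const trec_const] by (simp add: trec_def c_def)
  from partrec.search[OF this] show ?thesis
    by (simp add: c cong: if_cong)
qed

lemma trec_search:
  assumes "tdec (\<lambda>z. P (pfst z) (psnd z))" "\<And>n. \<exists>m. P n m"
  shows "trec (\<lambda>n. LEAST m. P n m)"
  using partrec_search[OF assms(1)] assms(2) by (simp add: trec_def)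

text \<open>The value can be searched for once the graph is decidable. This avoids explicit
  recursions for functions on list codes.\<close>

lemma trec_graph:
  assumes "tdec (\<lambda>z. P (pfst z) (psnd z))" "\<And>n m. P n m \<longleftrightarrow> m = f n"
  shows "trec f"
proof -
  have "trec (\<lambda>n. LEAST m. P n m)"
    by (rule trec_search[OF assms(1)]) (simp add: assms(2))
  moreover have "(LEAST m. P n m) = f n" for n
    by (simp add: assms(2) Least_equality)
  ultimately show ?thesis by simp
qed

lemma trec_max [rec_intros]:
  assumes "trec f" "trec g" shows "trec (\<lambda>n. max (f n) (g n))"
  unfolding max_def by (intro rec_intros assms)

lemma trec_div2 [rec_intros]: assumes "trec f" shows "trec (\<lambda>n. f n div 2)"
proof (rule trec_compose[OF _ assms])
  show "trec (\<lambda>n. n div 2)"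
  proof (rule trec_graph)
    show "tdec (\<lambda>z. (psnd z + psnd z \<le> pfst z) \<and> pfst z \<le> Suc (psnd z + psnd z))"
      by (intro rec_intros)
  qed auto
qed

lemma tdec_even [rec_intros]: assumes "trec f" shows "tdec (\<lambda>n. even (f n))"
proof -
  have "tdec (\<lambda>n. f n div 2 + f n div 2 = f n)" by (intro rec_intros assms)
  moreover have "k div 2 + k div 2 = k \<longleftrightarrow> even k" for k :: nat
    by presburger
  ultimately show ?thesis by simp
qed

text \<open>The guard \<open>P\<close> selects inputs whose code \<open>h n\<close> stands for an
  element of the domain; elsewhere the default 0 is returned and, by \<open>partrec_if\<close>, the
  possibly divergent \<open>\<phi>\<close> is not run.\<close>

lemma computable_on_trec:
  assumes "computable_on e D f" "trec h" "tdec P" "\<And>n. P n \<Longrightarrow> h n = e (x n) \<and> x n \<in> D"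
  shows "trec (\<lambda>n. if P n then f (x n) else 0)"
proof -
  obtain \<phi> where \<phi>: "partrec \<phi>" "\<And>x. x \<in> D \<Longrightarrow> \<phi> (e x) = Some (f x)"
    using assms(1) unfolding computable_on_def by blast
  have "partrec (\<lambda>n. if P n then \<phi> (h n) else Some 0)"
    by (intro partrec_if assms partrec_compose[OF \<phi>(1)] partrec.zero)
  then show ?thesis
    unfolding trec_def by (rule back_subst[of partrec]) (auto simp: fun_eq_iff \<phi>(2) assms(4))
qed

lemma computable_set_tdec:
  assumes "computable_set e D" "trec h" "\<And>n. h n = e (x n)"
  shows "tdec (\<lambda>n. x n \<in> D)"
proof -
  have "trec (\<lambda>n. if True then (if x n \<in> D then 1 else 0) else 0)"
    by (rule computable_on_trec[where f = "\<lambda>x. if x \<in> D then 1 else 0", OF _ assms(2) tdec_const])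
      (use assms in \<open>auto simp: computable_set_def\<close>)
  then show ?thesis by (simp add: tdec_def)
qed

subsection \<open>Lists\<close>

text \<open>The code of a nonempty list is the successor of the pair of its head and the code of its
  tail. At 0, the code of the empty list, truncated subtraction gives 0 again.\<close>

abbreviation ltl :: "nat \<Rightarrow> nat" where "ltl a \<equiv> psnd (a - 1)"

definition lnth :: "nat \<Rightarrow> nat \<Rightarrow> nat" where
  "lnth a j = (if j < length (list_decode a) then list_decode a ! j else 0)"

lemma prod_decode_0: "prod_decode 0 = (0, 0)"
  using prod_encode_inverse[of "(0, 0)"] by (simp add: prod_encode_def)

lemma list_decode_ltl: "list_decode (ltl a) = tl (list_decode a)"
  by (cases a) (auto simp: prod_decode_0 split: prod.split)

lemma list_decode_iter: "list_decode (rec_nat a (\<lambda>_ v. ltl v) j) = drop j (list_decode a)"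
proof (induction j)
  case (Suc j)
  then show ?case by (simp add: list_decode_ltl drop_Suc tl_drop del: One_nat_def)
qed simp

lemma list_decode_eq_Nil: "list_decode a = [] \<longleftrightarrow> a = 0"
  by (cases a) (auto split: prod.split)

lemma trec_lnth [rec_intros]:
  assumes "trec f" "trec g"
  shows "trec (\<lambda>n. lnth (f n) (g n))"
proof -
  have "trec (\<lambda>n. pfst (rec_nat (f n) (\<lambda>_ v. ltl v) (g n) - 1))"
    by (intro rec_intros assms)
  moreover have hd: "pfst (b - 1) = (if list_decode b = [] then 0 else hd (list_decode b))" for b
    by (cases b) (auto simp: prod_decode_0 split: prod.split)
  have "pfst (rec_nat a (\<lambda>_ v. ltl v) j - 1) = lnth a j" for a j
    unfolding hd list_decode_iter lnth_def by (auto simp: hd_drop_conv_nth)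
  ultimately show ?thesis by simp
qed

lemma trec_length [rec_intros]:
  assumes "trec f"
  shows "trec (\<lambda>n. length (list_decode (f n)))"
proof -
  \<comment> \<open>The length is the least number of tails after which the code is 0.\<close>
  have "trec (\<lambda>n. LEAST j. rec_nat (f n) (\<lambda>_ v. ltl v) j = 0)"
  proof (rule trec_search)
    show "tdec (\<lambda>z. rec_nat (f (pfst z)) (\<lambda>_ v. ltl v) (psnd z) = 0)"
      by (intro rec_intros trec_compose[OF assms])
    show "\<exists>j. rec_nat (f n) (\<lambda>_ v. ltl v) j = 0" for n
      by (rule exI[of _ "length (list_decode (f n))"])
        (simp add: list_decode_iter flip: list_decode_eq_Nil del: One_nat_def)
  qed
  moreover have "(LEAST j. rec_nat a (\<lambda>_ v. ltl v) j = 0) = length (list_decode a)" for a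
    by (rule Least_equality)
      (simp_all add: list_decode_iter flip: list_decode_eq_Nil del: One_nat_def)
  ultimately show ?thesis by simp
qed

lemma tdec_ball_list [rec_intros]:
  assumes "tdec (\<lambda>z. P (pfst z) (psnd z))" "trec a"
  shows "tdec (\<lambda>n. \<forall>x\<in>set (list_decode (a n)). P n x)"
proof -
  have "tdec (\<lambda>z. P (pfst z) (lnth (a (pfst z)) (psnd z)))"
    by (intro tdec_compose2[OF assms(1)] rec_intros trec_compose[OF assms(2)])
  then have "tdec (\<lambda>n. \<forall>j<length (list_decode (a n)). P n (lnth (a n) j))"
    by (intro rec_intros assms(2))
  then show ?thesis
    by (rule back_subst[of tdec]) (auto simp: fun_eq_iff all_set_conv_all_nth lnth_def)
qed

lemma trec_append [rec_intros]:
  assumes "trec f" "trec g"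
  shows "trec (\<lambda>n. list_encode (list_decode (f n) @ list_decode (g n)))"
proof (rule trec_graph)
  let ?P = "\<lambda>n m. length (list_decode m) = length (list_decode (f n)) + length (list_decode (g n)) \<and>
     (\<forall>j<length (list_decode m). lnth m j =
        (if j < length (list_decode (f n)) then lnth (f n) j
         else lnth (g n) (j - length (list_decode (f n)))))"
  show "tdec (\<lambda>z. ?P (pfst z) (psnd z))"
    by (intro rec_intros trec_compose[OF assms(1)] trec_compose[OF assms(2)])
  show "?P n m \<longleftrightarrow> m = list_encode (list_decode (f n) @ list_decode (g n))" for n m
  proof -
    have "?P n m \<longleftrightarrow> list_decode m = list_decode (f n) @ list_decode (g n)"
      by (auto simp: lnth_def list_eq_iff_nth_eq nth_append)
    also have "\<dots> \<longleftrightarrow> m = list_encode (list_decode (f n) @ list_decode (g n))"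
      by (metis list_decode_inverse list_encode_inverse)
    finally show ?thesis .
  qed
qed

lemma trec_map:
  assumes "trec (\<lambda>z. h (pfst z) (psnd z))" "trec f"
  shows "trec (\<lambda>n. list_encode (map (h n) (list_decode (f n))))"
proof (rule trec_graph)
  let ?P = "\<lambda>n m. length (list_decode m) = length (list_decode (f n)) \<and>
     (\<forall>j<length (list_decode m). lnth m j = h n (lnth (f n) j))"
  have "trec (\<lambda>z. h (pfst (pfst z)) (lnth (f (pfst (pfst z))) (psnd z)))"
    by (intro trec_compose2[OF assms(1)] rec_intros trec_compose[OF assms(2)])
  then show "tdec (\<lambda>z. ?P (pfst z) (psnd z))"
    by (intro rec_intros trec_compose[OF assms(2)])
  show "?P n m \<longleftrightarrow> m = list_encode (map (h n) (list_decode (f n)))" for n m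
  proof -
    have "?P n m \<longleftrightarrow> list_decode m = map (h n) (list_decode (f n))"
      by (auto simp: lnth_def list_eq_iff_nth_eq)
    also have "\<dots> \<longleftrightarrow> m = list_encode (map (h n) (list_decode (f n)))"
      by (metis list_decode_inverse list_encode_inverse)
    finally show ?thesis .
  qed
qed

section \<open>Computable evaluation of integral polynomials, and polynomials with generic
  coefficients\<close>

section \<open>Codes of integral polynomials\<close>

text \<open>Entry \<open>m\<close> of \<open>fin_decode p\<close>, read off the list code itself:
  decoding raises the last entry by one, and entries beyond the length count as 0.\<close>

definition fcoef :: "nat \<Rightarrow> nat \<Rightarrow> nat" where
  "fcoef p m = (if m < length (list_decode p)
     then if Suc m = length (list_decode p) then Suc (lnth p m) else lnth p m else 0)"

lemma length_fin_decode: "length (fin_decode n) = length (list_decode n)"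
  by (auto simp: fin_decode_def Let_def)

lemma fin_decode_nth: "m < length (fin_decode p) \<Longrightarrow> fin_decode p ! m = fcoef p m"
  by (cases "Suc m = length (list_decode p)")
    (auto simp: fin_decode_def Let_def fcoef_def lnth_def nth_append nth_butlast last_conv_nth
      dest: arg_cong[where f = "\<lambda>k. k - 1"])

lemma poly_support_fcoef: "poly_support p = {m. m < length (list_decode p) \<and> fcoef p m \<noteq> 0}"
  unfolding poly_support_def using fin_decode_nth by (auto simp: length_fin_decode)

lemma trec_fcoef [rec_intros]: "trec f \<Longrightarrow> trec g \<Longrightarrow> trec (\<lambda>n. fcoef (f n) (g n))"
  unfolding fcoef_def by (intro rec_intros)

lemma finite_poly_support [simp]: "finite (poly_support p)"
  by (simp add: poly_support_def)

text \<open>A running maximum over all positions, skipping those outside the support, is a primitive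
  recursion.\<close>

lemma poly_var_eq_rec:
  "poly_var p = rec_nat 0 (\<lambda>m v. if fcoef p m \<noteq> 0 then max v (length (list_decode m)) else v)
     (length (list_decode p))"
proof -
  have "rec_nat 0 (\<lambda>m v. if fcoef p m \<noteq> 0 then max v (length (list_decode m)) else v) k
      = Max (insert 0 ((\<lambda>m. length (list_decode m)) ` {m. m < k \<and> fcoef p m \<noteq> 0}))" for k
  proof (induction k)
    case (Suc k)
    have "{m. m < Suc k \<and> fcoef p m \<noteq> 0} =
      (if fcoef p k \<noteq> 0 then insert k {m. m < k \<and> fcoef p m \<noteq> 0} else {m. m < k \<and> fcoef p m \<noteq> 0})"
      by (auto simp: less_Suc_eq)
    with Suc show ?case
      by (simp add: insert_commute[of 0] max.commute)
  qed simp
  then show ?thesis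
    by (simp add: poly_var_def poly_support_fcoef length_fin_decode)
qed

lemma trec_poly_var [rec_intros]:
  assumes "trec f" shows "trec (\<lambda>n. poly_var (f n))"
  unfolding poly_var_eq_rec by (intro rec_intros assms trec_compose[OF assms])

lemma length_le_poly_var: "m \<in> poly_support p \<Longrightarrow> length (list_decode m) \<le> poly_var p"
  unfolding poly_var_def length_fin_decode by (intro Max_ge) auto

definition tpoly_eval :: "nat ring \<Rightarrow> nat \<Rightarrow> nat \<Rightarrow> nat" where
  "tpoly_eval K p a = (if set (list_decode a) \<subseteq> carrier K \<and> length (list_decode a) = poly_var p
     then poly_eval K p (list_decode a) else 0)"

lemma int_decode_cases:
  "int_decode c = (if even c then int (c div 2) else - int (Suc (c div 2)))"
  by (auto simp: int_decode_def sum_decode_def)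

lemma (in comm_monoid) finprod_lessThan_rec:
  assumes "f \<in> {..<n::nat} \<rightarrow> carrier G"
  shows "finprod G f {..<n} = rec_nat \<one> (\<lambda>j v. v \<otimes> f j) n"
  using assms
proof (induction n)
  case (Suc n)
  then have f: "f \<in> {..<n} \<rightarrow> carrier G" "f n \<in> carrier G" by auto
  then show ?case
    using Suc.IH finprod_closed[OF f(1)] by (simp add: lessThan_Suc finprod_insert m_comm)
qed simp

text \<open>The auxiliary \<open>zm\<close>, \<open>mon\<close> and \<open>pe\<close> are nested
  primitive recursions for integer multiples, monomials and the whole sum. They agree with the
  algebraic expressions on tuples over K of the right length, and this condition is what
  \<open>tpoly_eval\<close> tests.\<close>

lemma trec_tpoly_eval:
  assumes "computable_field K"
  shows "trec (\<lambda>z. tpoly_eval K (pfst z) (psnd z))"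
proof -
  note K = assms[unfolded computable_field_def uniformly_computable_fields_def]
  interpret field K using K by blast
  have mem: "tdec (\<lambda>n. f n \<in> carrier K)" if "trec f" for f
  proof -
    have "tdec (\<lambda>n. (0, f n) \<in> {(i::nat, x). x \<in> carrier K})"
      by (rule computable_set_tdec[where h = "\<lambda>n. prod_encode (0, f n)"])
        (use K that in \<open>auto intro!: rec_intros\<close>)
    then show ?thesis by simp
  qed
  define A where "A x y = (if x \<in> carrier K \<and> y \<in> carrier K then x \<oplus>\<^bsub>K\<^esub> y else 0)" for x y
  define M where "M x y = (if x \<in> carrier K \<and> y \<in> carrier K then x \<otimes>\<^bsub>K\<^esub> y else 0)" for x y
  have MK: "M x y = x \<otimes>\<^bsub>K\<^esub> y" if "x \<in> carrier K" "y \<in> carrier K" for x y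
    using that by (simp add: M_def)
  \<comment> \<open>A computable field is presented without negation, so the additive inverse is
    searched for; off the carrier the first disjunct keeps the search total.\<close>
  define neg where "neg x = (LEAST y. x \<notin> carrier K \<or> y \<in> carrier K \<and> A x y = \<zero>\<^bsub>K\<^esub>)" for x
  have trA: "trec (\<lambda>n. A (f n) (g n))" if "trec f" "trec g" for f g
  proof -
    have "trec (\<lambda>n. if f n \<in> carrier K \<and> g n \<in> carrier K
      then (case (0::nat, f n, g n) of (i, x, y) \<Rightarrow> x \<oplus>\<^bsub>K\<^esub> y) else 0)"
      by (rule computable_on_trec[where h = "\<lambda>n. prod_encode (0, prod_encode (f n, g n))"
            and D = "{(i::nat, x, y). x \<in> carrier K \<and> y \<in> carrier K}" and e = triple_encode])
        (use K that in \<open>auto intro!: rec_intros mem simp: triple_encode_def\<close>)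
    then show ?thesis unfolding A_def by (simp only: prod.case)
  qed
  have trM: "trec (\<lambda>n. M (f n) (g n))" if "trec f" "trec g" for f g
  proof -
    have "trec (\<lambda>n. if f n \<in> carrier K \<and> g n \<in> carrier K
      then (case (0::nat, f n, g n) of (i, x, y) \<Rightarrow> x \<otimes>\<^bsub>K\<^esub> y) else 0)"
      by (rule computable_on_trec[where h = "\<lambda>n. prod_encode (0, prod_encode (f n, g n))"
            and D = "{(i::nat, x, y). x \<in> carrier K \<and> y \<in> carrier K}" and e = triple_encode])
        (use K that in \<open>auto intro!: rec_intros mem simp: triple_encode_def\<close>)
    then show ?thesis unfolding M_def by (simp only: prod.case)
  qed
  have trneg: "trec (\<lambda>n. neg (f n))" if "trec f" for f
    unfolding neg_def
  proof (rule trec_search)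
    show "tdec (\<lambda>z. f (pfst z) \<notin> carrier K \<or> psnd z \<in> carrier K \<and> A (f (pfst z)) (psnd z) = \<zero>\<^bsub>K\<^esub>)"
      by (intro rec_intros mem trA trec_compose[OF that])
    show "\<exists>y. f n \<notin> carrier K \<or> y \<in> carrier K \<and> A (f n) y = \<zero>\<^bsub>K\<^esub>" for n
      unfolding A_def by (metis a_inv_closed r_neg)
  qed
  have neg: "neg x = \<ominus>\<^bsub>K\<^esub> x" if x: "x \<in> carrier K" for x
  proof -
    have "x \<notin> carrier K \<or> neg x \<in> carrier K \<and> A x (neg x) = \<zero>\<^bsub>K\<^esub>"
      unfolding neg_def
      by (rule LeastI[of _ "\<ominus>\<^bsub>K\<^esub> x"]) (use x in \<open>auto simp: A_def r_neg\<close>)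
    then show ?thesis
      using x by (auto simp: A_def intro!: minus_equality[symmetric] simp: a_comm)
  qed
  \<comment> \<open>\<open>int_decode c\<close> is \<open>c div 2\<close> for even \<open>c\<close>,
    and minus the successor of \<open>c div 2\<close> for odd \<open>c\<close>.\<close>
  define zm where "zm c y = (if even c then rec_nat \<zero>\<^bsub>K\<^esub> (\<lambda>_ v. A v y) (c div 2)
      else neg (rec_nat \<zero>\<^bsub>K\<^esub> (\<lambda>_ v. A v y) (Suc (c div 2))))" for c y
  define mon where "mon a m = rec_nat \<one>\<^bsub>K\<^esub>
     (\<lambda>j v. M v (rec_nat \<one>\<^bsub>K\<^esub> (\<lambda>_ v. M v (lnth a j)) (fcoef m j))) (length (list_decode m))" for a m
  define pe where "pe p a = rec_nat \<zero>\<^bsub>K\<^esub>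
     (\<lambda>m v. if fcoef p m \<noteq> 0 then A v (zm (fcoef p m) (mon a m)) else v) (length (list_decode p))" for p a
  have trpe: "trec (\<lambda>z. pe (pfst z) (psnd z))"
    unfolding pe_def zm_def mon_def by (intro rec_intros trA trM trneg)
  have pow: "rec_nat \<one>\<^bsub>K\<^esub> (\<lambda>_ v. M v x) e = x [^]\<^bsub>K\<^esub> e" if "x \<in> carrier K" for x and e :: nat
    using that by (induction e) (auto simp: M_def)
  have nm: "rec_nat \<zero>\<^bsub>K\<^esub> (\<lambda>_ v. A v x) e = [e] \<cdot>\<^bsub>K\<^esub> x" if "x \<in> carrier K" for x and e :: nat
    using that by (induction e) (auto simp: A_def add.nat_pow_Suc)
  have zm: "zm c x = [int_decode c] \<cdot>\<^bsub>K\<^esub> x" if "x \<in> carrier K" for x c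
  proof (cases "even c")
    case True
    then show ?thesis using that by (simp add: zm_def nm int_decode_cases add_pow_int_ge)
  next
    case False
    have "zm c x = neg ([Suc (c div 2)] \<cdot>\<^bsub>K\<^esub> x)"
      using False unfolding zm_def by (simp only: nm[OF that] if_False)
    also have "\<dots> = \<ominus>\<^bsub>K\<^esub> ([Suc (c div 2)] \<cdot>\<^bsub>K\<^esub> x)"
      by (rule neg) (rule add.nat_pow_closed[OF that])
    also have "\<dots> = [(- int (Suc (c div 2)))] \<cdot>\<^bsub>K\<^esub> x"
      by (subst add_pow_int_lt) (simp_all del: of_nat_Suc)
    finally show ?thesis using False by (simp add: int_decode_cases)
  qed
  have mon: "mon a m = (\<Otimes>\<^bsub>K\<^esub>j\<in>{..<length (fin_decode m)}. (list_decode a ! j) [^]\<^bsub>K\<^esub> (fin_decode m ! j))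
      \<and> mon a m \<in> carrier K"
    if "set (list_decode a) \<subseteq> carrier K" "length (list_decode m) \<le> length (list_decode a)" for a m
  proof -
    let ?f = "\<lambda>j. (list_decode a ! j) [^]\<^bsub>K\<^esub> (fin_decode m ! j)"
    have fc: "?f \<in> {..<length (fin_decode m)} \<rightarrow> carrier K"
      using that by (auto simp: length_fin_decode intro!: nat_pow_closed)
    have "rec_nat \<one>\<^bsub>K\<^esub> (\<lambda>j v. M v (rec_nat \<one>\<^bsub>K\<^esub> (\<lambda>_ v. M v (lnth a j)) (fcoef m j))) k
      = rec_nat \<one>\<^bsub>K\<^esub> (\<lambda>j v. v \<otimes>\<^bsub>K\<^esub> ?f j) k \<and>
       rec_nat \<one>\<^bsub>K\<^esub> (\<lambda>j v. v \<otimes>\<^bsub>K\<^esub> ?f j) k \<in> carrier K" if "k \<le> length (fin_decode m)" for k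
      using that
    proof (induction k)
      case (Suc k)
      then have k: "k < length (fin_decode m)" by simp
      then have mem: "list_decode a ! k \<in> carrier K"
        using \<open>set _ \<subseteq> _\<close> \<open>length (list_decode m) \<le> _\<close> by (auto simp: length_fin_decode)
      have l: "lnth a k = list_decode a ! k"
        using k \<open>length (list_decode m) \<le> _\<close> by (simp add: lnth_def length_fin_decode)
      show ?case
        using Suc k mem by (simp add: l pow MK fin_decode_nth)
    qed simp
    then show ?thesis
      unfolding mon_def finprod_lessThan_rec[OF fc] by (simp add: length_fin_decode)
  qed
  have pe: "pe p a = poly_eval K p (list_decode a)"
    if a: "set (list_decode a) \<subseteq> carrier K" "length (list_decode a) = poly_var p" for p a
  proof -
    let ?g = "\<lambda>m. [int_decode (fin_decode p ! m)] \<cdot>\<^bsub>K\<^esub>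
       (\<Otimes>\<^bsub>K\<^esub>j\<in>{..<length (fin_decode m)}. (list_decode a ! j) [^]\<^bsub>K\<^esub> (fin_decode m ! j))"
    have g: "?g m = zm (fcoef p m) (mon a m) \<and> ?g m \<in> carrier K" if "m \<in> poly_support p" for m
    proof -
      have "length (list_decode m) \<le> length (list_decode a)"
        using length_le_poly_var[OF that] a by simp
      note mm = mon[OF a(1) this]
      moreover have "fin_decode p ! m = fcoef p m"
        using that by (intro fin_decode_nth) (simp add: poly_support_def)
      ultimately show ?thesis
        using zm[of "mon a m" "fcoef p m"] by (auto intro: add.int_pow_closed)
    qed
    have g2: "zm (fcoef p m) (mon a m) \<in> carrier K" if "m \<in> poly_support p" for m
      using g[OF that] by metis
    have "rec_nat \<zero>\<^bsub>K\<^esub>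
     (\<lambda>m v. if fcoef p m \<noteq> 0 then A v (zm (fcoef p m) (mon a m)) else v) k
      = finsum K ?g {m. m < k \<and> m \<in> poly_support p}" if "k \<le> length (list_decode p)" for k
      using that
    proof (induction k)
      case (Suc k)
      have "{m. m < Suc k \<and> m \<in> poly_support p} = (if fcoef p k \<noteq> 0
        then insert k {m. m < k \<and> m \<in> poly_support p} else {m. m < k \<and> m \<in> poly_support p})"
        using Suc.prems by (auto simp: less_Suc_eq poly_support_fcoef)
      moreover have "k \<in> poly_support p" if "fcoef p k \<noteq> 0"
        using Suc.prems that by (auto simp: poly_support_fcoef)
      moreover have "finsum K ?g {m. m < k \<and> m \<in> poly_support p} \<in> carrier K"
        using g by (intro finsum_closed) auto
      moreover have "finsum K ?g (insert k {m. m < k \<and> m \<in> poly_support p})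
         = ?g k \<oplus>\<^bsub>K\<^esub> finsum K ?g {m. m < k \<and> m \<in> poly_support p}" if "k \<in> poly_support p"
        using g g2 that by (intro finsum_insert) auto
      ultimately show ?case
        using Suc g[of k] g2[of k] by (auto simp: A_def a_comm)
    qed simp
    from this[of "length (list_decode p)"] show ?thesis
      unfolding pe_def poly_eval_def by (auto simp: poly_support_fcoef intro: arg_cong2[of _ _ _ _ "finsum K"])
  qed
  have "trec (\<lambda>z. if (\<forall>x\<in>set (list_decode (psnd z)). x \<in> carrier K)
      \<and> length (list_decode (psnd z)) = poly_var (pfst z) then pe (pfst z) (psnd z) else 0)"
    by (intro rec_intros mem trpe)
  then show ?thesis
    by (rule back_subst[of trec]) (auto simp: tpoly_eval_def pe fun_eq_iff)
qed

lemma poly_eval_in_carrier: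
  assumes "cring K" "set a \<subseteq> carrier K" "poly_var p = length a"
  shows "poly_eval K p a \<in> carrier K"
proof -
  interpret cring K by fact
  have "a ! j \<in> carrier K" if "m \<in> poly_support p" "j < length (fin_decode m)" for m j
    using length_le_poly_var[OF that(1)] that(2) assms(2,3)
    by (auto simp: length_fin_decode subset_iff)
  then show ?thesis
    unfolding poly_eval_def
    by (intro finsum_closed Pi_I add.int_pow_closed finprod_closed nat_pow_closed) auto
qed

lemma poly_eval_hom:
  assumes "cring K" "cring L" "h \<in> ring_hom K L" "set a \<subseteq> carrier K" "poly_var p = length a"
  shows "h (poly_eval K p a) = poly_eval L p (map h a)"
proof -
  interpret K: cring K by fact
  interpret L: cring L by fact
  interpret h: ring_hom_cring K L h
    by unfold_locales (fact assms(3))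
  have le: "j < length a" "a ! j \<in> carrier K" if "m \<in> poly_support p" "j < length (fin_decode m)" for m j
    using length_le_poly_var[OF that(1)] that(2) assms(4,5)
    by (auto simp: length_fin_decode subset_iff)
  have zpow: "h ([k] \<cdot>\<^bsub>K\<^esub> x) = [k] \<cdot>\<^bsub>L\<^esub> h x" if "x \<in> carrier K" for k :: int and x
  proof -
    interpret g: group_hom "add_monoid K" "add_monoid L" h
      by (rule h.ring.a_group_hom)
    show ?thesis using g.hom_int_pow[of x k] that by (simp add: add_pow_def)
  qed
  have "h (poly_eval K p a) = (\<Oplus>\<^bsub>L\<^esub>m\<in>poly_support p. h ([int_decode (fin_decode p ! m)] \<cdot>\<^bsub>K\<^esub>
     (\<Otimes>\<^bsub>K\<^esub>j\<in>{..<length (fin_decode m)}. (a ! j) [^]\<^bsub>K\<^esub> (fin_decode m ! j))))"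
    unfolding poly_eval_def using le
    by (subst h.hom_finsum) (auto simp: comp_def intro!: K.add.int_pow_closed K.finprod_closed K.nat_pow_closed)
  also have "\<dots> = poly_eval L p (map h a)"
    unfolding poly_eval_def
  proof (intro L.finsum_cong' refl)
    fix m assume m: "m \<in> poly_support p"
    let ?f = "\<lambda>j. (a ! j) [^]\<^bsub>K\<^esub> (fin_decode m ! j)"
    have f: "?f \<in> {..<length (fin_decode m)} \<rightarrow> carrier K"
      using le[OF m] by (auto intro!: K.nat_pow_closed)
    have "h (finprod K ?f {..<length (fin_decode m)}) = finprod L (h \<circ> ?f) {..<length (fin_decode m)}"
      by (rule h.hom_finprod[OF f])
    also have "\<dots> = (\<Otimes>\<^bsub>L\<^esub>j\<in>{..<length (fin_decode m)}. (map h a ! j) [^]\<^bsub>L\<^esub> (fin_decode m ! j))"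
      using le[OF m]
      by (intro L.finprod_cong') (auto simp: h.ring.hom_nat_pow intro!: L.nat_pow_closed h.hom_closed)
    finally show "h ([int_decode (fin_decode p ! m)] \<cdot>\<^bsub>K\<^esub> finprod K ?f {..<length (fin_decode m)})
      = [int_decode (fin_decode p ! m)] \<cdot>\<^bsub>L\<^esub>
        (\<Otimes>\<^bsub>L\<^esub>j\<in>{..<length (fin_decode m)}. (map h a ! j) [^]\<^bsub>L\<^esub> (fin_decode m ! j))"
      using zpow[OF K.finprod_closed[OF f]] by simp
  qed (use le in \<open>auto intro!: L.add.int_pow_closed L.finprod_closed L.nat_pow_closed h.hom_closed\<close>)
  finally show ?thesis .
qed

text \<open>
  The code of \<open>c\<^sub>0 x\<^bsup>L-1\<^esup> + \<dots> + c\<^bsub>L-1\<^esub>\<close> as an integral polynomial in x and the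
  coefficients. The last variable does occur in it, so that its arity is L + 1.
\<close>

lemma exists_generic_univariate:
  assumes "L > 0"
  shows "\<exists>q. poly_var q = Suc L \<and>
    (\<forall>K x cs. cring K \<longrightarrow> x \<in> carrier K \<longrightarrow> set cs \<subseteq> carrier K \<longrightarrow> length cs = L \<longrightarrow>
       poly_eval K q (x # cs) = ring.eval K cs x)"
proof -
  have surj: "\<exists>n. fin_decode n = l" if "l = [] \<or> last l \<noteq> 0" for l
    using bij_betw_fin_decode that unfolding bij_betw_def by (metis (mono_tags, lifting) imageE mem_Collect_eq)
  \<comment> \<open>\<open>m j\<close> is the monomial formed by the power L - 1 - j of the first
    variable, which stands for x, and by the variable of the coefficient number j, which sits at
    position j + 1 of the tuple.\<close>
  have "\<forall>j. \<exists>n. fin_decode n = (L - 1 - j) # replicate j 0 @ [1]"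
    by (intro allI surj) simp
  then obtain m where m: "fin_decode (m j) = (L - 1 - j) # replicate j 0 @ [1]" for j
    by metis
  have lenm: "length (fin_decode (m j)) = Suc (Suc j)" for j
    by (simp add: m)
  have inj: "inj m"
    by (intro injI) (metis lenm Suc_inject)
  define S where "S = m ` {..<L}"
  have S: "finite S" "S \<noteq> {}" using assms by (auto simp: S_def)
  \<comment> \<open>All monomials in \<open>S\<close> get the coefficient 1, whose code is 2. The
    list ends at \<open>Max S\<close>, hence in a nonzero entry, as the range of
    \<open>fin_decode\<close> requires.\<close>
  obtain q where q: "fin_decode q = map (\<lambda>i. if i \<in> S then 2 else 0) [0..<Suc (Max S)]"
    using surj[of "map (\<lambda>i. if i \<in> S then 2 else 0) [0..<Suc (Max S)]"] Max_in[OF S] by auto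
  have nthq: "fin_decode q ! i = (if i \<in> S then 2 else 0)" if "i \<le> Max S" for i
    unfolding q using that by (subst nth_map) (auto simp del: upt_Suc)
  have supp: "poly_support q = S"
    unfolding poly_support_def
  proof (intro equalityI subsetI)
    fix i
    assume "i \<in> {i. i < length (fin_decode q) \<and> fin_decode q ! i \<noteq> 0}"
    then show "i \<in> S" using nthq[of i] by (simp add: q split: if_splits)
  next
    fix i
    assume "i \<in> S"
    moreover from this have "i \<le> Max S" using S by simp
    ultimately show "i \<in> {i. i < length (fin_decode q) \<and> fin_decode q ! i \<noteq> 0}"
      using nthq[of i] by (simp add: q)
  qed
  have "poly_var q = Max (insert 0 ((\<lambda>j. Suc (Suc j)) ` {..<L}))"
    unfolding poly_var_def supp S_def image_image lenm ..
  \<comment> \<open>The longest monomial is \<open>m (L - 1)\<close>; this is where L must be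
    positive.\<close>
  also have "\<dots> = Suc L"
    using assms by (intro Max_eqI) (auto intro!: image_eqI[of _ _ "L - 1"])
  finally have var: "poly_var q = Suc L" .
  have "poly_eval K q (x # cs) = ring.eval K cs x"
    if "cring K" and x: "x \<in> carrier K" and cs: "set cs \<subseteq> carrier K" and L: "length cs = L" for K :: "nat ring" and x cs
  proof -
    interpret cring K by fact
    have csj: "cs ! j \<in> carrier K" if "j < L" for j using cs L that by auto
    have mono: "(\<Otimes>\<^bsub>K\<^esub>i\<in>{..<length (fin_decode (m j))}. ((x # cs) ! i) [^]\<^bsub>K\<^esub> (fin_decode (m j) ! i))
       = cs ! j \<otimes>\<^bsub>K\<^esub> x [^]\<^bsub>K\<^esub> (L - 1 - j)" (is "finprod K ?f _ = _") if j: "j < L" for j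
    proof -
      have mid: "?f i = \<one>\<^bsub>K\<^esub>" if "i \<in> {1..j}" for i
        using that by (auto simp: m nth_Cons nth_append split: nat.split)
      have last: "?f (Suc j) = cs ! j"
        using csj[OF j] by (simp add: m nth_append)
      have first: "?f 0 = x [^]\<^bsub>K\<^esub> (L - 1 - j)"
        by (simp add: m)
      have "{..<length (fin_decode (m j))} = insert (Suc j) (insert 0 {1..j})"
        by (auto simp: lenm)
      then have "finprod K ?f {..<length (fin_decode (m j))}
          = ?f (Suc j) \<otimes>\<^bsub>K\<^esub> (?f 0 \<otimes>\<^bsub>K\<^esub> finprod K ?f {1..j})"
        using mid first last csj[OF j] x
        by (simp only:) (subst finprod_insert; (subst finprod_insert)?; auto simp: Pi_def simp del: nth_Cons_0 nth_Cons_Suc)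
      also have "finprod K ?f {1..j} = \<one>\<^bsub>K\<^esub>"
        by (rule finprod_one_eqI) (rule mid)
      finally show ?thesis
        using csj[OF j] x by (simp only: first last) simp
    qed
    have "poly_eval K q (x # cs) = (\<Oplus>\<^bsub>K\<^esub>k\<in>S. [int_decode (fin_decode q ! k)] \<cdot>\<^bsub>K\<^esub>
        (\<Otimes>\<^bsub>K\<^esub>i\<in>{..<length (fin_decode k)}. ((x # cs) ! i) [^]\<^bsub>K\<^esub> (fin_decode k ! i)))"
      unfolding poly_eval_def supp ..
    also have "\<dots> = (\<Oplus>\<^bsub>K\<^esub>j\<in>{..<L}. [int_decode (fin_decode q ! m j)] \<cdot>\<^bsub>K\<^esub>
        (\<Otimes>\<^bsub>K\<^esub>i\<in>{..<length (fin_decode (m j))}. ((x # cs) ! i) [^]\<^bsub>K\<^esub> (fin_decode (m j) ! i)))"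
      unfolding S_def using mono csj x
      by (intro finsum_reindex) (auto intro!: add.int_pow_closed inj_on_subset[OF inj])
    also have "\<dots> = (\<Oplus>\<^bsub>K\<^esub>j\<in>{..<L}. cs ! j \<otimes>\<^bsub>K\<^esub> x [^]\<^bsub>K\<^esub> (L - 1 - j))"
    proof (intro finsum_cong' refl)
      fix j assume "j \<in> {..<L}"
      then have j: "j < L" by simp
      have "m j \<in> S" using j by (auto simp: S_def)
      moreover have "m j \<le> Max S" using S calculation by simp
      ultimately have "int_decode (fin_decode q ! m j) = 1"
        by (simp add: nthq int_decode_cases)
      then show "[int_decode (fin_decode q ! m j)] \<cdot>\<^bsub>K\<^esub>
        (\<Otimes>\<^bsub>K\<^esub>i\<in>{..<length (fin_decode (m j))}. ((x # cs) ! i) [^]\<^bsub>K\<^esub> (fin_decode (m j) ! i))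
        = cs ! j \<otimes>\<^bsub>K\<^esub> x [^]\<^bsub>K\<^esub> (L - 1 - j)"
        using mono[OF j] csj[OF j] x by (simp add: add.int_pow_1)
    qed (use csj x in auto)
    also have "\<dots> = eval cs x"
      using cs L[symmetric]
    proof (induction cs arbitrary: L)
      case (Cons c cs)
      have cs: "cs ! j \<in> carrier K" if "j < length cs" for j
        using Cons.prems(1) that by auto
      let ?g = "\<lambda>j. (c # cs) ! j \<otimes>\<^bsub>K\<^esub> x [^]\<^bsub>K\<^esub> (L - 1 - j)"
      have "finsum K ?g {..<L} = ?g 0 \<oplus>\<^bsub>K\<^esub> finsum K ?g (Suc ` {..<length cs})"
        unfolding Cons.prems(2) list.size add_0_right add_Suc_right lessThan_Suc_eq_insert_0
        using Cons.prems(1) x cs by (intro finsum_insert) auto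
      also have "finsum K ?g (Suc ` {..<length cs}) = finsum K (\<lambda>j. ?g (Suc j)) {..<length cs}"
        using Cons.prems(1) x cs by (intro finsum_reindex) auto
      also have "\<dots> = (\<Oplus>\<^bsub>K\<^esub>j\<in>{..<length cs}. cs ! j \<otimes>\<^bsub>K\<^esub> x [^]\<^bsub>K\<^esub> (length cs - 1 - j))"
        using x cs Cons.prems by (intro finsum_cong') auto
      also have "\<dots> = eval cs x"
        using Cons.prems by (intro Cons.IH) auto
      finally show ?case using Cons.prems by simp
    qed simp
    finally show ?thesis .
  qed
  with var show ?thesis by blast
qed

section \<open>Extending embeddings of subfields by counting roots\<close>

section \<open>Extension of embeddings\<close>

context field
begin

lemma finite_roots:
  assumes "p \<in> carrier (poly_ring R)" "p \<noteq> []"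
  shows "finite {y \<in> carrier R. eval p y = \<zero>}" "card {y \<in> carrier R. eval p y = \<zero>} \<le> degree p"
proof -
  have eq: "{y \<in> carrier R. eval p y = \<zero>} = set_mset (roots p)"
    using assms by (auto simp: roots_mem_iff_is_root is_root_def)
  show "finite {y \<in> carrier R. eval p y = \<zero>}"
    unfolding eq by simp
  have "card (set_mset (roots p)) \<le> size (roots p)"
    using sum_mono[of "set_mset (roots p)" "\<lambda>_. 1" "count (roots p)"]
    by (simp add: size_multiset_overloaded_eq Suc_le_eq)
  then show "card {y \<in> carrier R. eval p y = \<zero>} \<le> degree p"
    unfolding eq using size_roots_le_degree[OF assms(1)] by simp
qed

text \<open>Splitting makes the multiset of roots as large as the degree, and separability excludes
  multiplicities.\<close>

lemma galois_extension_roots: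
  assumes "galois_extension R k" "x \<in> carrier R"
  shows "card {y \<in> carrier R. eval (Irr k x) y = \<zero>} = degree (Irr k x)"
proof -
  have k: "subfield k R" and alg: "(algebraic over k) x"
    and split: "splitted (Irr k x)" and sep: "\<And>y. y \<in> carrier R \<Longrightarrow> count (roots (Irr k x)) y \<le> 1"
    using assms by (auto simp: galois_extension_def over_def)
  have p: "Irr k x \<in> carrier (poly_ring R)" "Irr k x \<noteq> []"
    using IrrE(1,3)[OF k assms(2) alg] carrier_polynomial_shell[OF subfieldE(1)[OF k]]
      pirreducibleE(1)[OF subfieldE(1)[OF k] IrrE(1,2)[OF k assms(2) alg]] by auto
  have eq: "{y \<in> carrier R. eval (Irr k x) y = \<zero>} = set_mset (roots (Irr k x))"
    using p by (auto simp: roots_mem_iff_is_root is_root_def)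
  have "count (roots (Irr k x)) y = 1" if "y \<in># roots (Irr k x)" for y
  proof -
    have "y \<in> carrier R" using that eq by blast
    moreover have "count (roots (Irr k x)) y \<noteq> 0" using that by simp
    ultimately show ?thesis using sep[of y] by linarith
  qed
  then have "size (roots (Irr k x)) = card (set_mset (roots (Irr k x)))"
    by (simp add: size_multiset_overloaded_eq)
  with split show ?thesis by (simp add: eq splitted_def)
qed

lemma ring_hom_subfield_inj:
  assumes "subfield E R" "\<phi> \<in> ring_hom (R \<lparr> carrier := E \<rparr>) R"
  shows "inj_on \<phi> E"
  using non_trivial_field_hom_is_inj[OF assms(2) subfield_iff(2)[OF assms(1)] field_axioms] by simp

lemma ring_hom_subfield_zero:
  assumes "subfield E R" "\<phi> \<in> ring_hom (R \<lparr> carrier := E \<rparr>) R"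
  shows "\<phi> \<zero> = \<zero>"
proof -
  interpret E: field "R \<lparr> carrier := E \<rparr>" using subfield_iff(2)[OF assms(1)] .
  interpret h: ring_hom_cring "R \<lparr> carrier := E \<rparr>" R \<phi>
    by unfold_locales (fact assms(2))
  show ?thesis using h.ring.hom_zero by simp
qed

text \<open>Polynomials are normalized coefficient lists, and applying \<open>\<phi>\<close>
  entrywise commutes with their operations only up to normalization; evaluation does not see the
  difference.\<close>

lemma twisted_eval_hom:
  assumes "subfield E R" "\<phi> \<in> ring_hom (R \<lparr> carrier := E \<rparr>) R" "y \<in> carrier R"
  shows "(\<lambda>p. eval (map \<phi> p) y) \<in> ring_hom (E[X]) R"
proof -
  have E: "subring E R" using subfieldE(1)[OF assms(1)] .
  interpret E: field "R \<lparr> carrier := E \<rparr>" using subfield_iff(2)[OF assms(1)] .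
  interpret h: ring_hom_ring "R \<lparr> carrier := E \<rparr>" R \<phi>
    by (rule ring_hom_ringI2) (fact E.ring_axioms ring_axioms assms(2))+
  have pE: "set p \<subseteq> E" if "p \<in> carrier (E[X])" for p
    using that by (auto simp: univ_poly_def polynomial_def)
  have mp: "set (map \<phi> p) \<subseteq> carrier R" if "p \<in> carrier (E[X])" for p
    using pE[OF that] h.hom_closed by auto
  show ?thesis
  proof (rule ring_hom_memI)
    fix p assume p: "p \<in> carrier (E[X])"
    show "eval (map \<phi> p) y \<in> carrier R"
      using eval_in_carrier[OF mp[OF p] assms(3)] .
  next
    fix p q assume p: "p \<in> carrier (E[X])" and q: "q \<in> carrier (E[X])"
    have "set (poly_mult p q) \<subseteq> E" "set (poly_add p q) \<subseteq> E"
      using ring.ring_simprules(1,5)[OF univ_poly_is_ring[OF E] p q] pE by (auto simp: univ_poly_def)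
    then have m: "set (map \<phi> (poly_mult p q)) \<subseteq> carrier R" "set (map \<phi> (poly_add p q)) \<subseteq> carrier R"
      using h.hom_closed by auto
    have "eval (map \<phi> (poly_mult p q)) y = eval (normalize (map \<phi> (poly_mult p q))) y"
      using eval_normalize[OF m(1) assms(3)] by simp
    also have "\<dots> = eval (poly_mult (map \<phi> p) (map \<phi> q)) y"
      using h.poly_mult_hom'[of p q] pE[OF p] pE[OF q] by (simp add: poly_mult_consistent[OF E])
    also have "\<dots> = eval (map \<phi> p) y \<otimes> eval (map \<phi> q) y"
      by (rule eval_poly_mult[OF mp[OF p] mp[OF q] assms(3)])
    finally show "eval (map \<phi> (p \<otimes>\<^bsub>E[X]\<^esub> q)) y = eval (map \<phi> p) y \<otimes> eval (map \<phi> q) y"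
      by (simp add: univ_poly_mult)
    have "eval (map \<phi> (poly_add p q)) y = eval (normalize (map \<phi> (poly_add p q))) y"
      using eval_normalize[OF m(2) assms(3)] by simp
    also have "\<dots> = eval (poly_add (map \<phi> p) (map \<phi> q)) y"
      using h.poly_add_hom'[of p q] pE[OF p] pE[OF q] by (simp add: poly_add_consistent[OF E])
    also have "\<dots> = eval (map \<phi> p) y \<oplus> eval (map \<phi> q) y"
      by (rule eval_poly_add[OF mp[OF p] mp[OF q] assms(3)])
    finally show "eval (map \<phi> (p \<oplus>\<^bsub>E[X]\<^esub> q)) y = eval (map \<phi> p) y \<oplus> eval (map \<phi> q) y"
      by (simp add: univ_poly_add)
  next
    show "eval (map \<phi> \<one>\<^bsub>E[X]\<^esub>) y = \<one>"
      using ring_hom_one[OF assms(2)] assms(3) by (simp add: univ_poly_one)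
  qed
qed

text \<open>An element of E(x) is a value of some polynomial at x and is sent to the twisted value
  at y. This is well defined because a polynomial vanishing at x is a multiple of
  \<open>Irr E x\<close>, whose twisted value at y is zero by assumption.\<close>

lemma extend_hom_simple:
  assumes "subfield E R" "\<phi> \<in> ring_hom (R \<lparr> carrier := E \<rparr>) R"
    and "x \<in> carrier R" "(algebraic over E) x"
    and "y \<in> carrier R" "eval (map \<phi> (Irr E x)) y = \<zero>"
  obtains \<psi> where "\<psi> \<in> ring_hom (R \<lparr> carrier := simple_extension E x \<rparr>) R"
    "\<And>e. e \<in> E \<Longrightarrow> \<psi> e = \<phi> e" "\<psi> x = y"
proof -
  have E: "subring E R" "E \<subseteq> carrier R" using subfieldE(1,3)[OF assms(1)] by auto
  let ?T = "\<lambda>p. eval (map \<phi> p) y"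
  interpret UP: cring "E[X]" using univ_poly_is_cring[OF E(1)] .
  interpret T: ring_hom_cring "E[X]" R ?T
    by unfold_locales (fact twisted_eval_hom[OF assms(1,2,5)])
  interpret S: ring_hom_cring "E[X]" R "\<lambda>p. eval p x"
    by unfold_locales (fact eval_is_hom[OF E(1) assms(3)])
  have ker: "?T d = \<zero>" if d: "d \<in> carrier (E[X])" "eval d x = \<zero>" for d
  proof -
    have "Irr E x divides\<^bsub>E[X]\<^esub> d"
      using Irr_minimal[OF assms(1,3,4) d] pdivides_iff_shell[OF assms(1) IrrE(1)[OF assms(1,3,4)] d(1)]
      by simp
    then obtain q where "q \<in> carrier (E[X])" "d = Irr E x \<otimes>\<^bsub>E[X]\<^esub> q"
      unfolding factor_def by blast
    then show ?thesis
      using T.hom_mult[OF IrrE(1)[OF assms(1,3,4)]] assms(6) T.hom_closed by simp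
  qed
  have wd: "?T p = ?T q" if "p \<in> carrier (E[X])" "q \<in> carrier (E[X])" "eval p x = eval q x" for p q
  proof -
    have "eval (p \<ominus>\<^bsub>E[X]\<^esub> q) x = \<zero>"
      using that S.hom_add[of p "\<ominus>\<^bsub>E[X]\<^esub> q"] S.hom_closed[of q] by (simp add: a_minus_def S.ring.hom_a_inv r_neg)
    then have "?T (p \<ominus>\<^bsub>E[X]\<^esub> q) = \<zero>"
      using that by (intro ker) auto
    then have "?T p \<ominus> ?T q = \<zero>"
      using that T.hom_add[of p "\<ominus>\<^bsub>E[X]\<^esub> q"] by (simp add: a_minus_def T.ring.hom_a_inv)
    then show ?thesis
      using that T.hom_closed r_right_minus_eq by auto
  qed
  define \<psi> where "\<psi> a = ?T (SOME p. p \<in> carrier (E[X]) \<and> eval p x = a)" for a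
  have \<psi>: "\<psi> (eval p x) = ?T p" if "p \<in> carrier (E[X])" for p
  proof -
    let ?q = "SOME q. q \<in> carrier (E[X]) \<and> eval q x = eval p x"
    have "?q \<in> carrier (E[X]) \<and> eval ?q x = eval p x"
      by (rule someI[of _ p]) (use that in auto)
    then show ?thesis unfolding \<psi>_def using wd that by blast
  qed
  have img: "simple_extension E x = (\<lambda>p. eval p x) ` carrier (E[X])"
    using simple_extension_as_eval_img[OF E(2) assms(3)] .
  show thesis
  proof
    show "\<psi> \<in> ring_hom (R \<lparr> carrier := simple_extension E x \<rparr>) R"
    proof (rule ring_hom_memI; clarsimp simp: img)
      fix p assume "p \<in> carrier (E[X])"
      then show "\<psi> (eval p x) \<in> carrier R" by (simp add: \<psi>)
    next
      fix p q assume pq: "p \<in> carrier (E[X])" "q \<in> carrier (E[X])"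
      show "\<psi> (eval p x \<otimes> eval q x) = \<psi> (eval p x) \<otimes> \<psi> (eval q x)"
        using \<psi>[of "p \<otimes>\<^bsub>E[X]\<^esub> q"] pq by (simp add: \<psi>)
      show "\<psi> (eval p x \<oplus> eval q x) = \<psi> (eval p x) \<oplus> \<psi> (eval q x)"
        using \<psi>[of "p \<oplus>\<^bsub>E[X]\<^esub> q"] pq by (simp add: \<psi>)
    next
      show "\<psi> \<one> = \<one>" using \<psi>[of "\<one>\<^bsub>E[X]\<^esub>"] by simp
    qed
  next
    fix e assume e: "e \<in> E"
    show "\<psi> e = \<phi> e"
    proof (cases "e = \<zero>")
      case True
      then show ?thesis using ring_hom_subfield_zero[OF assms(1,2)] \<psi>[of "[]"] by (simp add: univ_poly_zero_closed)
    next
      case False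
      then have "[e] \<in> carrier (E[X])"
        using e by (simp add: univ_poly_def polynomial_def)
      moreover have "e \<in> carrier R" using e E by auto
      moreover have "\<phi> e \<in> carrier R" using ring_hom_closed[OF assms(2)] e by simp
      ultimately show ?thesis using \<psi>[of "[e]"] assms(3,5) by simp
    qed
  next
    have "X \<in> carrier (E[X])" using var_closed(1)[OF E(1)] .
    moreover have "\<phi> \<one> = \<one>" using ring_hom_one[OF assms(2)] by simp
    moreover have "\<phi> \<zero> = \<zero>" by (rule ring_hom_subfield_zero[OF assms(1,2)])
    ultimately show "\<psi> x = y"
      using \<psi>[of X] assms(3,5) by (simp add: var_def)
  qed
qed

text \<open>\<open>Irr E x\<close> divides \<open>Irr k x\<close>, which has as many roots as its
  degree and is unchanged by \<open>\<phi>\<close>. The transported cofactor has at most its degree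
  many of them, so enough are left for the transported \<open>Irr E x\<close>. Positive degree gives
  a root to extend to; degree at least 2 gives a second conjugate.\<close>

lemma galois_conjugate_card:
  assumes "galois_extension R k" "subfield E R" "k \<subseteq> E"
    and "\<phi> \<in> ring_hom (R \<lparr> carrier := E \<rparr>) R" "\<And>e. e \<in> k \<Longrightarrow> \<phi> e = e"
    and x: "x \<in> carrier R"
  shows "(algebraic over E) x" "degree (Irr E x) > 0"
    "card {y \<in> carrier R. eval (map \<phi> (Irr E x)) y = \<zero>} \<ge> degree (Irr E x)"
proof -
  have k: "subfield k R" and algk: "(algebraic over k) x"
    using assms by (auto simp: galois_extension_def over_def)
  show algE: "(algebraic over E) x"
    using algebraic_mono[OF assms(3) algk] .
  have E: "subring E R" "E \<subseteq> carrier R" using subfieldE(1,3)[OF assms(2)] by auto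
  let ?p = "Irr k x" and ?m = "Irr E x"
  note p = IrrE[OF k x algk] and m = IrrE[OF assms(2) x algE]
  have sub: "carrier (k[X]) \<subseteq> carrier (E[X])"
    using assms(3) by (auto simp: univ_poly_def polynomial_def)
  have pE: "?p \<in> carrier (E[X])" using p(1) sub by blast
  have p0: "?p \<noteq> []"
    using pirreducibleE(1)[OF subfieldE(1)[OF k] p(1,2)] .
  have m0: "?m \<noteq> []"
    using pirreducibleE(1)[OF E(1) m(1,2)] .
  show deg: "degree ?m > 0"
    using pirreducible_degree[OF assms(2) m(1,2)] by simp
  have "?m divides\<^bsub>E[X]\<^esub> ?p"
    using Irr_minimal[OF assms(2) x algE pE p(4)] pdivides_iff_shell[OF assms(2) m(1) pE] by simp
  then obtain q where q: "q \<in> carrier (E[X])" "?p = ?m \<otimes>\<^bsub>E[X]\<^esub> q"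
    unfolding factor_def by blast
  interpret UP: domain "E[X]" using univ_poly_is_domain[OF E(1)] .
  have q0: "q \<noteq> []"
    using q p0 m(1) UP.r_null by (auto simp: univ_poly_zero)
  have dp: "degree ?p = degree ?m + degree q"
    using poly_mult_degree_eq[OF E(1), of ?m q] q m(1) m0 q0
    by (simp add: univ_poly_mult univ_poly_carrier)
  have inj: "inj_on \<phi> E" using ring_hom_subfield_inj[OF assms(2,4)] .
  have \<phi>0: "\<phi> \<zero> = \<zero>" by (rule ring_hom_subfield_zero[OF assms(2,4)])
  have mapc: "map \<phi> r \<in> carrier (poly_ring R)" if "r \<in> carrier (E[X])" for r
  proof -
    have r: "r = [] \<or> set r \<subseteq> E \<and> hd r \<noteq> \<zero>"
      using that by (auto simp: univ_poly_def polynomial_def)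
    have "\<phi> (hd r) \<noteq> \<zero>" if "r \<noteq> []"
    proof
      assume "\<phi> (hd r) = \<zero>"
      then have "\<phi> (hd r) = \<phi> \<zero>" using \<phi>0 by simp
      moreover have "hd r \<in> E" "\<zero> \<in> E" using r that subringE(2)[OF E(1)] by (auto simp: hd_in_set subset_iff)
      ultimately have "hd r = \<zero>" using inj by (auto dest: inj_onD)
      then show False using r that by simp
    qed
    moreover have "\<phi> ` E \<subseteq> carrier R" using ring_hom_closed[OF assms(4)] by auto
    ultimately show ?thesis
      using r by (auto simp: univ_poly_def polynomial_def hd_map)
  qed
  have "map \<phi> ?p = ?p"
    using p(1) assms(5) by (intro map_idI) (auto simp: univ_poly_def polynomial_def)
  then have "{y \<in> carrier R. eval ?p y = \<zero>} \<subseteq>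
     {y \<in> carrier R. eval (map \<phi> ?m) y = \<zero>} \<union> {y \<in> carrier R. eval (map \<phi> q) y = \<zero>}"
  proof (intro subsetI)
    fix y assume y: "y \<in> {y \<in> carrier R. eval ?p y = \<zero>}"
    then have yR: "y \<in> carrier R" by simp
    note T = twisted_eval_hom[OF assms(2,4) yR]
    have "eval (map \<phi> ?m) y \<otimes> eval (map \<phi> q) y = eval (map \<phi> ?p) y"
      using ring_hom_mult[OF T m(1) q(1)] q(2) by simp
    also have "\<dots> = \<zero>" using y \<open>map \<phi> ?p = ?p\<close> by simp
    finally show "y \<in> {y \<in> carrier R. eval (map \<phi> ?m) y = \<zero>} \<union> {y \<in> carrier R. eval (map \<phi> q) y = \<zero>}"
      using integral ring_hom_closed[OF T m(1)] ring_hom_closed[OF T q(1)] yR by auto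
  qed
  then have "degree ?p \<le> card ({y \<in> carrier R. eval (map \<phi> ?m) y = \<zero>} \<union> {y \<in> carrier R. eval (map \<phi> q) y = \<zero>})"
    using galois_extension_roots[OF assms(1) x] finite_roots(1)[OF mapc[OF m(1)]] finite_roots(1)[OF mapc[OF q(1)]] m0 q0
    by (metis (no_types, lifting) card_mono finite_UnI map_is_Nil_conv)
  also have "\<dots> \<le> card {y \<in> carrier R. eval (map \<phi> ?m) y = \<zero>} + card {y \<in> carrier R. eval (map \<phi> q) y = \<zero>}"
    by (rule card_Un_le)
  also have "card {y \<in> carrier R. eval (map \<phi> q) y = \<zero>} \<le> degree q"
    using finite_roots(2)[OF mapc[OF q(1)]] q0 by simp
  finally show "card {y \<in> carrier R. eval (map \<phi> ?m) y = \<zero>} \<ge> degree ?m"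
    using dp by simp
qed

text \<open>Elements are adjoined one at a time; \<open>galois_conjugate_card\<close> supplies a
  root of the transported minimal polynomial as the image of the next one.\<close>

lemma extend_hom_finite:
  assumes "galois_extension R k" "subfield E R" "k \<subseteq> E"
    and "\<phi> \<in> ring_hom (R \<lparr> carrier := E \<rparr>) R" "\<And>e. e \<in> k \<Longrightarrow> \<phi> e = e"
    and "set xs \<subseteq> carrier R"
  shows "subfield (finite_extension E xs) R \<and>
    (\<exists>\<psi> \<in> ring_hom (R \<lparr> carrier := finite_extension E xs \<rparr>) R. \<forall>e\<in>E. \<psi> e = \<phi> e)"
  using assms(6)
proof (induction xs)
  case Nil
  then show ?case using assms(2,4) by auto
next
  case (Cons x xs)
  let ?E = "finite_extension E xs"
  from Cons obtain \<psi> where E': "subfield ?E R" and \<psi>: "\<psi> \<in> ring_hom (R \<lparr> carrier := ?E \<rparr>) R" "\<And>e. e \<in> E \<Longrightarrow> \<psi> e = \<phi> e"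
    by auto
  have x: "x \<in> carrier R" using Cons.prems by simp
  have incl: "E \<subseteq> ?E"
    using Cons.prems by (intro finite_extension_incl subfieldE(3)[OF assms(2)]) auto
  have fix': "\<psi> e = e" if "e \<in> k" for e
    using \<psi>(2) assms(3,5) that by auto
  have k': "k \<subseteq> ?E" using incl assms(3) by blast
  note c = galois_conjugate_card[OF assms(1) E' k' \<psi>(1) fix' x]
  have "{y \<in> carrier R. eval (map \<psi> (Irr ?E x)) y = \<zero>} \<noteq> {}"
    using c(2,3) by (metis (no_types, lifting) card.empty less_le_not_le)
  then obtain y where y: "y \<in> carrier R" "eval (map \<psi> (Irr ?E x)) y = \<zero>" by blast
  obtain \<psi>' where "\<psi>' \<in> ring_hom (R \<lparr> carrier := simple_extension ?E x \<rparr>) R"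
    "\<And>e. e \<in> ?E \<Longrightarrow> \<psi>' e = \<psi> e"
    using extend_hom_simple[OF E' \<psi>(1) x c(1) y] by blast
  moreover have "subfield (simple_extension ?E x) R"
    using simple_extension_is_subfield[OF E' x] c(1) by simp
  ultimately show ?case
    using incl \<psi>(2) by (auto intro!: bexI[of _ \<psi>'])
qed

end

text \<open>The root count encodes normality: a polynomial has at most its degree many roots, so
  none of them lie outside E. In this form the property survives transport along
  \<open>Psis n\<close>.\<close>

definition finite_normal :: "('a, 'b) ring_scheme \<Rightarrow> 'a set \<Rightarrow> 'a set \<Rightarrow> bool" where
  "finite_normal R k E \<longleftrightarrow> subfield E R \<and> k \<subseteq> E \<and>
     (\<exists>xs. set xs \<subseteq> E \<and> E \<subseteq> ring.finite_extension R k xs) \<and>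
     (\<forall>x\<in>E. \<exists>p\<in>carrier (k[X]\<^bsub>R\<^esub>). p \<noteq> [] \<and> ring.eval R p x = \<zero>\<^bsub>R\<^esub> \<and>
        card {y \<in> E. ring.eval R p y = \<zero>\<^bsub>R\<^esub>} = degree p)"

text \<open>\<open>\<phi>\<close> extends to M with the generators of E adjoined, a field that
  contains E. The extension maps the finite root set of a polynomial over k into itself, such sets
  cover E, and an injective self-map of a finite set is onto; hence E is mapped onto itself.\<close>

lemma (in field) extend_hom_finite_normal:
  assumes "galois_extension R k" "finite_normal R k E" "subfield M R" "k \<subseteq> M"
    and "\<phi> \<in> ring_hom (R \<lparr> carrier := M \<rparr>) R" "\<And>e. e \<in> k \<Longrightarrow> \<phi> e = e"
  obtains \<psi> where "\<psi> \<in> ring_hom (R \<lparr> carrier := E \<rparr>) R" "bij_betw \<psi> E E"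
    "\<And>e. e \<in> k \<Longrightarrow> \<psi> e = e" "\<And>x. x \<in> M \<Longrightarrow> x \<in> E \<Longrightarrow> \<psi> x = \<phi> x"
proof -
  have k: "subfield k R" using assms(1) by (simp add: galois_extension_def)
  have E: "subfield E R" "k \<subseteq> E" using assms(2) by (auto simp: finite_normal_def)
  obtain xs where xs: "set xs \<subseteq> E" "E \<subseteq> finite_extension k xs"
    using assms(2) by (auto simp: finite_normal_def)
  have xsR: "set xs \<subseteq> carrier R" using xs subfieldE(3)[OF E(1)] by auto
  obtain \<psi> where sub: "subfield (finite_extension M xs) R"
    and \<psi>: "\<psi> \<in> ring_hom (R \<lparr> carrier := finite_extension M xs \<rparr>) R" "\<And>e. e \<in> M \<Longrightarrow> \<psi> e = \<phi> e"
    using extend_hom_finite[OF assms(1,3-6) xsR] by auto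
  have EM: "E \<subseteq> finite_extension M xs"
    using xs(2) mono_finite_extension[OF assms(4), of xs] by blast
  have hom: "\<psi> \<in> ring_hom (R \<lparr> carrier := E \<rparr>) R"
    using \<psi>(1) EM unfolding ring_hom_def by (auto simp: Pi_iff subset_iff)
  have fix': "\<psi> e = e" if "e \<in> k" for e using \<psi>(2) assms(4,6) that by auto
  have inj: "inj_on \<psi> E" using ring_hom_subfield_inj[OF E(1) hom] .
  interpret F: field "R \<lparr> carrier := E \<rparr>" using subfield_iff(2)[OF E(1)] .
  interpret h: ring_hom_ring "R \<lparr> carrier := E \<rparr>" R \<psi>
    by (rule ring_hom_ringI2) (fact F.ring_axioms ring_axioms hom)+
  have roots: "\<exists>S. finite S \<and> x \<in> S \<and> S \<subseteq> E \<and> \<psi> ` S \<subseteq> S" if x: "x \<in> E" for x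
  proof -
    obtain p where p: "p \<in> carrier (k[X])" "p \<noteq> []" "eval p x = \<zero>"
      "card {y \<in> E. eval p y = \<zero>} = degree p"
      using assms(2) x by (auto simp: finite_normal_def)
    let ?S = "{y \<in> E. eval p y = \<zero>}" and ?S' = "{y \<in> carrier R. eval p y = \<zero>}"
    have pR: "p \<in> carrier (poly_ring R)"
      using carrier_polynomial_shell[OF subfieldE(1)[OF k] p(1)] .
    have pk: "set p \<subseteq> k" using p(1) by (auto simp: univ_poly_def polynomial_def)
    have "?S \<subseteq> ?S'" using subfieldE(3)[OF E(1)] by auto
    moreover have "card ?S' \<le> card ?S" "finite ?S'"
      using finite_roots[OF pR p(2)] p(4) by auto
    ultimately have eq: "?S = ?S'" by (metis card_seteq)
    have "\<psi> ` ?S \<subseteq> ?S'"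
    proof
      fix z assume "z \<in> \<psi> ` ?S"
      then obtain y where y: "y \<in> E" "eval p y = \<zero>" "z = \<psi> y" by blast
      have "map \<psi> p = p" using pk fix' by (intro map_idI) auto
      moreover have "\<psi> (eval p y) = eval (map \<psi> p) (\<psi> y)"
        using h.eval_hom'[of y p] y(1) pk E(2) eval_consistent[OF subfieldE(1)[OF E(1)]] by auto
      moreover have "\<psi> \<zero> = \<zero>" using h.hom_zero by simp
      moreover have "\<psi> y \<in> carrier R" using h.hom_closed[of y] y(1) by simp
      ultimately show "z \<in> ?S'" using y by simp
    qed
    with eq \<open>finite ?S'\<close> x p(3) show ?thesis by (intro exI[of _ ?S]) auto
  qed
  have "\<psi> ` E = E"
  proof (intro equalityI subsetI)
    fix z assume "z \<in> \<psi> ` E"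
    then show "z \<in> E" using roots by blast
  next
    fix z assume z: "z \<in> E"
    from roots[OF z] obtain S where S: "finite S" "z \<in> S" "S \<subseteq> E" "\<psi> ` S \<subseteq> S" by blast
    have "\<psi> ` S = S"
      using S inj by (intro endo_inj_surj) (auto intro: inj_on_subset)
    then show "z \<in> \<psi> ` E" using S by blast
  qed
  with inj have "bij_betw \<psi> E E" by (simp add: bij_betw_def)
  from that[OF hom this fix'] \<psi>(2) show thesis by blast
qed

section \<open>Elements of a finite extension that finitely many nontrivial maps all move\<close>

section \<open>Elements with trivial stabilizer\<close>

lemma (in ring) finite_Span:
  assumes "finite k"
  shows "finite (Span k Us)"
proof (induction Us)
  case (Cons u Us)
  have "line_extension k u (Span k Us) \<subseteq> (\<lambda>(a, v). a \<otimes> u \<oplus> v) ` (k \<times> Span k Us)"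
    by (auto simp: line_extension_mem_iff)
  then show ?case
    using Cons assms by (auto intro: finite_subset)
qed simp

text \<open>If k is finite, so is the field, and a map fixing a generator of the multiplicative
  group fixes everything. If k is infinite, induction on A applies: when the element x found so far
  is fixed by the new map s, choose y moved by s and pass to t x + y with t in k. Then s moves every
  such element, and each of the other maps excludes at most one t.\<close>

lemma (in field) exists_trivial_stabilizer:
  assumes k: "subfield k R" and fin: "finite_dimension k (carrier R)" and "finite A"
    and A: "\<And>a. a \<in> A \<Longrightarrow> a \<in> ring_hom R R" "\<And>a x. a \<in> A \<Longrightarrow> x \<in> k \<Longrightarrow> a x = x"
      "\<And>a. a \<in> A \<Longrightarrow> \<exists>x\<in>carrier R. a x \<noteq> x"
  shows "\<exists>t\<in>carrier R. \<forall>a\<in>A. a t \<noteq> t"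
proof (cases "finite k")
  case True
  obtain Us where Us: "set Us \<subseteq> carrier R" "Span k Us = carrier R"
    using exists_base[OF k finite_dimensionE[OF k fin]] by blast
  have "finite (carrier R)" using finite_Span[OF True, of Us] unfolding Us(2) .
  from finite_field_mult_group_has_gen[OF this] obtain t
    where t: "t \<in> carrier (Multiplicative_Group.mult_of R)" "carrier (Multiplicative_Group.mult_of R) = {t [^] i | i::nat. i \<in> UNIV}"
    by (elim bexE)
  then have tR: "t \<in> carrier R" by simp
  show ?thesis
  proof (intro bexI[OF _ tR] ballI notI)
    fix a assume a: "a \<in> A" "a t = t"
    interpret h: ring_hom_cring R R a
      by unfold_locales (fact A(1)[OF a(1)])
    have "a x = x" if x: "x \<in> carrier R" for x
    proof (cases "x = \<zero>")
      case False
      then have "x \<in> carrier (Multiplicative_Group.mult_of R)" using x by simp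
      then obtain i :: nat where "x = t [^] i" using t(2) by blast
      then show ?thesis using a(2) tR by (simp add: h.ring.hom_nat_pow)
    qed simp
    then show False using A(3)[OF a(1)] by blast
  qed
next
  case False
  show ?thesis
    using \<open>finite A\<close> A
  proof (induction A)
    case empty
    show ?case by (intro bexI[of _ \<zero>] ballI) simp_all
  next
    case (insert s S)
    have "\<exists>t\<in>carrier R. \<forall>a\<in>S. a t \<noteq> t"
      by (rule insert.IH) (simp_all add: insert.prems)
    then obtain x where x: "x \<in> carrier R" "\<And>a. a \<in> S \<Longrightarrow> a x \<noteq> x"
      by blast
    show ?case
    proof (cases "s x = x")
      case False
      with x show ?thesis by auto
    next
      case sx: True
      obtain y where y: "y \<in> carrier R" "s y \<noteq> y"
        using insert.prems(3) by blast
      define B where "B a = {t \<in> k. a (t \<otimes> x \<oplus> y) = t \<otimes> x \<oplus> y}" for a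
      have kR: "t \<in> carrier R" if "t \<in> k" for t using subfieldE(3)[OF k] that by blast
      have lin: "a (t \<otimes> x \<oplus> y) = t \<otimes> a x \<oplus> a y \<and> a x \<in> carrier R \<and> a y \<in> carrier R"
        if "a \<in> insert s S" "t \<in> k" for a t
      proof -
        interpret h: ring_hom_cring R R a
          by unfold_locales (fact insert.prems(1)[OF that(1)])
        show ?thesis using x(1) y(1) kR[OF that(2)] insert.prems(2)[OF that] by simp
      qed
      have "finite (B a)" if a: "a \<in> S" for a
      proof -
        have "t = u" if "t \<in> B a" "u \<in> B a" for t u
        proof -
          have tu: "t \<in> k" "u \<in> k" "a (t \<otimes> x \<oplus> y) = t \<otimes> x \<oplus> y" "a (u \<otimes> x \<oplus> y) = u \<otimes> x \<oplus> y"
            using that by (auto simp: B_def)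
          have c: "a x \<in> carrier R" "a y \<in> carrier R" "t \<in> carrier R" "u \<in> carrier R"
            using lin[of a t] a tu kR by auto
          have "t \<otimes> a x \<oplus> a y = t \<otimes> x \<oplus> y" "u \<otimes> a x \<oplus> a y = u \<otimes> x \<oplus> y"
            using lin[of a t] lin[of a u] a tu by auto
          then have "(t \<otimes> a x \<oplus> a y) \<ominus> (u \<otimes> a x \<oplus> a y) = (t \<otimes> x \<oplus> y) \<ominus> (u \<otimes> x \<oplus> y)"
            by simp
          moreover have "(t \<otimes> a x \<oplus> a y) \<ominus> (u \<otimes> a x \<oplus> a y) = (t \<ominus> u) \<otimes> a x"
            "(t \<otimes> x \<oplus> y) \<ominus> (u \<otimes> x \<oplus> y) = (t \<ominus> u) \<otimes> x"
            using c x(1) y(1) by algebra+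
          ultimately have "(t \<ominus> u) \<otimes> a x = (t \<ominus> u) \<otimes> x" by simp
          then have "t \<ominus> u = \<zero>"
            using x(2)[OF a] c x(1) m_lcancel[of "t \<ominus> u" "a x" x] by auto
          then show "t = u" using c by simp
        qed
        then have "\<exists>t. B a \<subseteq> {t}" by blast
        then show ?thesis by (meson finite.emptyI finite_insert finite_subset)
      qed
      then have "finite (\<Union>a\<in>S. B a)" using insert.hyps by blast
      then obtain t where t: "t \<in> k" "t \<notin> (\<Union>a\<in>S. B a)"
        using \<open>infinite k\<close> by (meson finite_subset subsetI)
      have "a (t \<otimes> x \<oplus> y) \<noteq> t \<otimes> x \<oplus> y" if "a \<in> insert s S" for a
      proof (cases "a = s")
        case True
        have "s (t \<otimes> x \<oplus> y) = t \<otimes> x \<oplus> s y" using lin[of s t] t(1) sx by (metis insertI1)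
        moreover have "t \<otimes> x \<oplus> s y \<noteq> t \<otimes> x \<oplus> y"
        proof
          assume eq: "t \<otimes> x \<oplus> s y = t \<otimes> x \<oplus> y"
          have "s y \<in> carrier R" using lin[of s t] t by blast
          then have "s y = y"
            using eq add.l_cancel[of "t \<otimes> x" "s y" y] y(1) x(1) kR[OF t(1)] by blast
          with y(2) show False by blast
        qed
        ultimately show ?thesis using True by simp
      next
        case False
        then show ?thesis using that t by (auto simp: B_def)
      qed
      then show ?thesis using kR[OF t(1)] x(1) y(1) by (intro bexI[of _ "t \<otimes> x \<oplus> y"]) auto
    qed
  qed
qed

section \<open>Galois theory of the presented levels\<close>

section \<open>Fully computable Galois extensions\<close>

lemma BijGroup_subgroup:
  assumes "H \<subseteq> Bij S" "(\<lambda>x\<in>S. x) \<in> H"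
    and "\<And>f g. f \<in> H \<Longrightarrow> g \<in> H \<Longrightarrow> compose S f g \<in> H"
    and "\<And>f. f \<in> H \<Longrightarrow> (\<lambda>x\<in>S. inv_into S f x) \<in> H"
  shows "subgroup H (BijGroup S)"
proof (rule subgroup.intro)
  show "H \<subseteq> carrier (BijGroup S)" using assms(1) by (simp add: BijGroup_def)
  show "\<one>\<^bsub>BijGroup S\<^esub> \<in> H" using assms(2) by (simp add: BijGroup_def)
  show "f \<otimes>\<^bsub>BijGroup S\<^esub> g \<in> H" if "f \<in> H" "g \<in> H" for f g
    using assms(1,3) that by (auto simp: BijGroup_def)
  show "inv\<^bsub>BijGroup S\<^esub> f \<in> H" if "f \<in> H" for f
    using inv_BijGroup[of f S] assms(1,4) that by auto
qed

lemma gal_group: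
  assumes "k' \<subseteq> carrier R" "ring R" shows "group (gal R k')"
proof -
  let ?S = "carrier R"
  have "subgroup {\<sigma> \<in> Bij ?S. \<sigma> \<in> ring_hom R R \<and> (\<forall>x\<in>k'. \<sigma> x = x)} (BijGroup ?S)"
  proof (rule BijGroup_subgroup)
    interpret ring R by fact
    show "(\<lambda>x\<in>?S. x) \<in> {\<sigma> \<in> Bij ?S. \<sigma> \<in> ring_hom R R \<and> (\<forall>x\<in>k'. \<sigma> x = x)}"
      using assms by (auto simp: id_Bij intro!: ring_hom_memI)
    fix f g
    assume f: "f \<in> {\<sigma> \<in> Bij ?S. \<sigma> \<in> ring_hom R R \<and> (\<forall>x\<in>k'. \<sigma> x = x)}"
    then have fh: "f \<in> ring_hom R R" and fb: "f \<in> Bij ?S" by auto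
    {
      assume g: "g \<in> {\<sigma> \<in> Bij ?S. \<sigma> \<in> ring_hom R R \<and> (\<forall>x\<in>k'. \<sigma> x = x)}"
      then have gh: "g \<in> ring_hom R R" by auto
      have "compose ?S f g \<in> ring_hom R R"
        using ring_hom_closed[OF gh] ring_hom_closed[OF fh] ring_hom_mult[OF gh] ring_hom_mult[OF fh]
          ring_hom_add[OF gh] ring_hom_add[OF fh] ring_hom_one[OF gh] ring_hom_one[OF fh]
        by (intro ring_hom_memI) (auto simp: compose_def)
      then show "compose ?S f g \<in> {\<sigma> \<in> Bij ?S. \<sigma> \<in> ring_hom R R \<and> (\<forall>x\<in>k'. \<sigma> x = x)}"
        using f g assms compose_Bij[of f ?S g] by (auto simp: compose_def subset_iff)
    }
    have inv: "inv_into ?S f x \<in> ?S" "f (inv_into ?S f x) = x" if "x \<in> ?S" for x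
      using that fb by (auto simp: Bij_def bij_betw_def intro: inv_into_into f_inv_into_f)
    have inv': "inv_into ?S f y = x" if "x \<in> ?S" "f x = y" for x y
      using that fb by (auto simp: Bij_def bij_betw_def)
    have "(\<lambda>x\<in>?S. inv_into ?S f x) \<in> ring_hom R R"
    proof (rule ring_hom_memI)
      fix x y assume "x \<in> ?S" "y \<in> ?S"
      then show "(\<lambda>x\<in>?S. inv_into ?S f x) (x \<otimes>\<^bsub>R\<^esub> y)
          = (\<lambda>x\<in>?S. inv_into ?S f x) x \<otimes>\<^bsub>R\<^esub> (\<lambda>x\<in>?S. inv_into ?S f x) y"
        "(\<lambda>x\<in>?S. inv_into ?S f x) (x \<oplus>\<^bsub>R\<^esub> y)
          = (\<lambda>x\<in>?S. inv_into ?S f x) x \<oplus>\<^bsub>R\<^esub> (\<lambda>x\<in>?S. inv_into ?S f x) y"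
        using inv ring_hom_mult[OF fh] ring_hom_add[OF fh] by (auto intro!: inv')
    qed (use inv inv' ring_hom_one[OF fh] in auto)
    then show "(\<lambda>x\<in>?S. inv_into ?S f x) \<in> {\<sigma> \<in> Bij ?S. \<sigma> \<in> ring_hom R R \<and> (\<forall>x\<in>k'. \<sigma> x = x)}"
      using f restrict_inv_into_Bij[OF fb] assms inv' by (auto simp: subset_iff)
  qed auto
  from subgroup.subgroup_is_group[OF this group_BijGroup] show ?thesis
    by (simp add: gal_def)
qed

lemma gal_mult: "g \<in> carrier (gal R k') \<Longrightarrow> h \<in> carrier (gal R k') \<Longrightarrow> g \<otimes>\<^bsub>gal R k'\<^esub> h = compose (carrier R) g h"
  by (auto simp: gal_def BijGroup_def)

lemma gal_one: "\<one>\<^bsub>gal R k'\<^esub> = (\<lambda>x\<in>carrier R. x)"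
  by (simp add: gal_def BijGroup_def)

text \<open>The groups are presented by their elements and multiplication; idempotence expresses
  being the identity through the multiplication alone.\<close>

lemma (in group) idempotent_eq_one: "g \<in> carrier G \<Longrightarrow> g \<otimes> g = g \<longleftrightarrow> g = \<one>"
  using l_cancel_one by auto

locale computable_galois =
  fixes K F :: "nat ring" and Psi :: "nat \<Rightarrow> nat"
    and Ks :: "nat \<Rightarrow> nat ring" and Psis Phis :: "nat \<Rightarrow> nat \<Rightarrow> nat"
    and G :: "nat \<Rightarrow> nat monoid" and res act :: "nat \<Rightarrow> nat \<Rightarrow> nat \<Rightarrow> nat"
  assumes fcg: "fully_computable_galois K F Psi Ks Psis Phis G res act"
begin

abbreviation "k \<equiv> Psi ` carrier F"
abbreviation "kn n \<equiv> base_in F Psi (Ks n) (Psis n)"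

lemma K_computable: "computable_field K" and F_computable: "computable_field F"
  and Psi_hom: "Psi \<in> ring_hom F K" and Psi_computable: "computable_on id (carrier F) Psi"
  and K_galois: "galois_extension K k"
  and Ks_computable: "uniformly_computable_fields Ks"
  and Psis_hom: "Psis i \<in> ring_hom (Ks i) K"
  and Phis_hom: "Phis i \<in> ring_hom (Ks i) (Ks (Suc i))"
  and Psis_Phis: "x \<in> carrier (Ks i) \<Longrightarrow> Psis (Suc i) (Phis i x) = Psis i x"
  and Psis_computable: "computable_on prod_encode {(i, x). x \<in> carrier (Ks i)} (\<lambda>(i, x). Psis i x)"
  and k_subset_Psis: "k \<subseteq> Psis i ` carrier (Ks i)"
  and Ks_galois: "galois_extension (Ks i) (kn i)"
  and Ks_finite: "ring.finite_dimension (Ks i) (kn i) (carrier (Ks i))"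
  and K_Union: "carrier K = (\<Union>i. Psis i ` carrier (Ks i))"
  and G_computable: "uniformly_computable_finite_groups G"
  and act_iso: "(\<lambda>g. restrict (act i g) (carrier (Ks i))) \<in> iso (G i) (gal (Ks i) (kn i))"
  and res_closed: "n < m \<Longrightarrow> g \<in> carrier (G m) \<Longrightarrow> res m n g \<in> carrier (G n)"
  and res_act: "n < m \<Longrightarrow> g \<in> carrier (G m) \<Longrightarrow> x \<in> carrier (Ks n) \<Longrightarrow> y \<in> carrier (Ks m) \<Longrightarrow>
    Psis m y = Psis n x \<Longrightarrow> Psis m (act m g y) = Psis n (act n (res m n g) x)"
  and res_computable: "computable_on triple_encode {(m, n, g). n < m \<and> g \<in> carrier (G m)}
      (\<lambda>(m, n, g). res m n g)"
  and act_computable: "computable_on triple_encode {(i, g, x). g \<in> carrier (G i) \<and> x \<in> carrier (Ks i)}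
      (\<lambda>(i, g, x). act i g x)"
  using fcg unfolding fully_computable_galois_def by auto

sublocale K: field K
  using K_galois by (simp add: galois_extension_def)

sublocale F: field F
  using F_computable by (simp add: computable_field_def uniformly_computable_fields_def)

lemma Ks_field: "field (Ks n)"
  using Ks_galois by (simp add: galois_extension_def)

lemma Psis_cring_hom: "ring_hom_cring (Ks n) K (Psis n)"
proof -
  interpret L: field "Ks n" by (rule Ks_field)
  show ?thesis by unfold_locales (rule Psis_hom)
qed

lemma Psis_closed [simp]: "x \<in> carrier (Ks n) \<Longrightarrow> Psis n x \<in> carrier K"
  using ring_hom_closed[OF Psis_hom] .

lemma Psi_closed [simp]: "x \<in> carrier F \<Longrightarrow> Psi x \<in> carrier K"
  using ring_hom_closed[OF Psi_hom] .

lemma Psis_inj: "inj_on (Psis n) (carrier (Ks n))"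
  using non_trivial_field_hom_is_inj[OF Psis_hom Ks_field K.field_axioms] .

lemma k_subfield: "subfield k K"
  using K_galois by (simp add: galois_extension_def)

lemma k_in_K: "k \<subseteq> carrier K" by auto

lemma Psis_mono: "n \<le> m \<Longrightarrow> Psis n ` carrier (Ks n) \<subseteq> Psis m ` carrier (Ks m)"
proof (induction m rule: dec_induct)
  case (step m)
  have "Psis m ` carrier (Ks m) \<subseteq> Psis (Suc m) ` carrier (Ks (Suc m))"
    using Psis_Phis ring_hom_closed[OF Phis_hom] by (metis image_eqI image_subsetI)
  with step show ?case by blast
qed simp

lemma Psis_eqD: "Psis n x = Psis n y \<Longrightarrow> x \<in> carrier (Ks n) \<Longrightarrow> y \<in> carrier (Ks n) \<Longrightarrow> x = y"
  using Psis_inj by (rule inj_onD)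

lemma level_subfield: "subfield (Psis n ` carrier (Ks n)) K"
proof -
  interpret L: field "Ks n" by (rule Ks_field)
  interpret h: ring_hom_cring "Ks n" K "Psis n" by (rule Psis_cring_hom)
  show ?thesis
    using h.ring.img_is_subfield(2)[OF L.carrier_is_subfield] by simp
qed

lemma kn_subfield: "subfield (kn n) (Ks n)"
  using Ks_galois by (simp add: galois_extension_def)

lemma Psis_kn: "Psis n ` kn n = k"
proof (intro equalityI subsetI)
  fix e assume e: "e \<in> k"
  then obtain x where "x \<in> carrier (Ks n)" "e = Psis n x"
    using k_subset_Psis[of n] by blast
  then show "e \<in> Psis n ` kn n" using e by (auto simp: base_in_def)
qed (auto simp: base_in_def)

text \<open>A spanning list of \<open>Ks n\<close> over its base field gives the generators. Minimal
  polynomials formed inside \<open>Ks n\<close> and transported along \<open>Psis n\<close> have as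
  many roots in the image as their degree.\<close>

lemma finite_normal_level: "finite_normal K k (Psis n ` carrier (Ks n))"
proof -
  interpret L: field "Ks n" by (rule Ks_field)
  interpret h: ring_hom_cring "Ks n" K "Psis n" by (rule Psis_cring_hom)
  let ?E = "Psis n ` carrier (Ks n)"
  obtain Us where Us: "set Us \<subseteq> carrier (Ks n)" "L.Span (kn n) Us = carrier (Ks n)"
    using L.exists_base[OF kn_subfield L.finite_dimensionE[OF kn_subfield Ks_finite]] by blast
  have UsK: "set (map (Psis n) Us) \<subseteq> carrier K" using Us(1) by auto
  have "K.Span (Psis n ` kn n) (map (Psis n) Us) = Psis n ` L.Span (kn n) Us"
    by (rule h.ring.Span_hom) (use Us(1) subfieldE(3)[OF kn_subfield] in auto)
  then have span: "K.Span k (map (Psis n) Us) = ?E"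
    by (simp only: Psis_kn Us(2))
  have sr: "subring (K.finite_extension k (map (Psis n) Us)) K"
    by (rule K.finite_extension_is_subring[OF subfieldE(1)[OF k_subfield] UsK])
  have incl: "k \<subseteq> K.finite_extension k (map (Psis n) Us)"
    by (rule K.finite_extension_incl[OF k_in_K UsK])
  have "subalgebra k (K.finite_extension k (map (Psis n) Us)) K"
  proof (rule subalgebra.intro)
    show "subgroup (K.finite_extension k (map (Psis n) Us)) (add_monoid K)"
      using sr by (rule subring.axioms(1))
    show "subalgebra_axioms k (K.finite_extension k (map (Psis n) Us)) K"
      by (rule subalgebra_axioms.intro) (use subringE(6)[OF sr] incl in blast)
  qed
  then have gen: "?E \<subseteq> K.finite_extension k (map (Psis n) Us)"
    using K.subalgebra_Span_incl[OF k_subfield _ K.finite_extension_mem[OF subfieldE(1)[OF k_subfield] UsK]]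
    unfolding span by blast
  have roots: "\<exists>p\<in>carrier (k[X]\<^bsub>K\<^esub>). p \<noteq> [] \<and> K.eval p x = \<zero>\<^bsub>K\<^esub> \<and>
        card {y \<in> ?E. K.eval p y = \<zero>\<^bsub>K\<^esub>} = degree p" if "x \<in> ?E" for x
  proof -
    from that obtain z where z: "z \<in> carrier (Ks n)" "x = Psis n z" by blast
    have alg: "(L.algebraic over (kn n)) z"
      using Ks_galois[of n] z(1) by (auto simp: galois_extension_def over_def)
    let ?q = "L.Irr (kn n) z"
    note q = L.IrrE[OF kn_subfield z(1) alg]
    have q0: "?q \<noteq> []"
      using L.pirreducibleE(1)[OF subfieldE(1)[OF kn_subfield] q(1,2)] .
    have qs: "set ?q \<subseteq> kn n" using q(1) by (auto simp: univ_poly_def polynomial_def)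
    then have qc: "set ?q \<subseteq> carrier (Ks n)" by (auto simp: base_in_def)
    have ev: "K.eval (map (Psis n) ?q) (Psis n y) = \<zero>\<^bsub>K\<^esub> \<longleftrightarrow> L.eval ?q y = \<zero>\<^bsub>Ks n\<^esub>"
      if "y \<in> carrier (Ks n)" for y
    proof -
      have "K.eval (map (Psis n) ?q) (Psis n y) = Psis n (L.eval ?q y)"
        using h.ring.eval_hom'[OF that qc] by simp
      moreover have "Psis n \<zero>\<^bsub>Ks n\<^esub> = \<zero>\<^bsub>K\<^esub>" by simp
      moreover have "L.eval ?q y \<in> carrier (Ks n)" using L.eval_in_carrier[OF qc that] .
      ultimately show ?thesis
        using inj_on_eq_iff[OF Psis_inj, of "L.eval ?q y" n "\<zero>\<^bsub>Ks n\<^esub>"] by simp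
    qed
    have "set (map (Psis n) ?q) \<subseteq> k" using qs Psis_kn[of n] by auto
    moreover have "hd (map (Psis n) ?q) = \<one>\<^bsub>K\<^esub>" using q(3) q0 by (simp add: hd_map)
    ultimately have pk: "map (Psis n) ?q \<in> carrier (k[X]\<^bsub>K\<^esub>)"
      by (auto simp: univ_poly_def polynomial_def)
    have "{y \<in> ?E. K.eval (map (Psis n) ?q) y = \<zero>\<^bsub>K\<^esub>}
        = Psis n ` {y \<in> carrier (Ks n). L.eval ?q y = \<zero>\<^bsub>Ks n\<^esub>}"
      using ev by auto
    then have "card {y \<in> ?E. K.eval (map (Psis n) ?q) y = \<zero>\<^bsub>K\<^esub>}
        = card {y \<in> carrier (Ks n). L.eval ?q y = \<zero>\<^bsub>Ks n\<^esub>}"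
      using inj_on_subset[OF Psis_inj] by (auto intro: card_image)
    also have "\<dots> = degree (map (Psis n) ?q)"
      using L.galois_extension_roots[OF Ks_galois z(1)] by simp
    finally show ?thesis
      using pk q0 ev[OF z(1)] q(4) z(2) by (intro bexI[OF _ pk]) simp
  qed
  show ?thesis
    unfolding finite_normal_def
    using level_subfield k_subset_Psis gen roots UsK Us(1)
    by (intro conjI exI[of _ "map (Psis n) Us"] ballI) auto
qed

lemma act_gal:
  assumes "g \<in> carrier (G n)"
  shows "restrict (act n g) (carrier (Ks n)) \<in> carrier (gal (Ks n) (kn n))"
  using act_iso[of n] assms by (auto simp: iso_def hom_def)

lemma act_bij: "g \<in> carrier (G n) \<Longrightarrow> bij_betw (act n g) (carrier (Ks n)) (carrier (Ks n))"
  using act_gal[of g n] by (auto simp: gal_def Bij_def cong: bij_betw_cong)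

lemma act_closed [simp]: "g \<in> carrier (G n) \<Longrightarrow> x \<in> carrier (Ks n) \<Longrightarrow> act n g x \<in> carrier (Ks n)"
  using act_bij bij_betwE by blast

lemma act_hom: "g \<in> carrier (G n) \<Longrightarrow> act n g \<in> ring_hom (Ks n) (Ks n)"
proof -
  assume g: "g \<in> carrier (G n)"
  interpret L: field "Ks n" by (rule Ks_field)
  have h: "restrict (act n g) (carrier (Ks n)) \<in> ring_hom (Ks n) (Ks n)"
    using act_gal[OF g] by (auto simp: gal_def)
  show ?thesis
    using ring_hom_mult[OF h] ring_hom_add[OF h] ring_hom_one[OF h] g
    by (intro ring_hom_memI) auto
qed

lemma act_fixes: "g \<in> carrier (G n) \<Longrightarrow> x \<in> kn n \<Longrightarrow> act n g x = x"
  using act_gal[of g n] by (auto simp: gal_def base_in_def)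

lemma act_faithful:
  assumes "g \<in> carrier (G n)" "h \<in> carrier (G n)" "\<And>x. x \<in> carrier (Ks n) \<Longrightarrow> act n g x = act n h x"
  shows "g = h"
proof -
  have "restrict (act n g) (carrier (Ks n)) = restrict (act n h) (carrier (Ks n))"
    using assms(3) by (intro restrict_ext) auto
  then show ?thesis
    using act_iso[of n] assms(1,2) by (auto simp: iso_def bij_betw_def dest: inj_onD)
qed

lemma G_group: "group (G n)"
  using G_computable by (simp add: uniformly_computable_finite_groups_def)

lemma finite_G: "finite (carrier (G n))"
  using G_computable unfolding uniformly_computable_finite_groups_def by (metis List.finite_set)

lemma act_mult:
  assumes "g \<in> carrier (G n)" "h \<in> carrier (G n)" "x \<in> carrier (Ks n)"
  shows "act n (g \<otimes>\<^bsub>G n\<^esub> h) x = act n g (act n h x)"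
proof -
  have "restrict (act n (g \<otimes>\<^bsub>G n\<^esub> h)) (carrier (Ks n))
    = restrict (act n g) (carrier (Ks n)) \<otimes>\<^bsub>gal (Ks n) (kn n)\<^esub> restrict (act n h) (carrier (Ks n))"
    using act_iso[of n] assms by (auto simp: iso_def hom_def)
  also have "\<dots> = compose (carrier (Ks n)) (restrict (act n g) (carrier (Ks n))) (restrict (act n h) (carrier (Ks n)))"
    using act_gal[OF assms(1)] act_gal[OF assms(2)] by (auto simp: gal_def BijGroup_def)
  finally show ?thesis
    using assms by (auto simp: compose_def dest: fun_cong[where x = x])
qed

lemma act_one: "x \<in> carrier (Ks n) \<Longrightarrow> act n \<one>\<^bsub>G n\<^esub> x = x"
proof -
  assume x: "x \<in> carrier (Ks n)"
  interpret group "G n" by (rule G_group)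
  have "act n \<one>\<^bsub>G n\<^esub> (act n \<one>\<^bsub>G n\<^esub> x) = act n \<one>\<^bsub>G n\<^esub> x"
    using act_mult[of "\<one>\<^bsub>G n\<^esub>" n "\<one>\<^bsub>G n\<^esub>" x] x by simp
  then show ?thesis
    using act_bij[of "\<one>\<^bsub>G n\<^esub>" n] x by (auto simp: bij_betw_def dest: inj_onD)
qed

lemma act_surj:
  assumes "a \<in> carrier (gal (Ks n) (kn n))"
  obtains g where "g \<in> carrier (G n)" "\<And>x. x \<in> carrier (Ks n) \<Longrightarrow> act n g x = a x"
proof -
  have "a \<in> (\<lambda>g. restrict (act n g) (carrier (Ks n))) ` carrier (G n)"
    using act_iso[of n] assms by (auto simp: iso_def bij_betw_def)
  then show thesis using that by fastforce
qed

text \<open>\<open>act n\<close> reaches the whole Galois group of \<open>Ks n\<close>, so it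
  suffices to pull \<open>\<psi>\<close> back along \<open>Psis n\<close>.\<close>

lemma level_automorphism:
  assumes hom: "\<psi> \<in> ring_hom (K \<lparr> carrier := Psis n ` carrier (Ks n) \<rparr>) K"
    and bij: "bij_betw \<psi> (Psis n ` carrier (Ks n)) (Psis n ` carrier (Ks n))"
    and fixes_k: "\<And>e. e \<in> k \<Longrightarrow> \<psi> e = e"
  obtains g where "g \<in> carrier (G n)" "\<And>x. x \<in> carrier (Ks n) \<Longrightarrow> Psis n (act n g x) = \<psi> (Psis n x)"
proof -
  interpret L: field "Ks n" by (rule Ks_field)
  interpret h: ring_hom_cring "Ks n" K "Psis n" by (rule Psis_cring_hom)
  let ?E = "Psis n ` carrier (Ks n)"
  let ?j = "inv_into (carrier (Ks n)) (Psis n)"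
  define a where "a = (\<lambda>x\<in>carrier (Ks n). ?j (\<psi> (Psis n x)))"
  have \<psi>E: "\<psi> y \<in> ?E" if "y \<in> ?E" for y using bij that by (rule bij_betw_apply)
  have j: "?j y \<in> carrier (Ks n)" "Psis n (?j y) = y" if "y \<in> ?E" for y
    using that by (auto intro: inv_into_into f_inv_into_f)
  have a: "a x \<in> carrier (Ks n)" "Psis n (a x) = \<psi> (Psis n x)" if "x \<in> carrier (Ks n)" for x
    using that j \<psi>E by (auto simp: a_def)
  have eqI: "x = y" if "x \<in> carrier (Ks n)" "y \<in> carrier (Ks n)" "Psis n x = Psis n y" for x y
    using Psis_inj that by (auto dest: inj_onD)
  have "a \<in> ring_hom (Ks n) (Ks n)"
  proof (rule ring_hom_memI)
    fix x y assume xy: "x \<in> carrier (Ks n)" "y \<in> carrier (Ks n)"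
    show "a (x \<otimes>\<^bsub>Ks n\<^esub> y) = a x \<otimes>\<^bsub>Ks n\<^esub> a y"
      by (rule eqI) (use xy ring_hom_mult[OF hom, of "Psis n x" "Psis n y"] in \<open>auto simp: a\<close>)
    show "a (x \<oplus>\<^bsub>Ks n\<^esub> y) = a x \<oplus>\<^bsub>Ks n\<^esub> a y"
      by (rule eqI) (use xy ring_hom_add[OF hom, of "Psis n x" "Psis n y"] in \<open>auto simp: a\<close>)
  next
    show "a \<one>\<^bsub>Ks n\<^esub> = \<one>\<^bsub>Ks n\<^esub>"
      by (rule eqI) (use ring_hom_one[OF hom] in \<open>auto simp: a\<close>)
  qed (rule a)
  moreover have "a \<in> Bij (carrier (Ks n))"
  proof -
    have "inj_on a (carrier (Ks n))"
    proof (rule inj_onI)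
      fix x y assume xy: "x \<in> carrier (Ks n)" "y \<in> carrier (Ks n)" "a x = a y"
      then have "\<psi> (Psis n x) = \<psi> (Psis n y)" using a by metis
      then have "Psis n x = Psis n y"
        using bij xy by (auto simp: bij_betw_def dest: inj_onD)
      then show "x = y" using xy eqI by blast
    qed
    moreover have "a ` carrier (Ks n) = carrier (Ks n)"
    proof (intro equalityI subsetI)
      fix y assume y: "y \<in> carrier (Ks n)"
      then have "Psis n y \<in> \<psi> ` ?E" using bij by (auto simp: bij_betw_def)
      then obtain x where x: "x \<in> carrier (Ks n)" "Psis n y = \<psi> (Psis n x)" by blast
      have "y = a x" by (rule eqI) (use x y a in auto)
      then show "y \<in> a ` carrier (Ks n)" using x by blast
    qed (use a in auto)
    moreover have "a \<in> extensional (carrier (Ks n))" by (simp add: a_def)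
    ultimately show ?thesis by (simp add: Bij_def bij_betw_def)
  qed
  moreover have "a x = x" if "x \<in> kn n" for x
  proof -
    have "x \<in> carrier (Ks n)" "Psis n x \<in> k" using that by (auto simp: base_in_def)
    with a[of x] fixes_k[of "Psis n x"] show ?thesis
      by (intro Psis_eqD[of n "a x" x]) auto
  qed
  ultimately have "a \<in> carrier (gal (Ks n) (kn n))" by (simp add: gal_def)
  then obtain g where "g \<in> carrier (G n)" "\<And>x. x \<in> carrier (Ks n) \<Longrightarrow> act n g x = a x"
    by (rule act_surj) blast
  then show thesis using that a by auto
qed

text \<open>This is the form in which Galois theory is used below. It is applied with M a simple
  extension (conjugates and generators), a level (surjectivity of restriction) and K itself
  (density).\<close>

lemma embedding_lift:
  assumes "subfield M K" "k \<subseteq> M" "\<phi> \<in> ring_hom (K \<lparr> carrier := M \<rparr>) K" "\<And>e. e \<in> k \<Longrightarrow> \<phi> e = e"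
  obtains g where "g \<in> carrier (G n)"
    "\<And>x. x \<in> carrier (Ks n) \<Longrightarrow> Psis n x \<in> M \<Longrightarrow> Psis n (act n g x) = \<phi> (Psis n x)"
proof -
  obtain \<psi> where \<psi>: "\<psi> \<in> ring_hom (K \<lparr> carrier := Psis n ` carrier (Ks n) \<rparr>) K"
    "bij_betw \<psi> (Psis n ` carrier (Ks n)) (Psis n ` carrier (Ks n))"
    "\<And>e. e \<in> k \<Longrightarrow> \<psi> e = e" "\<And>x. x \<in> M \<Longrightarrow> x \<in> Psis n ` carrier (Ks n) \<Longrightarrow> \<psi> x = \<phi> x"
    using K.extend_hom_finite_normal[OF K_galois finite_normal_level assms] by blast
  obtain g where "g \<in> carrier (G n)" "\<And>x. x \<in> carrier (Ks n) \<Longrightarrow> Psis n (act n g x) = \<psi> (Psis n x)"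
    using level_automorphism[OF \<psi>(1-3)] by blast
  then show thesis using that \<psi>(4) by auto
qed

text \<open>Idempotence of \<open>g\<close> stands for \<open>g\<close> being the identity, which
  keeps the condition decidable from the presented multiplication.\<close>

definition trivial_stab :: "nat \<Rightarrow> nat \<Rightarrow> bool" where
  "trivial_stab n t \<longleftrightarrow> t \<in> carrier (Ks n) \<and> (\<forall>g\<in>carrier (G n). act n g t = t \<longrightarrow> g \<otimes>\<^bsub>G n\<^esub> g = g)"

lemma exists_trivial_stab: "\<exists>t. trivial_stab n t"
proof -
  interpret L: field "Ks n" by (rule Ks_field)
  interpret G: group "G n" by (rule G_group)
  let ?A = "act n ` (carrier (G n) - {\<one>\<^bsub>G n\<^esub>})"
  have "\<exists>t\<in>carrier (Ks n). \<forall>a\<in>?A. a t \<noteq> t"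
  proof (rule L.exists_trivial_stabilizer[OF kn_subfield Ks_finite])
    show "finite ?A" using finite_G by simp
    fix a assume a: "a \<in> ?A"
    then show "a \<in> ring_hom (Ks n) (Ks n)" using act_hom by auto
    show "a x = x" if "x \<in> kn n" for x using a that act_fixes by auto
    show "\<exists>x\<in>carrier (Ks n). a x \<noteq> x"
      using a act_faithful[of _ n "\<one>\<^bsub>G n\<^esub>"] act_one by fastforce
  qed
  then show ?thesis
    unfolding trivial_stab_def by (auto simp: G.idempotent_eq_one)
qed

lemma subfield_simple_extension:
  assumes "t \<in> carrier K"
  shows "subfield (K.simple_extension k t) K" "k \<subseteq> K.simple_extension k t"
    "t \<in> K.simple_extension k t" "(K.algebraic over k) t"
proof -
  show alg: "(K.algebraic over k) t"
    using K_galois assms by (auto simp: galois_extension_def over_def)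
  show "subfield (K.simple_extension k t) K"
    using K.simple_extension_is_subfield[OF k_subfield assms] alg by simp
  show "k \<subseteq> K.simple_extension k t"
    by (rule K.simple_extension_incl[OF k_in_K assms])
  show "t \<in> K.simple_extension k t"
    by (rule K.simple_extension_mem[OF subfieldE(1)[OF k_subfield] assms])
qed

text \<open>A root \<open>y\<close> of the minimal polynomial of \<open>t\<close> is the image of
  \<open>t\<close> under an embedding of k(t), which \<open>embedding_lift\<close> turns into a
  group element. The hypothesis speaks of all polynomials over k because its failure is what
  provides a separating polynomial.\<close>

lemma conjugate_in_orbit:
  assumes t: "t \<in> carrier (Ks n)" and y: "y \<in> carrier K"
    and van: "\<And>p. p \<in> carrier (k[X]\<^bsub>K\<^esub>) \<Longrightarrow> p \<noteq> [] \<Longrightarrow> K.eval p (Psis n t) = \<zero>\<^bsub>K\<^esub> \<Longrightarrow> K.eval p y = \<zero>\<^bsub>K\<^esub>"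
  shows "\<exists>g\<in>carrier (G n). y = Psis n (act n g t)"
proof -
  note s = subfield_simple_extension[OF Psis_closed[OF t]]
  have id: "(\<lambda>x. x) \<in> ring_hom (K \<lparr> carrier := k \<rparr>) K"
    by (intro ring_hom_memI) auto
  note irr = K.IrrE[OF k_subfield Psis_closed[OF t] s(4)]
  have "K.Irr k (Psis n t) \<noteq> []"
    using K.pirreducibleE(1)[OF subfieldE(1)[OF k_subfield] irr(1,2)] .
  then have "K.eval (map (\<lambda>x. x) (K.Irr k (Psis n t))) y = \<zero>\<^bsub>K\<^esub>"
    using van irr by simp
  from K.extend_hom_simple[OF k_subfield id Psis_closed[OF t] s(4) y this]
  obtain \<phi> where \<phi>: "\<phi> \<in> ring_hom (K \<lparr> carrier := K.simple_extension k (Psis n t) \<rparr>) K"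
    "\<And>e. e \<in> k \<Longrightarrow> \<phi> e = e" "\<phi> (Psis n t) = y" by blast
  obtain g where "g \<in> carrier (G n)"
    "\<And>x. x \<in> carrier (Ks n) \<Longrightarrow> Psis n x \<in> K.simple_extension k (Psis n t) \<Longrightarrow> Psis n (act n g x) = \<phi> (Psis n x)"
    using embedding_lift[OF s(1,2) \<phi>(1,2)] by blast
  then show ?thesis using t s(3) \<phi>(3) by (intro bexI[of _ g]) auto
qed

text \<open>If x were outside M = k(t), its minimal polynomial over M would have degree at least 2
  and hence a second root y. The embedding over M sending x to y comes from some g in
  \<open>G n\<close>; it fixes t, so g is the identity, contradicting that x is moved.\<close>

lemma trivial_stab_generates:
  assumes t: "trivial_stab n t" and x: "x \<in> carrier (Ks n)"
  shows "\<exists>p\<in>carrier (k[X]\<^bsub>K\<^esub>). K.eval p (Psis n t) = Psis n x"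
proof (rule ccontr)
  assume neg: "\<not> ?thesis"
  interpret G: group "G n" by (rule G_group)
  have tc: "t \<in> carrier (Ks n)" using t by (simp add: trivial_stab_def)
  let ?M = "K.simple_extension k (Psis n t)"
  note s = subfield_simple_extension[OF Psis_closed[OF tc]]
  have nx: "Psis n x \<notin> ?M"
    using neg K.simple_extension_as_eval_img[OF k_in_K Psis_closed[OF tc]] by auto
  have id: "(\<lambda>x. x) \<in> ring_hom (K \<lparr> carrier := ?M \<rparr>) K"
    using subfieldE(3)[OF s(1)] by (intro ring_hom_memI) auto
  note c = K.galois_conjugate_card[OF K_galois s(1,2) id refl Psis_closed[OF x]]
  note irr = K.IrrE[OF s(1) Psis_closed[OF x] c(1)]
  have "degree (K.Irr ?M (Psis n x)) \<noteq> 1"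
  proof
    assume "degree (K.Irr ?M (Psis n x)) = 1"
    then obtain b where b: "K.Irr ?M (Psis n x) = [\<one>\<^bsub>K\<^esub>, b]"
      using irr(3) by (cases "K.Irr ?M (Psis n x)"; cases "tl (K.Irr ?M (Psis n x))") auto
    then have bM: "b \<in> ?M" using irr(1) by (auto simp: univ_poly_def polynomial_def)
    then have bK: "b \<in> carrier K" using subfieldE(3)[OF s(1)] by auto
    have "Psis n x \<oplus>\<^bsub>K\<^esub> b = \<zero>\<^bsub>K\<^esub>"
      using irr(4) x bK by (simp add: b)
    then have "Psis n x = \<ominus>\<^bsub>K\<^esub> b"
      using K.minus_equality[of "Psis n x" b] x bK by simp
    then have "Psis n x \<in> ?M"
      using subringE(5)[OF subfieldE(1)[OF s(1)] bM] by simp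
    then show False using nx by simp
  qed
  then have deg: "2 \<le> card {y \<in> carrier K. K.eval (map (\<lambda>x. x) (K.Irr ?M (Psis n x))) y = \<zero>\<^bsub>K\<^esub>}"
    using c(2,3) by linarith
  obtain y where y: "y \<in> carrier K" "K.eval (map (\<lambda>x. x) (K.Irr ?M (Psis n x))) y = \<zero>\<^bsub>K\<^esub>" "y \<noteq> Psis n x"
  proof (rule ccontr)
    assume "\<not> thesis"
    then have "{y \<in> carrier K. K.eval (map (\<lambda>x. x) (K.Irr ?M (Psis n x))) y = \<zero>\<^bsub>K\<^esub>} \<subseteq> {Psis n x}"
      using that by blast
    from card_mono[OF _ this] deg show False by simp
  qed
  obtain \<phi> where \<phi>: "\<phi> \<in> ring_hom (K \<lparr> carrier := K.simple_extension ?M (Psis n x) \<rparr>) K"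
    "\<And>e. e \<in> ?M \<Longrightarrow> \<phi> e = e" "\<phi> (Psis n x) = y"
    using K.extend_hom_simple[OF s(1) id Psis_closed[OF x] c(1) y(1,2)] by blast
  have M': "subfield (K.simple_extension ?M (Psis n x)) K"
    using K.simple_extension_is_subfield[OF s(1) Psis_closed[OF x]] c(1) by simp
  have incl: "?M \<subseteq> K.simple_extension ?M (Psis n x)"
    by (rule K.simple_extension_incl[OF subfieldE(3)[OF s(1)] Psis_closed[OF x]])
  obtain g where g: "g \<in> carrier (G n)"
    "\<And>z. z \<in> carrier (Ks n) \<Longrightarrow> Psis n z \<in> K.simple_extension ?M (Psis n x) \<Longrightarrow> Psis n (act n g z) = \<phi> (Psis n z)"
    using embedding_lift[OF M' subset_trans[OF s(2) incl] \<phi>(1)] \<phi>(2) s(2) by blast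
  have "Psis n (act n g t) = Psis n t"
    using g(2)[OF tc] incl s(3) \<phi>(2) by auto
  then have "act n g t = t"
    using Psis_eqD act_closed[OF g(1) tc] tc by blast
  then have "g = \<one>\<^bsub>G n\<^esub>"
    using t g(1) by (auto simp: trivial_stab_def G.idempotent_eq_one)
  moreover have "Psis n x \<in> K.simple_extension ?M (Psis n x)"
    by (rule K.simple_extension_mem[OF subfieldE(1)[OF s(1)] Psis_closed[OF x]])
  ultimately have "Psis n x = y"
    using g(2)[OF x] \<phi>(3) act_one[OF x] by simp
  then show False using y(3) by simp
qed

text \<open>\<open>res\<close> is specified only for n < m; the top level itself needs the
  identity.\<close>

definition resm :: "nat \<Rightarrow> nat \<Rightarrow> nat \<Rightarrow> nat" where
  "resm m n g = (if n < m then res m n g else g)"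

lemma resm_closed: "n \<le> m \<Longrightarrow> g \<in> carrier (G m) \<Longrightarrow> resm m n g \<in> carrier (G n)"
  using res_closed by (auto simp: resm_def)

lemma resm_act: "n \<le> m \<Longrightarrow> g \<in> carrier (G m) \<Longrightarrow> x \<in> carrier (Ks n) \<Longrightarrow> y \<in> carrier (Ks m) \<Longrightarrow>
    Psis m y = Psis n x \<Longrightarrow> Psis m (act m g y) = Psis n (act n (resm m n g) x)"
  using res_act[of n m g x y] Psis_inj[of m] by (auto simp: resm_def le_less dest: inj_onD)

text \<open>The action of g on level n is an embedding over k of a subfield of K, so
  \<open>embedding_lift\<close> realizes it by some element of \<open>G m\<close>; faithfulness of
  the action identifies the restriction of that element with g.\<close>

lemma resm_surj:
  assumes "n \<le> m" "g \<in> carrier (G n)"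
  shows "\<exists>h\<in>carrier (G m). resm m n h = g"
proof -
  interpret L: field "Ks n" by (rule Ks_field)
  interpret h: ring_hom_cring "Ks n" K "Psis n" by (rule Psis_cring_hom)
  let ?E = "Psis n ` carrier (Ks n)"
  let ?j = "inv_into (carrier (Ks n)) (Psis n)"
  let ?\<phi> = "\<lambda>y. Psis n (act n g (?j y))"
  have j: "?j (Psis n x) = x" if "x \<in> carrier (Ks n)" for x
    using Psis_inj that by simp
  note gh = act_hom[OF assms(2)]
  have hom: "?\<phi> \<in> ring_hom (K \<lparr> carrier := ?E \<rparr>) K"
  proof (rule ring_hom_memI; clarsimp simp: j assms(2))
    fix x y assume xy: "x \<in> carrier (Ks n)" "y \<in> carrier (Ks n)"
    show "?\<phi> (Psis n x \<otimes>\<^bsub>K\<^esub> Psis n y) = Psis n (act n g x) \<otimes>\<^bsub>K\<^esub> Psis n (act n g y)"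
      using xy j[of "x \<otimes>\<^bsub>Ks n\<^esub> y"] ring_hom_mult[OF gh xy] assms(2) by simp
    show "?\<phi> (Psis n x \<oplus>\<^bsub>K\<^esub> Psis n y) = Psis n (act n g x) \<oplus>\<^bsub>K\<^esub> Psis n (act n g y)"
      using xy j[of "x \<oplus>\<^bsub>Ks n\<^esub> y"] ring_hom_add[OF gh xy] assms(2) by simp
  next
    show "?\<phi> \<one>\<^bsub>K\<^esub> = \<one>\<^bsub>K\<^esub>"
      using j[of "\<one>\<^bsub>Ks n\<^esub>"] ring_hom_one[OF gh] by simp
  qed
  have fixk: "?\<phi> e = e" if e: "e \<in> k" for e
  proof -
    have "e \<in> ?E" using e k_subset_Psis by blast
    then obtain x where x: "x \<in> carrier (Ks n)" "e = Psis n x" by blast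
    then have "x \<in> kn n" using e by (simp add: base_in_def)
    then show ?thesis using x j assms(2) by (simp add: act_fixes)
  qed
  obtain h where h: "h \<in> carrier (G m)"
    "\<And>x. x \<in> carrier (Ks m) \<Longrightarrow> Psis m x \<in> ?E \<Longrightarrow> Psis m (act m h x) = ?\<phi> (Psis m x)"
    using embedding_lift[OF level_subfield k_subset_Psis hom fixk] by blast
  have "resm m n h = g"
  proof (rule act_faithful[OF resm_closed[OF assms(1) h(1)] assms(2)])
    fix x assume x: "x \<in> carrier (Ks n)"
    then obtain y where y: "y \<in> carrier (Ks m)" "Psis m y = Psis n x"
      using Psis_mono[OF assms(1)] by (metis image_iff subset_iff)
    have "Psis n (act n (resm m n h) x) = Psis m (act m h y)"
      using resm_act[OF assms(1) h(1) x y] by simp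
    also have "\<dots> = Psis n (act n g x)"
      using h(2)[OF y(1)] x y(2) j by simp
    finally show "act n (resm m n h) x = act n g x"
      using Psis_eqD act_closed[OF resm_closed[OF assms(1) h(1)] x] act_closed[OF assms(2) x] by blast
  qed
  with h(1) show ?thesis by blast
qed

end

section \<open>Search and dichotomy along a cohesive set\<close>

section \<open>Partial recursive functions along a cohesive set\<close>

text \<open>Almost every index of C as a filter, so that statements about representatives combine by
  \<open>eventually_elim\<close>.\<close>

definition ae :: "nat set \<Rightarrow> nat filter" where
  "ae C = inf cofinite (principal C)"

lemma almost_subset_iff: "C \<subseteq>\<^sup>* A \<longleftrightarrow> (\<forall>\<^sub>F i in ae C. i \<in> A)"
proof -
  have "C - A = {x. \<not> (x \<in> C \<longrightarrow> x \<in> A)}" by auto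
  then show ?thesis
    by (simp add: ae_def almost_subset_def eventually_inf_principal eventually_cofinite)
qed

lemma ae_nontrivial: "infinite C \<Longrightarrow> ae C \<noteq> bot"
  by (auto simp: ae_def trivial_limit_def eventually_inf_principal eventually_cofinite)

lemma partrec_bind:
  assumes "partrec f" "partrec (\<lambda>z. g (pfst z) (psnd z))"
  shows "partrec (\<lambda>i. Option.bind (f i) (g i))"
proof -
  have "partrec (\<lambda>n. Some n)" using trec_id by (simp add: trec_def)
  from partrec.comp[OF assms(2) partrec.pair[OF this assms(1)]] show ?thesis
    by (rule back_subst[of partrec]) (auto simp: fun_eq_iff split: option.split bind_split)
qed

lemma partrec_None: "partrec (\<lambda>_. None)"
  using partrec_search[of "\<lambda>_ _. False"] tdec_const by simp

lemma partrec_Some: "trec f \<Longrightarrow> partrec (\<lambda>n. Some (f n))"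
  by (simp add: trec_def)

lemma partrec_map:
  assumes "partrec f" "trec (\<lambda>z. g (pfst z) (psnd z))"
  shows "partrec (\<lambda>i. map_option (g i) (f i))"
proof -
  have "partrec (\<lambda>i. Option.bind (f i) (\<lambda>x. Some (g i x)))"
    by (intro partrec_bind assms partrec_Some)
  then show ?thesis
    by (rule back_subst[of partrec]) (auto simp: fun_eq_iff split: option.split bind_split)
qed

definition ppair :: "(nat \<rightharpoonup> nat) \<Rightarrow> (nat \<rightharpoonup> nat) \<Rightarrow> (nat \<rightharpoonup> nat)" where
  "ppair f g i = Option.bind (f i) (\<lambda>a. Option.bind (g i) (\<lambda>b. Some (prod_encode (a, b))))"

lemma partrec_ppair: "partrec f \<Longrightarrow> partrec g \<Longrightarrow> partrec (ppair f g)"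
  unfolding ppair_def[abs_def] by (rule partrec.pair)

lemma ppair_Some [simp]: "ppair f g i = Some z \<longleftrightarrow> f i = Some (pfst z) \<and> g i = Some (psnd z)"
  by (cases "f i"; cases "g i") (auto simp: ppair_def)

lemma ppair_None [simp]: "ppair f g i = None \<longleftrightarrow> f i = None \<or> g i = None"
  by (cases "f i"; cases "g i") (auto simp: ppair_def)

lemma the_ppair: "f i \<noteq> None \<Longrightarrow> g i \<noteq> None \<Longrightarrow> the (ppair f g i) = prod_encode (the (f i), the (g i))"
  by (auto simp: ppair_def)

text \<open>The indices where \<open>f\<close> converges to a value with property \<open>P\<close>
  form a c.e. set, so C is almost contained in it or almost disjoint from it. This replaces the
  failure of an almost-everywhere statement by its almost-everywhere negation.\<close>

lemma cohesive_dichotomy: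
  assumes "cohesive C" "partrec f" "\<forall>\<^sub>F i in ae C. f i \<noteq> None"
    and "tdec (\<lambda>z. P (pfst z) (psnd z))"
  shows "(\<forall>\<^sub>F i in ae C. P i (the (f i))) \<or> (\<forall>\<^sub>F i in ae C. \<not> P i (the (f i)))"
proof -
  let ?h = "\<lambda>i. Option.bind (f i) (\<lambda>x. if P i x then Some (0::nat) else None)"
  have "partrec ?h"
    by (intro partrec_bind assms(2) partrec_if assms(4) partrec.zero partrec_None)
  then have "ce_set (dom ?h)" unfolding ce_set_def by (intro exI[of _ ?h] conjI refl)
  then have "C \<subseteq>\<^sup>* dom ?h \<or> C \<subseteq>\<^sup>* - dom ?h"
    using assms(1) by (simp add: cohesive_def)
  then show ?thesis
  proof
    assume "C \<subseteq>\<^sup>* dom ?h"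
    then have "\<forall>\<^sub>F i in ae C. i \<in> dom ?h" by (simp only: almost_subset_iff)
    then have "\<forall>\<^sub>F i in ae C. P i (the (f i))"
      by eventually_elim (auto split: bind_splits if_splits)
    then show ?thesis ..
  next
    assume "C \<subseteq>\<^sup>* - dom ?h"
    then have "\<forall>\<^sub>F i in ae C. i \<in> - dom ?h" by (simp only: almost_subset_iff)
    with assms(3) have "\<forall>\<^sub>F i in ae C. \<not> P i (the (f i))"
      by eventually_elim (auto split: bind_splits if_splits)
    then show ?thesis ..
  qed
qed

text \<open>The choice is made by unbounded search and is undefined where there is no witness. The
  specification thus holds wherever \<open>g\<close> converges, not just almost everywhere, as
  membership in \<open>cfuns\<close> requires.\<close>

lemma partrec_selection:
  assumes "partrec f" "\<forall>\<^sub>F i in F. f i \<noteq> None"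
    and "tdec (\<lambda>z. P (pfst (pfst z)) (psnd (pfst z)) (psnd z))"
    and "\<forall>\<^sub>F i in F. \<exists>m. P i (the (f i)) m"
  obtains g where "partrec g" "\<forall>\<^sub>F i in F. g i \<noteq> None"
    "\<And>i m. g i = Some m \<Longrightarrow> f i \<noteq> None \<and> P i (the (f i)) m"
proof -
  let ?s = "\<lambda>i x. if \<exists>m. P i x m then Some (LEAST m. P i x m) else None"
  have "partrec (\<lambda>z. ?s (pfst z) (psnd z))"
    by (rule partrec_search[where P = "\<lambda>z m. P (pfst z) (psnd z) m"]) (use assms(3) in simp)
  then have "partrec (\<lambda>i. Option.bind (f i) (?s i))"
    by (rule partrec_bind[OF assms(1)])
  moreover have "\<forall>\<^sub>F i in F. Option.bind (f i) (?s i) \<noteq> None"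
    using assms(2,4) by eventually_elim auto
  moreover have "f i \<noteq> None \<and> P i (the (f i)) m" if "Option.bind (f i) (?s i) = Some m" for i m
    using that by (auto split: bind_splits if_splits intro: LeastI)
  ultimately show thesis using that by blast
qed

text \<open>Dichotomy decides one candidate value at a time; running out of candidates is impossible
  because C is infinite.\<close>

lemma cohesive_constant:
  assumes "cohesive C" "partrec f" "\<forall>\<^sub>F i in ae C. f i \<noteq> None" "finite A" "\<forall>\<^sub>F i in ae C. the (f i) \<in> A"
  obtains a where "a \<in> A" "\<forall>\<^sub>F i in ae C. the (f i) = a"
proof -
  have "\<exists>a\<in>A. \<forall>\<^sub>F i in ae C. the (f i) = a"
    using assms(4,5)
  proof (induction A)
    case empty
    then have "ae C = bot" by (simp add: trivial_limit_def)
    then show ?case using ae_nontrivial assms(1) by (simp add: cohesive_def)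
  next
    case (insert a A)
    have "tdec (\<lambda>z. psnd z = a)" by (intro rec_intros)
    from cohesive_dichotomy[OF assms(1-3) this] show ?case
    proof
      assume "\<forall>\<^sub>F i in ae C. the (f i) \<noteq> a"
      with insert.prems have "\<forall>\<^sub>F i in ae C. the (f i) \<in> A" by eventually_elim auto
      then show ?thesis using insert.IH by blast
    qed auto
  qed
  then show thesis using that by blast
qed

section \<open>Reducing statements about classes to representatives\<close>

section \<open>Classes in cohesive products\<close>

lemma cfuns_iff: "f \<in> cfuns C A \<longleftrightarrow> partrec f \<and> (\<forall>\<^sub>F i in ae C. f i \<noteq> None) \<and>
    (\<forall>i x. f i = Some x \<longrightarrow> (\<exists>D. A i = Some D \<and> x \<in> D))"
  by (auto simp: cfuns_def almost_subset_iff dom_def elim: eventually_mono)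

lemma cfuns_constI:
  assumes "partrec f" "\<forall>\<^sub>F i in ae C. f i \<noteq> None" "\<And>i x. f i = Some x \<Longrightarrow> x \<in> D"
  shows "f \<in> cfuns C (const_seq D)"
  using assms by (auto simp: cfuns_iff)

lemma cfunsD:
  assumes "f \<in> cfuns C A"
  shows "partrec f" "\<forall>\<^sub>F i in ae C. f i \<noteq> None"
  using assms by (auto simp: cfuns_iff)

lemma cfuns_constD: "f \<in> cfuns C (const_seq D) \<Longrightarrow> f i = Some x \<Longrightarrow> x \<in> D"
  by (auto simp: cfuns_iff)

text \<open>Members of \<open>cfuns\<close> converge almost everywhere, so equality of the optional
  values already implies convergence.\<close>

lemma crel_iff: "(f, g) \<in> crel C A \<longleftrightarrow> f \<in> cfuns C A \<and> g \<in> cfuns C A \<and> (\<forall>\<^sub>F i in ae C. f i = g i)"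
proof -
  have "(\<forall>\<^sub>F i in ae C. f i \<noteq> None \<and> g i \<noteq> None \<and> f i = g i) \<longleftrightarrow> (\<forall>\<^sub>F i in ae C. f i = g i)"
    if "f \<in> cfuns C A"
    by (rule eventually_subst) (use cfunsD(2)[OF that] in eventually_elim, auto)
  then show ?thesis
    by (auto simp: crel_def almost_subset_iff)
qed

lemma mem_cclass: "g \<in> cclass C A f \<longleftrightarrow> f \<in> cfuns C A \<and> g \<in> cfuns C A \<and> (\<forall>\<^sub>F i in ae C. f i = g i)"
  by (simp add: cclass_def crel_iff)

lemma cclass_self: "f \<in> cfuns C A \<Longrightarrow> f \<in> cclass C A f"
  by (simp add: mem_cclass)

lemma cclass_eq_iff:
  assumes "f \<in> cfuns C A" "g \<in> cfuns C A"
  shows "cclass C A f = cclass C A g \<longleftrightarrow> (\<forall>\<^sub>F i in ae C. f i = g i)"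
proof
  assume "cclass C A f = cclass C A g"
  then show "\<forall>\<^sub>F i in ae C. f i = g i"
    using cclass_self[OF assms(2)] by (auto simp: mem_cclass)
next
  assume *: "\<forall>\<^sub>F i in ae C. f i = g i"
  have "(\<forall>\<^sub>F i in ae C. f i = h i) \<longleftrightarrow> (\<forall>\<^sub>F i in ae C. g i = h i)" for h
    by (rule eventually_subst) (use * in eventually_elim, simp)
  then show "cclass C A f = cclass C A g"
    using assms by (auto simp: mem_cclass)
qed

lemma cprod_iff: "U \<in> cprod C A \<longleftrightarrow> (\<exists>f\<in>cfuns C A. U = cclass C A f)"
  by (auto simp: cprod_def quotient_def cclass_def)

lemma cclass_in_cprod: "f \<in> cfuns C A \<Longrightarrow> cclass C A f \<in> cprod C A"
  by (auto simp: cprod_iff)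

lemma cclass_rep: "f \<in> cclass C A g \<Longrightarrow> cclass C A g = cclass C A f"
  using cclass_eq_iff[of g C A f] by (auto simp: mem_cclass)

text \<open>A member of the union either has an image in \<open>cfuns\<close>, and then the class of
  \<open>g\<close>, or contributes the empty set.\<close>

lemma Union_cclass:
  assumes "g \<in> cfuns C B" "x \<in> I" "h x = g"
    and "\<And>y. y \<in> I \<Longrightarrow> \<forall>\<^sub>F i in ae C. h y i = g i"
  shows "(\<Union>y\<in>I. cclass C B (h y)) = cclass C B g"
proof (intro equalityI subsetI)
  fix f assume "f \<in> (\<Union>y\<in>I. cclass C B (h y))"
  then obtain y where y: "y \<in> I" "f \<in> cclass C B (h y)" by blast
  then have "h y \<in> cfuns C B" by (simp add: mem_cclass)
  then show "f \<in> cclass C B g"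
    using cclass_eq_iff[of "h y" C B g] assms(1,4) y by auto
qed (use assms(2,3) in auto)

lemma clift1_cclass:
  assumes "f \<in> cfuns C A" "(\<lambda>i. map_option h (f i)) \<in> cfuns C (const_seq D)"
  shows "clift1 C D h (cclass C A f) = cclass C (const_seq D) (\<lambda>i. map_option h (f i))"
  unfolding clift1_def
proof (rule Union_cclass[where x = f and h = "\<lambda>f i. map_option h (f i)", OF assms(2) cclass_self[OF assms(1)] refl])
  fix g assume "g \<in> cclass C A f"
  then have "\<forall>\<^sub>F i in ae C. f i = g i" by (simp add: mem_cclass)
  then show "\<forall>\<^sub>F i in ae C. map_option h (g i) = map_option h (f i)"
    by eventually_elim simp
qed

lemma clift2_cclass:
  assumes "f \<in> cfuns C A" "g \<in> cfuns C B"
    and "(\<lambda>i. Option.bind (f i) (\<lambda>x. Option.bind (g i) (h x))) \<in> cfuns C (const_seq D)"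
  shows "clift2 C D h (cclass C A f) (cclass C B g)
    = cclass C (const_seq D) (\<lambda>i. Option.bind (f i) (\<lambda>x. Option.bind (g i) (h x)))"
proof -
  let ?h = "\<lambda>(f, g) i. Option.bind (f i) (\<lambda>x. Option.bind (g i) (h x))"
  have "clift2 C D h (cclass C A f) (cclass C B g)
    = (\<Union>p\<in>cclass C A f \<times> cclass C B g. cclass C (const_seq D) (?h p))"
    by (auto simp: clift2_def)
  also have "\<dots> = cclass C (const_seq D) (?h (f, g))"
  proof (rule Union_cclass[where x = "(f, g)"])
    fix p assume p: "p \<in> cclass C A f \<times> cclass C B g"
    then have "\<forall>\<^sub>F i in ae C. f i = fst p i" "\<forall>\<^sub>F i in ae C. g i = snd p i"
      by (auto simp: mem_cclass)
    then show "\<forall>\<^sub>F i in ae C. ?h p i = ?h (f, g) i"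
      by eventually_elim (simp add: case_prod_beta)
  qed (use assms in \<open>auto simp: cclass_self\<close>)
  finally show ?thesis by simp
qed

lemma clift_rel_cclass:
  assumes "f \<in> cfuns C A" "g \<in> cfuns C B"
  shows "clift_rel C P (cclass C A f) (cclass C B g) \<longleftrightarrow> (\<forall>\<^sub>F i in ae C. P (the (f i)) (the (g i)))"
proof
  assume "clift_rel C P (cclass C A f) (cclass C B g)"
  then obtain f' g' where fg: "f' \<in> cclass C A f" "g' \<in> cclass C B g"
    "\<forall>\<^sub>F i in ae C. \<exists>x y. f' i = Some x \<and> g' i = Some y \<and> P x y"
    by (auto simp: clift_rel_def almost_subset_iff)
  then have "\<forall>\<^sub>F i in ae C. f i = f' i" "\<forall>\<^sub>F i in ae C. g i = g' i"
    by (auto simp: mem_cclass)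
  with fg(3) show "\<forall>\<^sub>F i in ae C. P (the (f i)) (the (g i))"
    by eventually_elim auto
next
  assume "\<forall>\<^sub>F i in ae C. P (the (f i)) (the (g i))"
  with cfunsD(2)[OF assms(1)] cfunsD(2)[OF assms(2)]
  have "\<forall>\<^sub>F i in ae C. \<exists>x y. f i = Some x \<and> g i = Some y \<and> P x y"
    by eventually_elim auto
  then show "clift_rel C P (cclass C A f) (cclass C B g)"
    using cclass_self[OF assms(1)] cclass_self[OF assms(2)]
    by (auto simp: clift_rel_def almost_subset_iff)
qed

text \<open>Cutting the function down to the indices where the decidable property holds changes it
  only finitely often on C. The new representative has the property wherever it is defined.\<close>

lemma cfuns_restrict:
  assumes "f \<in> cfuns C A" "tdec (\<lambda>z. P (pfst z) (psnd z))" "\<forall>\<^sub>F i in ae C. P i (the (f i))"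
  obtains g where "g \<in> cfuns C A" "cclass C A g = cclass C A f"
    "\<And>i x. g i = Some x \<Longrightarrow> f i = Some x \<and> P i x"
proof -
  let ?g = "\<lambda>i. Option.bind (f i) (\<lambda>x. if P i x then Some x else None)"
  have g: "?g i = Some x \<Longrightarrow> f i = Some x \<and> P i x" for i x
    by (auto split: bind_splits if_splits)
  have "partrec ?g"
    by (intro partrec_bind cfunsD[OF assms(1)] partrec_if assms(2) partrec_Some rec_intros partrec_None)
  moreover have ev: "\<forall>\<^sub>F i in ae C. ?g i = f i"
    using assms(3) cfunsD(2)[OF assms(1)] by eventually_elim auto
  moreover have "\<forall>\<^sub>F i in ae C. ?g i \<noteq> None"
    using ev cfunsD(2)[OF assms(1)] by eventually_elim simp
  ultimately have "?g \<in> cfuns C A"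
    using assms(1) g unfolding cfuns_iff by blast
  moreover from this have "cclass C A ?g = cclass C A f"
    using cclass_eq_iff[OF _ assms(1)] ev by blast
  ultimately show thesis using that g by blast
qed

lemma cclass_cong_ae:
  assumes "f \<in> cfuns C A" "g \<in> cfuns C A" "\<forall>\<^sub>F i in ae C. the (f i) = the (g i)"
  shows "cclass C A f = cclass C A g"
proof -
  have "\<forall>\<^sub>F i in ae C. f i = g i"
    using assms(3) cfunsD(2)[OF assms(1)] cfunsD(2)[OF assms(2)] by eventually_elim auto
  then show ?thesis using cclass_eq_iff[OF assms(1,2)] by simp
qed

lemma cclass_eq_ae:
  assumes "f \<in> cfuns C A" "g \<in> cfuns C A"
  shows "cclass C A f = cclass C A g \<longleftrightarrow> (\<forall>\<^sub>F i in ae C. the (f i) = the (g i))"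
proof
  assume "cclass C A f = cclass C A g"
  then have "\<forall>\<^sub>F i in ae C. f i = g i" using cclass_eq_iff[OF assms] by simp
  then show "\<forall>\<^sub>F i in ae C. the (f i) = the (g i)" by eventually_elim simp
qed (rule cclass_cong_ae[OF assms])

section \<open>Polynomials over F as searchable codes, and recursiveness of the given
  operations\<close>

context computable_galois
begin

lemma k_list_preimage:
  assumes "set p \<subseteq> k"
  obtains d where "set d \<subseteq> carrier F" "map Psi d = p"
proof
  show "set (map (inv_into (carrier F) Psi) p) \<subseteq> carrier F"
    using assms by (auto intro: inv_into_into)
  show "map Psi (map (inv_into (carrier F) Psi) p) = p"
  proof -
    have "map (\<lambda>x. Psi (inv_into (carrier F) Psi x)) p = map (\<lambda>x. x) p"
      by (intro map_cong refl f_inv_into_f) (use assms in auto)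
    then show ?thesis by (simp add: comp_def)
  qed
qed

text \<open>The polynomial over k is split into data that a search can find: the code of an integral
  polynomial and a list of coefficients from F.\<close>

lemma separating_polynomial:
  assumes "t \<in> carrier (Ks n)" "y \<in> carrier K" "\<not> (\<exists>g\<in>carrier (G n). y = Psis n (act n g t))"
  obtains q d where "set d \<subseteq> carrier F" "poly_var q = Suc (length d)"
    "poly_eval K q (Psis n t # map Psi d) = \<zero>\<^bsub>K\<^esub>" "poly_eval K q (y # map Psi d) \<noteq> \<zero>\<^bsub>K\<^esub>"
proof -
  obtain p where p: "p \<in> carrier (k[X]\<^bsub>K\<^esub>)" "p \<noteq> []"
    "K.eval p (Psis n t) = \<zero>\<^bsub>K\<^esub>" "K.eval p y \<noteq> \<zero>\<^bsub>K\<^esub>"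
    using conjugate_in_orbit[OF assms(1,2)] assms(3) by blast
  have pk: "set p \<subseteq> k" using p(1) by (auto simp: univ_poly_def polynomial_def)
  obtain d where d: "set d \<subseteq> carrier F" "map Psi d = p" using k_list_preimage[OF pk] .
  obtain q where q: "poly_var q = Suc (length p)"
    "\<And>x. x \<in> carrier K \<Longrightarrow> poly_eval K q (x # p) = K.eval p x"
    using exists_generic_univariate[of "length p"] p(2) pk K.cring_axioms k_in_K by force
  have "length d = length p" using d(2) by auto
  then show thesis using that[of d q] d q p assms by simp
qed

lemma generating_polynomial:
  assumes "trivial_stab n t" "x \<in> carrier (Ks n)"
  obtains q d where "set d \<subseteq> carrier F" "poly_var q = Suc (length d)"
    "poly_eval K q (Psis n t # map Psi d) = Psis n x"
proof -
  obtain p where p: "p \<in> carrier (k[X]\<^bsub>K\<^esub>)" "K.eval p (Psis n t) = Psis n x"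
    using trivial_stab_generates[OF assms] by blast
  have t: "Psis n t \<in> carrier K" using assms(1) by (simp add: trivial_stab_def)
  \<comment> \<open>The generic polynomial needs a nonempty coefficient list, so the zero polynomial
    is represented by the single coefficient zero.\<close>
  define p' where "p' = (if p = [] then [\<zero>\<^bsub>K\<^esub>] else p)"
  have "\<zero>\<^bsub>K\<^esub> \<in> k" using subringE(2)[OF subfieldE(1)[OF k_subfield]] .
  then have pk: "set p' \<subseteq> k" using p(1) by (auto simp: univ_poly_def polynomial_def p'_def)
  have p': "K.eval p' (Psis n t) = Psis n x" "p' \<noteq> []"
    using p(2) t by (auto simp: p'_def)
  obtain d where d: "set d \<subseteq> carrier F" "map Psi d = p'" using k_list_preimage[OF pk] .
  obtain q where q: "poly_var q = Suc (length p')"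
    "\<And>x. x \<in> carrier K \<Longrightarrow> poly_eval K q (x # p') = K.eval p' x"
    using exists_generic_univariate[of "length p'"] p'(2) pk K.cring_axioms k_in_K by force
  have "length d = length p'" using d(2) by auto
  then show thesis using that[of d q] d q p' t by simp
qed

text \<open>The relation is pulled back to \<open>Ks n\<close>, where \<open>act n g\<close> is a
  ring homomorphism that fixes the coefficients coming from F.\<close>

lemma poly_eval_act:
  assumes "g \<in> carrier (G n)" "t \<in> carrier (Ks n)" "x \<in> carrier (Ks n)"
    and d: "set d \<subseteq> carrier F" "poly_var q = Suc (length d)"
    and ev: "poly_eval K q (Psis n t # map Psi d) = Psis n x"
  shows "poly_eval K q (Psis n (act n g t) # map Psi d) = Psis n (act n g x)"
proof -
  interpret L: field "Ks n" by (rule Ks_field)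
  define e where "e = map (\<lambda>a. inv_into (carrier (Ks n)) (Psis n) (Psi a)) d"
  have i: "Psi a \<in> Psis n ` carrier (Ks n)" if "a \<in> carrier F" for a
    using that k_subset_Psis by blast
  have e: "set e \<subseteq> kn n" "map (Psis n) e = map Psi d"
    using d(1) i by (auto simp: e_def base_in_def subset_iff f_inv_into_f inv_into_into)
  then have ec: "set e \<subseteq> carrier (Ks n)" by (auto simp: base_in_def)
  have len: "length e = length d" by (simp add: e_def)
  have hom: "poly_eval K q (Psis n s # map Psi d) = Psis n (poly_eval (Ks n) q (s # e))"
    if "s \<in> carrier (Ks n)" for s
    using poly_eval_hom[OF L.cring_axioms K.cring_axioms Psis_hom, of "s # e" q] that ec e(2) d(2) len by simp
  have cl: "poly_eval (Ks n) q (t # e) \<in> carrier (Ks n)"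
    using poly_eval_in_carrier[OF L.cring_axioms, of "t # e" q] assms(2) ec d(2) len by simp
  have "poly_eval (Ks n) q (t # e) = x"
    using ev hom[OF assms(2)] Psis_eqD cl assms(3) by metis
  then have "act n g x = poly_eval (Ks n) q (act n g t # map (act n g) e)"
    using poly_eval_hom[OF L.cring_axioms L.cring_axioms act_hom[OF assms(1)], of "t # e" q] assms(2) ec d(2) len
    by simp
  also have "map (act n g) e = e"
    using e(1) act_fixes[OF assms(1)] by (intro map_idI) auto
  finally show ?thesis using hom[of "act n g t"] assms(1,2) by simp
qed

subsection \<open>Total versions of the computable operations\<close>

text \<open>Outside their domains the total versions take the value 0, which may be an element of the fields.\<close>

definition tPsi :: "nat \<Rightarrow> nat" where "tPsi x = (if x \<in> carrier F then Psi x else 0)"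
definition tPsis :: "nat \<Rightarrow> nat \<Rightarrow> nat" where "tPsis n x = (if x \<in> carrier (Ks n) then Psis n x else 0)"
definition tact :: "nat \<Rightarrow> nat \<Rightarrow> nat \<Rightarrow> nat" where
  "tact n g x = (if g \<in> carrier (G n) \<and> x \<in> carrier (Ks n) then act n g x else 0)"
definition tmult :: "nat \<Rightarrow> nat \<Rightarrow> nat \<Rightarrow> nat" where
  "tmult n g h = (if g \<in> carrier (G n) \<and> h \<in> carrier (G n) then g \<otimes>\<^bsub>G n\<^esub> h else 0)"
definition tresm :: "nat \<Rightarrow> nat \<Rightarrow> nat \<Rightarrow> nat" where
  "tresm m n g = (if n \<le> m \<and> g \<in> carrier (G m) then resm m n g else 0)"

lemma tdec_K [rec_intros]: assumes "trec f" shows "tdec (\<lambda>n. f n \<in> carrier K)"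
proof -
  have "tdec (\<lambda>n. (0, f n) \<in> {(i::nat, x). x \<in> carrier K})"
    by (rule computable_set_tdec[where h = "\<lambda>n. prod_encode (0, f n)"])
      (use K_computable assms in \<open>auto intro!: rec_intros simp: computable_field_def uniformly_computable_fields_def\<close>)
  then show ?thesis by simp
qed

lemma tdec_F [rec_intros]: assumes "trec f" shows "tdec (\<lambda>n. f n \<in> carrier F)"
proof -
  have "tdec (\<lambda>n. (0, f n) \<in> {(i::nat, x). x \<in> carrier F})"
    by (rule computable_set_tdec[where h = "\<lambda>n. prod_encode (0, f n)"])
      (use F_computable assms in \<open>auto intro!: rec_intros simp: computable_field_def uniformly_computable_fields_def\<close>)
  then show ?thesis by simp
qed

lemma tdec_Ks [rec_intros]: assumes "trec a" "trec f" shows "tdec (\<lambda>n. f n \<in> carrier (Ks (a n)))"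
proof -
  have "tdec (\<lambda>n. (a n, f n) \<in> {(i, x). x \<in> carrier (Ks i)})"
    by (rule computable_set_tdec[where h = "\<lambda>n. prod_encode (a n, f n)"])
      (use Ks_computable assms in \<open>auto intro!: rec_intros simp: uniformly_computable_fields_def\<close>)
  then show ?thesis by simp
qed

lemma G_elements:
  obtains e where "trec e" "\<And>n. set (list_decode (e n)) = carrier (G n)"
proof -
  obtain elems where el: "\<And>i. set (elems i) = carrier (G i)" "computable_on id UNIV (\<lambda>i. list_encode (elems i))"
    using G_computable by (auto simp: uniformly_computable_finite_groups_def)
  have "trec (\<lambda>n. if True then list_encode (elems n) else 0)"
    by (rule computable_on_trec[OF el(2) trec_id tdec_const]) auto
  then show thesis using that[of "\<lambda>n. list_encode (elems n)"] el(1) by simp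
qed

text \<open>The complete list of elements is computable from the index, so the quantifier is
  bounded. The tests for conjugacy and for trivial stabilizers rest on this.\<close>

lemma tdec_ball_G [rec_intros]:
  assumes "tdec (\<lambda>z. P (pfst z) (psnd z))" "trec a"
  shows "tdec (\<lambda>n. \<forall>g\<in>carrier (G (a n)). P n g)"
proof -
  obtain e where e: "trec e" "\<And>n. set (list_decode (e n)) = carrier (G n)" using G_elements by blast
  have "tdec (\<lambda>n. \<forall>g\<in>set (list_decode (e (a n))). P n g)"
    by (intro rec_intros assms trec_compose[OF e(1)])
  then show ?thesis by (simp only: e(2))
qed

lemma tdec_bex_G [rec_intros]:
  assumes "tdec (\<lambda>z. P (pfst z) (psnd z))" "trec a"
  shows "tdec (\<lambda>n. \<exists>g\<in>carrier (G (a n)). P n g)"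
proof -
  have "tdec (\<lambda>n. \<not> (\<forall>g\<in>carrier (G (a n)). \<not> P n g))" by (intro rec_intros assms)
  then show ?thesis by simp
qed

lemma tdec_G [rec_intros]: assumes "trec a" "trec f" shows "tdec (\<lambda>n. f n \<in> carrier (G (a n)))"
proof -
  have "tdec (\<lambda>n. \<exists>g\<in>carrier (G (a n)). g = f n)" by (intro rec_intros assms trec_compose[OF assms(2)])
  then show ?thesis by simp
qed

lemma trec_tPsi [rec_intros]: assumes "trec f" shows "trec (\<lambda>n. tPsi (f n))"
  unfolding tPsi_def
  by (rule computable_on_trec[OF Psi_computable assms]) (auto intro!: rec_intros assms)

lemma trec_tPsis [rec_intros]: assumes "trec a" "trec f" shows "trec (\<lambda>n. tPsis (a n) (f n))"
proof -
  have "trec (\<lambda>n. if f n \<in> carrier (Ks (a n)) then (case (a n, f n) of (i, x) \<Rightarrow> Psis i x) else 0)"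
    by (rule computable_on_trec[OF Psis_computable trec_pair[OF assms]]) (auto intro!: rec_intros assms)
  then show ?thesis unfolding tPsis_def by (simp only: prod.case)
qed

lemma trec_tact [rec_intros]:
  assumes "trec a" "trec g" "trec f" shows "trec (\<lambda>n. tact (a n) (g n) (f n))"
proof -
  have "trec (\<lambda>n. if g n \<in> carrier (G (a n)) \<and> f n \<in> carrier (Ks (a n))
     then (case (a n, g n, f n) of (i, g, x) \<Rightarrow> act i g x) else 0)"
    by (rule computable_on_trec[OF act_computable trec_pair[OF assms(1) trec_pair[OF assms(2,3)]]])
      (auto intro!: rec_intros assms simp: triple_encode_def)
  then show ?thesis unfolding tact_def by (simp only: prod.case)
qed

lemma trec_tmult [rec_intros]:
  assumes "trec a" "trec g" "trec f" shows "trec (\<lambda>n. tmult (a n) (g n) (f n))"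
proof -
  have c: "computable_on triple_encode {(i, g, h). g \<in> carrier (G i) \<and> h \<in> carrier (G i)}
      (\<lambda>(i, g, h). g \<otimes>\<^bsub>G i\<^esub> h)"
    using G_computable by (simp add: uniformly_computable_finite_groups_def)
  have "trec (\<lambda>n. if g n \<in> carrier (G (a n)) \<and> f n \<in> carrier (G (a n))
     then (case (a n, g n, f n) of (i, g, x) \<Rightarrow> g \<otimes>\<^bsub>G i\<^esub> x) else 0)"
    by (rule computable_on_trec[OF c trec_pair[OF assms(1) trec_pair[OF assms(2,3)]]])
      (auto intro!: rec_intros assms simp: triple_encode_def)
  then show ?thesis unfolding tmult_def by (simp only: prod.case)
qed

lemma trec_tresm [rec_intros]:
  assumes "trec m" "trec a" "trec g" shows "trec (\<lambda>n. tresm (m n) (a n) (g n))"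
proof -
  have "trec (\<lambda>n. if a n < m n \<and> g n \<in> carrier (G (m n))
     then (case (m n, a n, g n) of (m, n, g) \<Rightarrow> res m n g) else 0)"
    by (rule computable_on_trec[OF res_computable trec_pair[OF assms(1) trec_pair[OF assms(2,3)]]])
      (auto intro!: rec_intros assms simp: triple_encode_def)
  then have r: "trec (\<lambda>n. if a n < m n \<and> g n \<in> carrier (G (m n)) then res (m n) (a n) (g n) else 0)"
    by (simp only: prod.case)
  have "trec (\<lambda>n. if a n \<le> m n \<and> g n \<in> carrier (G (m n)) then
     (if a n < m n then (if a n < m n \<and> g n \<in> carrier (G (m n)) then res (m n) (a n) (g n) else 0) else g n) else 0)"
    by (intro trec_if rec_intros assms r)
  then show ?thesis
    by (rule back_subst[of trec]) (auto simp: tresm_def resm_def fun_eq_iff)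
qed

lemma trec_tpoly_eval' [rec_intros]:
  assumes "trec p" "trec a" shows "trec (\<lambda>n. tpoly_eval K (p n) (a n))"
  by (rule trec_compose2[OF trec_tpoly_eval[OF K_computable] assms])

definition tbase :: "nat \<Rightarrow> nat" where
  "tbase a = list_encode (map tPsi (list_decode a))"

lemma trec_tbase [rec_intros]: assumes "trec f" shows "trec (\<lambda>n. tbase (f n))"
  unfolding tbase_def by (rule trec_map) (intro rec_intros assms)+

text \<open>A copy of \<open>trivial_stab\<close> in terms of the total operations, to which the
  closure rules apply.\<close>

definition ttrivial_stab :: "nat \<Rightarrow> nat \<Rightarrow> bool" where
  "ttrivial_stab n t \<longleftrightarrow> t \<in> carrier (Ks n) \<and> (\<forall>g\<in>carrier (G n). tact n g t = t \<longrightarrow> tmult n g g = g)"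

lemma trivial_stab_eq: "trivial_stab = ttrivial_stab"
  by (auto simp: fun_eq_iff trivial_stab_def ttrivial_stab_def tact_def tmult_def)

lemma tdec_trivial_stab [rec_intros]:
  assumes "trec f" "trec g" shows "tdec (\<lambda>n. trivial_stab (f n) (g n))"
  unfolding trivial_stab_eq ttrivial_stab_def
  by (intro rec_intros assms trec_compose[OF assms(1)] trec_compose[OF assms(2)])

definition tcons :: "nat \<Rightarrow> nat \<Rightarrow> nat" where
  "tcons x a = list_encode (x # list_decode a)"

lemma trec_tcons [rec_intros]:
  assumes "trec f" "trec g" shows "trec (\<lambda>n. tcons (f n) (g n))"
  unfolding tcons_def list_encode.simps list_decode_inverse by (intro rec_intros assms)

end

section \<open>Hyper-tuples through representatives, and what hyper-automorphisms preserve\<close>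

section \<open>Hyper-automorphisms\<close>

lemma tuples_iff: "a \<in> tuples D \<longleftrightarrow> set (list_decode a) \<subseteq> D"
  by (auto simp: tuples_def image_iff) (metis in_listsI list_decode_inverse subset_iff)

text \<open>\<open>psing\<close>, \<open>papp\<close> and, below, \<open>peval\<close> and
  \<open>pbase\<close> are the counterparts on representatives of the operations on
  hyper-tuples.\<close>

definition psing :: "(nat \<rightharpoonup> nat) \<Rightarrow> (nat \<rightharpoonup> nat)" where
  "psing f i = map_option (\<lambda>x. list_encode [x]) (f i)"

definition papp :: "(nat \<rightharpoonup> nat) \<Rightarrow> (nat \<rightharpoonup> nat) \<Rightarrow> (nat \<rightharpoonup> nat)" where
  "papp f g i = Option.bind (f i) (\<lambda>a. Option.bind (g i) (\<lambda>b. Some (tup_append a b)))"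

lemma trec_tup_append [rec_intros]: "trec f \<Longrightarrow> trec g \<Longrightarrow> trec (\<lambda>n. tup_append (f n) (g n))"
  unfolding tup_append_def by (rule trec_append)

lemma trec_sing [rec_intros]: "trec f \<Longrightarrow> trec (\<lambda>n. list_encode [f n])"
  unfolding list_encode.simps by (intro rec_intros)

lemma trec_tup_arity [rec_intros]: "trec f \<Longrightarrow> trec (\<lambda>n. tup_arity (f n))"
  unfolding tup_arity_def by (rule trec_length)

lemma psing_cfuns: "f \<in> cfuns C (const_seq D) \<Longrightarrow> psing f \<in> cfuns C (const_seq (tuples D))"
proof (rule cfuns_constI)
  assume f: "f \<in> cfuns C (const_seq D)"
  have "trec (\<lambda>z. list_encode [psnd z])" by (intro rec_intros)
  then show "partrec (psing f)"
    unfolding psing_def[abs_def] by (intro partrec_map cfunsD[OF f])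
  show "\<forall>\<^sub>F i in ae C. psing f i \<noteq> None"
    using cfunsD(2)[OF f] by eventually_elim (simp add: psing_def)
  show "x \<in> tuples D" if "psing f i = Some x" for i x
    using that cfuns_constD[OF f] by (auto simp: psing_def tuples_iff simp del: list_encode.simps)
qed

lemma the_psing: "f i \<noteq> None \<Longrightarrow> the (psing f i) = list_encode [the (f i)]"
  by (auto simp: psing_def)

lemma papp_cfuns:
  assumes "f \<in> cfuns C (const_seq (tuples D))" "g \<in> cfuns C (const_seq (tuples D))"
  shows "papp f g \<in> cfuns C (const_seq (tuples D))"
proof (rule cfuns_constI)
  have "partrec (\<lambda>i. map_option (\<lambda>z. tup_append (pfst z) (psnd z)) (ppair f g i))"
    by (intro partrec_map partrec_ppair cfunsD[OF assms(1)] cfunsD[OF assms(2)] rec_intros)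
  then show "partrec (papp f g)"
    by (rule back_subst[of partrec]) (auto simp: fun_eq_iff ppair_def papp_def split: bind_split)
  show "\<forall>\<^sub>F i in ae C. papp f g i \<noteq> None"
    using cfunsD(2)[OF assms(1)] cfunsD(2)[OF assms(2)] by eventually_elim (auto simp: papp_def)
  show "x \<in> tuples D" if "papp f g i = Some x" for i x
    using that cfuns_constD[OF assms(1), of i] cfuns_constD[OF assms(2), of i]
    by (auto simp: papp_def tuples_iff tup_append_def split: bind_splits)
qed

lemma the_papp: "f i \<noteq> None \<Longrightarrow> g i \<noteq> None \<Longrightarrow> the (papp f g i) = tup_append (the (f i)) (the (g i))"
  by (auto simp: papp_def)

lemma map_option_arity_cfuns:
  assumes "f \<in> cfuns C A" "trec h"
  shows "(\<lambda>i. map_option h (f i)) \<in> cfuns C (const_seq UNIV)"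
proof (rule cfuns_constI)
  show "partrec (\<lambda>i. map_option h (f i))"
    by (intro partrec_map cfunsD[OF assms(1)] trec_compose[OF assms(2)] rec_intros)
  show "\<forall>\<^sub>F i in ae C. map_option h (f i) \<noteq> None"
    using cfunsD(2)[OF assms(1)] by eventually_elim simp
qed simp

lemma clift1_UNIV_eq_iff:
  assumes "f \<in> cfuns C A" "g \<in> cfuns C B" "trec h" "trec h'"
  shows "clift1 C UNIV h (cclass C A f) = clift1 C UNIV h' (cclass C B g)
    \<longleftrightarrow> (\<forall>\<^sub>F i in ae C. h (the (f i)) = h' (the (g i)))"
proof -
  note c = map_option_arity_cfuns[OF assms(1,3)] map_option_arity_cfuns[OF assms(2,4)]
  have "clift1 C UNIV h (cclass C A f) = clift1 C UNIV h' (cclass C B g)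
    \<longleftrightarrow> (\<forall>\<^sub>F i in ae C. the (map_option h (f i)) = the (map_option h' (g i)))"
    using clift1_cclass[OF assms(1) c(1)] clift1_cclass[OF assms(2) c(2)] cclass_eq_ae[OF c] by simp
  also have "\<dots> \<longleftrightarrow> (\<forall>\<^sub>F i in ae C. h (the (f i)) = h' (the (g i)))"
    by (rule eventually_subst)
      (use cfunsD(2)[OF assms(1)] cfunsD(2)[OF assms(2)] in eventually_elim, auto)
  finally show ?thesis .
qed

locale cohesive_galois = computable_galois +
  fixes C :: "nat set"
  assumes C: "cohesive C"
begin

abbreviation "fT \<equiv> cfuns C (const_seq (tuples (carrier K)))"
abbreviation "fK \<equiv> cfuns C (const_seq (carrier K))"
abbreviation "fB \<equiv> cfuns C (const_seq (tuples (carrier F)))"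
abbreviation "fN \<equiv> cfuns C (const_seq UNIV)"
abbreviation "tc \<equiv> cclass C (const_seq (tuples (carrier K)))"
abbreviation "kc \<equiv> cclass C (const_seq (carrier K))"
abbreviation "nc \<equiv> cclass C (const_seq UNIV)"
abbreviation "H \<equiv> hyper_tuples C K"
abbreviation "HA \<equiv> HAut C K F Psi"
abbreviation "sing \<equiv> hyper_singleton C K"

lemma ae_C: "ae C \<noteq> bot"
  using C ae_nontrivial by (simp add: cohesive_def)

lemma tc_H [simp]: "f \<in> fT \<Longrightarrow> tc f \<in> H"
  by (rule cclass_in_cprod)

lemma H_cases:
  assumes "a \<in> H" obtains f where "f \<in> fT" "a = tc f"
  using assms by (auto simp: cprod_iff)

lemma tc_eq_iff: "f \<in> fT \<Longrightarrow> g \<in> fT \<Longrightarrow> tc f = tc g \<longleftrightarrow> (\<forall>\<^sub>F i in ae C. the (f i) = the (g i))"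
  by (rule cclass_eq_ae)

lemma sing_kc: "f \<in> fK \<Longrightarrow> sing (kc f) = tc (psing f)"
  unfolding hyper_singleton_def using clift1_cclass[of f C _ "\<lambda>x. list_encode [x]"] psing_cfuns[of f C]
  by (simp add: psing_def[abs_def])

lemma append_tc: "f \<in> fT \<Longrightarrow> g \<in> fT \<Longrightarrow> hyper_append C K (tc f) (tc g) = tc (papp f g)"
  unfolding hyper_append_def using papp_cfuns[of f C _ g] clift2_cclass[of f C _ g]
  by (simp add: papp_def[abs_def])

lemma arity_eq_iff: "f \<in> fT \<Longrightarrow> g \<in> fT \<Longrightarrow>
    hyper_arity C (tc f) = hyper_arity C (tc g) \<longleftrightarrow> (\<forall>\<^sub>F i in ae C. tup_arity (the (f i)) = tup_arity (the (g i)))"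
  unfolding hyper_arity_def
  by (rule clift1_UNIV_eq_iff) (assumption | rule trec_tup_arity[OF trec_id])+

lemma arity_var_eq_iff: "f \<in> fT \<Longrightarrow> q \<in> fN \<Longrightarrow>
    hyper_arity C (tc f) = hyper_var C (nc q) \<longleftrightarrow> (\<forall>\<^sub>F i in ae C. tup_arity (the (f i)) = poly_var (the (q i)))"
  unfolding hyper_arity_def hyper_var_def
  by (rule clift1_UNIV_eq_iff) (assumption | rule trec_tup_arity[OF trec_id] trec_poly_var[OF trec_id])+

lemma prefix_iff: "f \<in> fT \<Longrightarrow> g \<in> fT \<Longrightarrow>
    hyper_prefix C (tc f) (tc g) \<longleftrightarrow> (\<forall>\<^sub>F i in ae C. tup_prefix (the (f i)) (the (g i)))"
  unfolding hyper_prefix_def by (rule clift_rel_cclass)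

definition peval :: "(nat \<rightharpoonup> nat) \<Rightarrow> (nat \<rightharpoonup> nat) \<Rightarrow> (nat \<rightharpoonup> nat)" where
  "peval q f i = Option.bind (q i) (\<lambda>p. Option.bind (f i) (\<lambda>a.
     if tup_arity a = poly_var p then Some (poly_eval K p (list_decode a)) else None))"

lemma peval_fK:
  assumes "q \<in> fN" "f \<in> fT" "\<forall>\<^sub>F i in ae C. tup_arity (the (f i)) = poly_var (the (q i))"
  shows "peval q f \<in> fK"
proof (rule cfuns_constI)
  have "partrec (\<lambda>i. Option.bind (ppair q f i) (\<lambda>z. if tup_arity (psnd z) = poly_var (pfst z)
    then Some (tpoly_eval K (pfst z) (psnd z)) else None))"
    by (intro partrec_bind partrec_ppair cfunsD[OF assms(1)] cfunsD[OF assms(2)] partrec_if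
        partrec_Some partrec_None rec_intros)
  then show "partrec (peval q f)"
  proof (rule back_subst[of partrec], intro ext)
    fix i
    show "Option.bind (ppair q f i) (\<lambda>z. if tup_arity (psnd z) = poly_var (pfst z)
      then Some (tpoly_eval K (pfst z) (psnd z)) else None) = peval q f i"
      using cfuns_constD[OF assms(2), of i]
      by (cases "q i"; cases "f i") (auto simp: ppair_def peval_def tpoly_eval_def tuples_iff tup_arity_def)
  qed
  show "\<forall>\<^sub>F i in ae C. peval q f i \<noteq> None"
    using cfunsD(2)[OF assms(1)] cfunsD(2)[OF assms(2)] assms(3)
    by eventually_elim (auto simp: peval_def)
  show "x \<in> carrier K" if "peval q f i = Some x" for i x
    using that cfuns_constD[OF assms(2), of i]
    by (auto simp: peval_def tuples_iff tup_arity_def intro!: poly_eval_in_carrier[OF K.cring_axioms]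
        split: bind_splits if_splits)
qed

lemma eval_nc_tc:
  assumes "q \<in> fN" "f \<in> fT" "\<forall>\<^sub>F i in ae C. tup_arity (the (f i)) = poly_var (the (q i))"
  shows "hyper_eval C K (nc q) (tc f) = kc (peval q f)"
  unfolding hyper_eval_def using clift2_cclass[OF assms(1,2)] peval_fK[OF assms]
  by (simp add: peval_def[abs_def])

lemma the_peval:
  assumes "q i \<noteq> None" "f i \<noteq> None" "tup_arity (the (f i)) = poly_var (the (q i))"
  shows "the (peval q f i) = poly_eval K (the (q i)) (list_decode (the (f i)))"
  using assms by (auto simp: peval_def)

definition pbase :: "(nat \<rightharpoonup> nat) \<Rightarrow> (nat \<rightharpoonup> nat)" where
  "pbase f i = map_option (\<lambda>a. list_encode (map Psi (list_decode a))) (f i)"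

lemma pbase_fT:
  assumes "f \<in> fB" shows "pbase f \<in> fT"
proof (rule cfuns_constI)
  have "partrec (\<lambda>i. map_option tbase (f i))"
    by (intro partrec_map cfunsD[OF assms] rec_intros)
  then show "partrec (pbase f)"
  proof (rule back_subst[of partrec], intro ext)
    fix i
    show "map_option tbase (f i) = pbase f i"
      using cfuns_constD[OF assms, of i]
      by (cases "f i") (auto simp: pbase_def tbase_def tuples_iff tPsi_def subset_iff
          intro!: arg_cong[where f = list_encode])
  qed
  show "\<forall>\<^sub>F i in ae C. pbase f i \<noteq> None"
    using cfunsD(2)[OF assms] by eventually_elim (simp add: pbase_def)
  show "x \<in> tuples (carrier K)" if "pbase f i = Some x" for i x
    using that cfuns_constD[OF assms, of i] by (auto simp: pbase_def tuples_iff subset_iff)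
qed

lemma hyper_base_iff: "a \<in> hyper_tuples_base C K F Psi \<longleftrightarrow> (\<exists>f\<in>fB. a = tc (pbase f))"
proof -
  have "clift1 C (tuples (carrier K)) (\<lambda>a. list_encode (map Psi (list_decode a)))
      (cclass C (const_seq (tuples (carrier F))) f) = tc (pbase f)" if "f \<in> fB" for f
    using clift1_cclass[OF that] pbase_fT[OF that] by (simp add: pbase_def[abs_def])
  moreover have "hyper_tuples C F = cclass C (const_seq (tuples (carrier F))) ` fB"
    by (auto simp: cprod_iff)
  ultimately have "hyper_tuples_base C K F Psi = (\<lambda>f. tc (pbase f)) ` fB"
    by (simp add: hyper_tuples_base_def image_image cong: image_cong)
  then show ?thesis by blast
qed

definition hauto :: "((nat \<rightharpoonup> nat) set \<Rightarrow> (nat \<rightharpoonup> nat) set) \<Rightarrow> bool" where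
  "hauto \<sigma> \<longleftrightarrow> \<sigma> \<in> Bij H \<and>
    (\<forall>a\<in>H. \<forall>b\<in>H. (hyper_prefix C (\<sigma> a) (\<sigma> b) \<longleftrightarrow> hyper_prefix C a b) \<and>
       \<sigma> (hyper_append C K a b) = hyper_append C K (\<sigma> a) (\<sigma> b)) \<and>
    (\<forall>a\<in>H. hyper_arity C (\<sigma> a) = hyper_arity C a) \<and>
    (\<forall>p\<in>cpow C UNIV. \<forall>a\<in>H. hyper_arity C a = hyper_var C p \<longrightarrow>
       sing (hyper_eval C K p (\<sigma> a)) = \<sigma> (sing (hyper_eval C K p a))) \<and>
    (\<forall>a\<in>hyper_tuples_base C K F Psi. \<sigma> a = a)"

lemma HA_carrier: "carrier HA = Collect hauto"
  by (auto simp: HAut_def hauto_def)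

lemma append_H: "a \<in> H \<Longrightarrow> b \<in> H \<Longrightarrow> hyper_append C K a b \<in> H"
  by (elim H_cases) (simp add: append_tc papp_cfuns)

lemma sing_eval_H:
  assumes "p \<in> cpow C UNIV" "a \<in> H" "hyper_arity C a = hyper_var C p"
  shows "sing (hyper_eval C K p a) \<in> H"
proof -
  obtain f where f: "f \<in> fT" "a = tc f" using H_cases[OF assms(2)] .
  obtain q where q: "q \<in> fN" "p = nc q" using assms(1) by (auto simp: cprod_iff)
  have ev: "\<forall>\<^sub>F i in ae C. tup_arity (the (f i)) = poly_var (the (q i))"
    using assms(3) f q arity_var_eq_iff by simp
  show ?thesis
    using eval_nc_tc[OF q(1) f(1) ev] peval_fK[OF q(1) f(1) ev] f q by (simp add: sing_kc psing_cfuns)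
qed

lemma base_H: "a \<in> hyper_tuples_base C K F Psi \<Longrightarrow> a \<in> H"
  by (auto simp: hyper_base_iff pbase_fT)

text \<open>For inverses, each clause for \<open>f\<close> is applied at preimages;
  \<open>append_H\<close>, \<open>sing_eval_H\<close> and \<open>base_H\<close> ensure that the
  intermediate values lie where \<open>f\<close> is a bijection.\<close>

lemma HA_subgroup: "subgroup (carrier HA) (BijGroup H)"
proof (rule BijGroup_subgroup; unfold HA_carrier)
  show "Collect hauto \<subseteq> Bij H" by (auto simp: hauto_def)
  show "(\<lambda>x\<in>H. x) \<in> Collect hauto"
    by (auto simp: hauto_def id_Bij append_H sing_eval_H base_H)
  fix f assume f: "f \<in> Collect hauto"
  have fH: "f a \<in> H" if "a \<in> H" for a
    using f that Bij_imp_funcset[of f H] by (auto simp: hauto_def)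
  {
    fix g assume g: "g \<in> Collect hauto"
    have gH: "g a \<in> H" if "a \<in> H" for a
      using g that Bij_imp_funcset[of g H] by (auto simp: hauto_def)
    show "compose H f g \<in> Collect hauto"
      using f g fH gH compose_Bij[of f H g] append_H sing_eval_H base_H
      by (simp add: hauto_def compose_def)
  }
  let ?g = "\<lambda>x\<in>H. inv_into H f x"
  have fB: "f \<in> Bij H" using f by (simp add: hauto_def)
  have bij: "bij_betw f H H" using fB by (simp add: Bij_def)
  have g: "?g a \<in> H" "f (?g a) = a" if "a \<in> H" for a
    using that bij_betw_inv_into_right[OF bij that] bij_betw_apply[OF bij_betw_inv_into[OF bij] that]
    by simp_all
  have g': "?g (f a) = a" if "a \<in> H" for a
    using bij_betw_inv_into_left[OF bij that] fH[OF that] by simp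
  have "hauto ?g"
    unfolding hauto_def
  proof (intro conjI ballI impI)
    show "?g \<in> Bij H" by (rule restrict_inv_into_Bij[OF fB])
    fix a assume a: "a \<in> H"
    {
      fix b assume b: "b \<in> H"
      show "hyper_prefix C (?g a) (?g b) \<longleftrightarrow> hyper_prefix C a b"
        using f g[OF a] g[OF b] unfolding hauto_def mem_Collect_eq by metis
      have "f (hyper_append C K (?g a) (?g b)) = hyper_append C K a b"
        using f g[OF a] g[OF b] unfolding hauto_def mem_Collect_eq by metis
      then show "?g (hyper_append C K a b) = hyper_append C K (?g a) (?g b)"
        using g'[of "hyper_append C K (?g a) (?g b)"] append_H g(1)[OF a] g(1)[OF b] by metis
    }
    show ar: "hyper_arity C (?g a) = hyper_arity C a"
      using f g[OF a] unfolding hauto_def mem_Collect_eq by metis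
    fix p assume p: "p \<in> cpow C UNIV" "hyper_arity C a = hyper_var C p"
    have "sing (hyper_eval C K p (f (?g a))) = f (sing (hyper_eval C K p (?g a)))"
      using f p g(1)[OF a] ar unfolding hauto_def mem_Collect_eq by metis
    then show "sing (hyper_eval C K p (?g a)) = ?g (sing (hyper_eval C K p a))"
      using g'[OF sing_eval_H[OF p(1) g(1)[OF a]]] ar p(2) g(2)[OF a] by simp
  next
    fix a assume a: "a \<in> hyper_tuples_base C K F Psi"
    then have "f a = a" using f by (simp add: hauto_def)
    then show "?g a = a" using g'[OF base_H[OF a]] by simp
  qed
  then show "?g \<in> Collect hauto" by simp
qed

lemma HA_group: "group HA"
proof -
  have "HA = BijGroup H \<lparr>carrier := carrier HA\<rparr>" by (simp add: HAut_def)
  then show ?thesis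
    using subgroup.subgroup_is_group[OF HA_subgroup group_BijGroup] by simp
qed

lemma HA_one: "\<one>\<^bsub>HA\<^esub> = (\<lambda>x\<in>H. x)"
  by (simp add: HAut_def BijGroup_def)

lemma HA_mult: "\<sigma> \<in> carrier HA \<Longrightarrow> \<tau> \<in> carrier HA \<Longrightarrow> \<sigma> \<otimes>\<^bsub>HA\<^esub> \<tau> = compose H \<sigma> \<tau>"
  by (auto simp: HA_carrier hauto_def HAut_def BijGroup_def)

lemma hauto_H: "hauto \<sigma> \<Longrightarrow> a \<in> H \<Longrightarrow> \<sigma> a \<in> H"
  using Bij_imp_funcset[of \<sigma> H] by (auto simp: hauto_def)

lemma hauto_append: "hauto \<sigma> \<Longrightarrow> a \<in> H \<Longrightarrow> b \<in> H \<Longrightarrow>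
    \<sigma> (hyper_append C K a b) = hyper_append C K (\<sigma> a) (\<sigma> b)"
  by (simp add: hauto_def)

lemma hauto_arity: "hauto \<sigma> \<Longrightarrow> a \<in> H \<Longrightarrow> hyper_arity C (\<sigma> a) = hyper_arity C a"
  by (simp add: hauto_def)

lemma hauto_base: "hauto \<sigma> \<Longrightarrow> f \<in> fB \<Longrightarrow> \<sigma> (tc (pbase f)) = tc (pbase f)"
proof -
  assume \<sigma>: "hauto \<sigma>" and f: "f \<in> fB"
  have "tc (pbase f) \<in> hyper_tuples_base C K F Psi"
    unfolding hyper_base_iff using f by blast
  with \<sigma> show ?thesis by (simp add: hauto_def)
qed

text \<open>Arity is preserved, so the image has arity 1 almost everywhere. After
  \<open>cfuns_restrict\<close> this holds wherever the representative is defined, and its entries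
  represent an element of the power of K.\<close>

lemma hauto_sing:
  assumes "hauto \<sigma>" "y \<in> fK"
  obtains y' where "y' \<in> fK" "\<sigma> (tc (psing y)) = tc (psing y')"
proof -
  have y: "psing y \<in> fT" using psing_cfuns[OF assms(2)] .
  obtain f where f: "f \<in> fT" "\<sigma> (tc (psing y)) = tc f"
    using hauto_H[OF assms(1) tc_H[OF y]] H_cases by blast
  have "\<forall>\<^sub>F i in ae C. tup_arity (the (f i)) = tup_arity (the (psing y i))"
    using hauto_arity[OF assms(1) tc_H[OF y]] f y arity_eq_iff by simp
  with cfunsD(2)[OF assms(2)] have ev: "\<forall>\<^sub>F i in ae C. tup_arity (the (f i)) = 1"
    by eventually_elim (simp add: the_psing tup_arity_def del: list_encode.simps)
  have "tdec (\<lambda>z. tup_arity (psnd z) = 1)" by (intro rec_intros)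
  then obtain g where g: "g \<in> fT" "tc g = tc f" "\<And>i x. g i = Some x \<Longrightarrow> f i = Some x \<and> tup_arity x = 1"
    using cfuns_restrict[where P = "\<lambda>_ a. tup_arity a = 1", OF f(1) _ ev] by blast
  define y' where "y' i = map_option (\<lambda>a. lnth a 0) (g i)" for i
  have len: "list_decode a = [lnth a 0]" if "tup_arity a = 1" for a
    using that by (auto simp: lnth_def tup_arity_def length_Suc_conv)
  have y': "y' \<in> fK"
  proof (rule cfuns_constI)
    show "partrec y'"
      unfolding y'_def[abs_def] by (intro partrec_map cfunsD[OF g(1)] rec_intros)
    show "\<forall>\<^sub>F i in ae C. y' i \<noteq> None"
      using cfunsD(2)[OF g(1)] by eventually_elim (simp add: y'_def)
    show "x \<in> carrier K" if "y' i = Some x" for i x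
      using that g(3)[of i] cfuns_constD[OF g(1), of i] len
      by (fastforce simp: y'_def tuples_iff)
  qed
  have "psing y' = g"
  proof
    fix i
    show "psing y' i = g i"
    proof (cases "g i")
      case (Some a)
      then have "list_encode [lnth a 0] = a"
        using g(3)[of i a] len[of a] by (metis list_decode_inverse)
      then show ?thesis using Some by (simp add: psing_def y'_def del: list_encode.simps)
    qed (simp add: psing_def y'_def)
  qed
  then show thesis using that[OF y'] f(2) g(2) by simp
qed

text \<open>The polynomial is applied to the tuple consisting of \<open>y\<close> followed by the
  coefficients \<open>c\<close>. Since \<open>\<sigma>\<close> respects concatenation and fixes the
  part over F, the image tuple is \<open>y'\<close> followed by the same \<open>c\<close>.\<close>

lemma hauto_poly:
  assumes \<sigma>: "hauto \<sigma>" and y: "y \<in> fK" "y' \<in> fK" "\<sigma> (tc (psing y)) = tc (psing y')"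
    and q: "q \<in> fN" and c: "c \<in> fB"
    and var: "\<forall>\<^sub>F i in ae C. poly_var (the (q i)) = Suc (length (list_decode (the (c i))))"
    and z: "z \<in> fK" "\<forall>\<^sub>F i in ae C. poly_eval K (the (q i)) (the (y i) # map Psi (list_decode (the (c i)))) = the (z i)"
  obtains z' where "z' \<in> fK" "\<sigma> (tc (psing z)) = tc (psing z')"
    "\<forall>\<^sub>F i in ae C. poly_eval K (the (q i)) (the (y' i) # map Psi (list_decode (the (c i)))) = the (z' i)"
proof -
  note cT = pbase_fT[OF c]
  let ?a = "\<lambda>y. papp (psing y) (pbase c)"
  have a: "?a y \<in> fT" if "y \<in> fK" for y using papp_cfuns[OF psing_cfuns[OF that] cT] .
  have the_a: "\<forall>\<^sub>F i in ae C. list_decode (the (?a y i)) = the (y i) # map Psi (list_decode (the (c i)))"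
    if "y \<in> fK" for y
    using cfunsD(2)[OF c] cfunsD(2)[OF that]
  proof eventually_elim
    case (elim i)
    then have "the (?a y i) = tup_append (list_encode [the (y i)]) (the (pbase c i))"
      by (auto simp: the_papp the_psing pbase_def psing_def papp_def)
    then show ?case using elim by (auto simp: tup_append_def pbase_def simp del: list_encode.simps)
  qed
  have ar: "\<forall>\<^sub>F i in ae C. tup_arity (the (?a y i)) = poly_var (the (q i))" if "y \<in> fK" for y
    using the_a[OF that] var by eventually_elim (simp add: tup_arity_def)
  have ev: "\<forall>\<^sub>F i in ae C. the (peval q (?a y) i) = poly_eval K (the (q i)) (the (y i) # map Psi (list_decode (the (c i))))"
    if "y \<in> fK" for y
    using the_a[OF that] ar[OF that] cfunsD(2)[OF q] cfunsD(2)[OF a[OF that]]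
    by eventually_elim (simp add: the_peval)
  have img: "\<sigma> (tc (?a y)) = tc (?a y')"
    using hauto_append[OF \<sigma> tc_H[OF psing_cfuns[OF y(1)]] tc_H[OF cT]] y(3) hauto_base[OF \<sigma> c]
    by (simp add: append_tc psing_cfuns y cT)
  have "kc (peval q (?a y)) = kc z"
  proof (rule cclass_cong_ae[OF peval_fK[OF q a[OF y(1)] ar[OF y(1)]] z(1)])
    show "\<forall>\<^sub>F i in ae C. the (peval q (?a y) i) = the (z i)"
      using ev[OF y(1)] z(2) by eventually_elim simp
  qed
  then have "\<sigma> (tc (psing z)) = \<sigma> (sing (hyper_eval C K (nc q) (tc (?a y))))"
    by (simp add: eval_nc_tc[OF q a[OF y(1)] ar[OF y(1)]] sing_kc z(1))
  also have "\<dots> = sing (hyper_eval C K (nc q) (tc (?a y')))"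
  proof -
    have "nc q \<in> cpow C UNIV" using q by (rule cclass_in_cprod)
    moreover have "hyper_arity C (tc (?a y)) = hyper_var C (nc q)"
      using arity_var_eq_iff[OF a[OF y(1)] q] ar[OF y(1)] by simp
    ultimately show ?thesis
      using \<sigma> tc_H[OF a[OF y(1)]] img unfolding hauto_def by metis
  qed
  also have "\<dots> = tc (psing (peval q (?a y')))"
    using eval_nc_tc[OF q a[OF y(2)] ar[OF y(2)]] peval_fK[OF q a[OF y(2)] ar[OF y(2)]] by (simp add: sing_kc)
  finally have "\<sigma> (tc (psing z)) = tc (psing (peval q (?a y')))" .
  moreover have "\<forall>\<^sub>F i in ae C. poly_eval K (the (q i)) (the (y' i) # map Psi (list_decode (the (c i))))
      = the (peval q (?a y') i)"
    using ev[OF y(2)] by eventually_elim simp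
  ultimately show thesis
    using that peval_fK[OF q a[OF y(2)] ar[OF y(2)]] by blast
qed

lemma psing_tc_eq_iff: "y \<in> fK \<Longrightarrow> z \<in> fK \<Longrightarrow>
    tc (psing y) = tc (psing z) \<longleftrightarrow> (\<forall>\<^sub>F i in ae C. the (y i) = the (z i))"
proof -
  assume yz: "y \<in> fK" "z \<in> fK"
  have "tc (psing y) = tc (psing z) \<longleftrightarrow> (\<forall>\<^sub>F i in ae C. the (psing y i) = the (psing z i))"
    using tc_eq_iff psing_cfuns yz by simp
  also have "\<dots> \<longleftrightarrow> (\<forall>\<^sub>F i in ae C. the (y i) = the (z i))"
    by (rule eventually_subst)
      (use cfunsD(2)[OF yz(1)] cfunsD(2)[OF yz(2)] in eventually_elim, auto simp: the_psing)
  finally show ?thesis .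
qed

end

section \<open>The group element by which a hyper-automorphism acts on a product of levels\<close>

section \<open>Action of hyper-automorphisms on finite levels\<close>

context cohesive_galois
begin

lemma list_decode_tbase: "set (list_decode d) \<subseteq> carrier F \<Longrightarrow> list_decode (tbase d) = map Psi (list_decode d)"
  by (auto simp: tbase_def tPsi_def)

lemma tpoly_eval_base:
  assumes "set (list_decode d) \<subseteq> carrier F" "x \<in> carrier K" "poly_var q = Suc (length (list_decode d))"
  shows "tpoly_eval K q (tcons x (tbase d)) = poly_eval K q (x # map Psi (list_decode d))"
  using assms by (auto simp: tpoly_eval_def tcons_def list_decode_tbase subset_iff simp del: list_encode.simps)

abbreviation lev :: "(nat \<rightharpoonup> nat) \<Rightarrow> (nat \<rightharpoonup> nat set)" where
  "lev \<nu> \<equiv> (\<lambda>i. map_option (\<lambda>n. carrier (Ks n)) (\<nu> i))"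

abbreviation glev :: "(nat \<rightharpoonup> nat) \<Rightarrow> (nat \<rightharpoonup> nat set)" where
  "glev \<nu> \<equiv> (\<lambda>i. map_option (\<lambda>n. carrier (G n)) (\<nu> i))"

definition pPsis :: "(nat \<rightharpoonup> nat) \<Rightarrow> (nat \<rightharpoonup> nat) \<Rightarrow> (nat \<rightharpoonup> nat)" where
  "pPsis \<nu> f i = Option.bind (\<nu> i) (\<lambda>n. map_option (Psis n) (f i))"

definition pact :: "(nat \<rightharpoonup> nat) \<Rightarrow> (nat \<rightharpoonup> nat) \<Rightarrow> (nat \<rightharpoonup> nat) \<Rightarrow> (nat \<rightharpoonup> nat)" where
  "pact \<nu> \<gamma> f i = Option.bind (\<nu> i) (\<lambda>n. Option.bind (\<gamma> i) (\<lambda>g. map_option (act n g) (f i)))"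

lemma levD: "f \<in> cfuns C (lev \<nu>) \<Longrightarrow> f i = Some x \<Longrightarrow> \<exists>n. \<nu> i = Some n \<and> x \<in> carrier (Ks n)"
  unfolding cfuns_iff by fastforce

lemma glevD: "f \<in> cfuns C (glev \<nu>) \<Longrightarrow> f i = Some x \<Longrightarrow> \<exists>n. \<nu> i = Some n \<and> x \<in> carrier (G n)"
  unfolding cfuns_iff by fastforce

lemma levI:
  assumes "partrec f" "\<forall>\<^sub>F i in ae C. f i \<noteq> None"
    "\<And>i x. f i = Some x \<Longrightarrow> \<nu> i \<noteq> None \<and> x \<in> carrier (Ks (the (\<nu> i)))"
  shows "f \<in> cfuns C (lev \<nu>)"
  unfolding cfuns_iff using assms by fastforce

lemma glevI:
  assumes "partrec f" "\<forall>\<^sub>F i in ae C. f i \<noteq> None"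
    "\<And>i x. f i = Some x \<Longrightarrow> \<nu> i \<noteq> None \<and> x \<in> carrier (G (the (\<nu> i)))"
  shows "f \<in> cfuns C (glev \<nu>)"
  unfolding cfuns_iff using assms by fastforce

lemma lev_ae:
  assumes "f \<in> cfuns C (lev \<nu>)"
  shows "\<forall>\<^sub>F i in ae C. f i \<noteq> None \<and> \<nu> i \<noteq> None \<and> the (f i) \<in> carrier (Ks (the (\<nu> i)))"
  using cfunsD(2)[OF assms] by eventually_elim (use levD[OF assms] in fastforce)

lemma glev_ae:
  assumes "f \<in> cfuns C (glev \<nu>)"
  shows "\<forall>\<^sub>F i in ae C. f i \<noteq> None \<and> \<nu> i \<noteq> None \<and> the (f i) \<in> carrier (G (the (\<nu> i)))"
  using cfunsD(2)[OF assms] by eventually_elim (use glevD[OF assms] in fastforce)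

lemma pPsis_fK:
  assumes "partrec \<nu>" "f \<in> cfuns C (lev \<nu>)"
  shows "pPsis \<nu> f \<in> fK"
proof (rule cfuns_constI)
  have "partrec (\<lambda>i. map_option (\<lambda>z. tPsis (pfst z) (psnd z)) (ppair \<nu> f i))"
    by (intro partrec_map partrec_ppair assms(1) cfunsD[OF assms(2)] rec_intros)
  then show "partrec (pPsis \<nu> f)"
  proof (rule back_subst[of partrec], intro ext)
    fix i
    show "map_option (\<lambda>z. tPsis (pfst z) (psnd z)) (ppair \<nu> f i) = pPsis \<nu> f i"
      using levD[OF assms(2), of i] by (cases "\<nu> i"; cases "f i") (auto simp: ppair_def pPsis_def tPsis_def)
  qed
  show "\<forall>\<^sub>F i in ae C. pPsis \<nu> f i \<noteq> None"
    using lev_ae[OF assms(2)] by eventually_elim (auto simp: pPsis_def)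
  show "x \<in> carrier K" if "pPsis \<nu> f i = Some x" for i x
    using that levD[OF assms(2), of i] by (auto simp: pPsis_def split: bind_splits)
qed

lemma the_pPsis: "\<nu> i \<noteq> None \<Longrightarrow> f i \<noteq> None \<Longrightarrow> the (pPsis \<nu> f i) = Psis (the (\<nu> i)) (the (f i))"
  by (auto simp: pPsis_def)

lemma pact_lev:
  assumes "partrec \<nu>" "\<gamma> \<in> cfuns C (glev \<nu>)" "f \<in> cfuns C (lev \<nu>)"
  shows "pact \<nu> \<gamma> f \<in> cfuns C (lev \<nu>)"
proof (rule levI)
  have "partrec (\<lambda>i. map_option (\<lambda>z. tact (pfst z) (pfst (psnd z)) (psnd (psnd z))) (ppair \<nu> (ppair \<gamma> f) i))"
    by (intro partrec_map partrec_ppair assms(1) cfunsD[OF assms(2)] cfunsD[OF assms(3)] rec_intros)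
  then show "partrec (pact \<nu> \<gamma> f)"
  proof (rule back_subst[of partrec], intro ext)
    fix i
    show "map_option (\<lambda>z. tact (pfst z) (pfst (psnd z)) (psnd (psnd z))) (ppair \<nu> (ppair \<gamma> f) i) = pact \<nu> \<gamma> f i"
      using levD[OF assms(3), of i] glevD[OF assms(2), of i]
      by (cases "\<nu> i"; cases "f i"; cases "\<gamma> i") (auto simp: ppair_def pact_def tact_def)
  qed
  show "\<forall>\<^sub>F i in ae C. pact \<nu> \<gamma> f i \<noteq> None"
    using lev_ae[OF assms(3)] glev_ae[OF assms(2)] by eventually_elim (auto simp: pact_def)
  show "\<nu> i \<noteq> None \<and> x \<in> carrier (Ks (the (\<nu> i)))" if "pact \<nu> \<gamma> f i = Some x" for i x
    using that levD[OF assms(3), of i] glevD[OF assms(2), of i]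
    by (auto simp: pact_def split: bind_splits)
qed

lemma the_pact: "\<nu> i \<noteq> None \<Longrightarrow> \<gamma> i \<noteq> None \<Longrightarrow> f i \<noteq> None \<Longrightarrow>
    the (pact \<nu> \<gamma> f i) = act (the (\<nu> i)) (the (\<gamma> i)) (the (f i))"
  by (auto simp: pact_def)

abbreviation cst :: "nat \<Rightarrow> nat \<rightharpoonup> nat" where "cst x \<equiv> (\<lambda>_. Some x)"

lemma cst_cfuns: "x \<in> D \<Longrightarrow> cst x \<in> cfuns C (const_seq D)"
  by (rule cfuns_constI) (auto intro: partrec_Some rec_intros)

lemma hauto_k:
  assumes "hauto \<sigma>" "a \<in> carrier F"
  shows "\<sigma> (tc (psing (cst (Psi a)))) = tc (psing (cst (Psi a)))"
proof -
  have "cst (list_encode [a]) \<in> fB"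
    using assms(2) by (intro cst_cfuns) (simp add: tuples_iff del: list_encode.simps)
  moreover have "pbase (cst (list_encode [a])) = psing (cst (Psi a))"
    by (auto simp: fun_eq_iff pbase_def psing_def simp del: list_encode.simps)
  ultimately show ?thesis using hauto_base[OF assms(1)] by metis
qed

lemma Psi_zero: "Psi \<zero>\<^bsub>F\<^esub> = \<zero>\<^bsub>K\<^esub>"
proof -
  interpret h: ring_hom_cring F K Psi by unfold_locales (rule Psi_hom)
  show ?thesis by simp
qed

text \<open>One search result codes both a polynomial and its coefficient list; the two parts become
  elements of different products.\<close>

lemma split_poly_code:
  assumes "partrec s" "\<forall>\<^sub>F i in ae C. s i \<noteq> None"
    "\<And>i m. s i = Some m \<Longrightarrow> \<forall>d\<in>set (list_decode (psnd m)). d \<in> carrier F"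
  shows "(\<lambda>i. map_option pfst (s i)) \<in> fN" "(\<lambda>i. map_option psnd (s i)) \<in> fB"
proof -
  show "(\<lambda>i. map_option pfst (s i)) \<in> fN"
    by (rule cfuns_constI; (intro partrec_map assms(1) rec_intros)?)
      (use assms(2) in \<open>auto elim: eventually_mono\<close>)
  show "(\<lambda>i. map_option psnd (s i)) \<in> fB"
    by (rule cfuns_constI; (intro partrec_map assms(1) rec_intros)?)
      (use assms(2,3) in \<open>auto elim: eventually_mono simp: tuples_iff\<close>)
qed

text \<open>
  If the image of a generator \<open>t\<close> were not conjugate to it at almost all indices, a separating
  polynomial over the base field could be found by search, and the corresponding hyper-polynomial
  would contradict that \<open>\<sigma>\<close> fixes zero. The images of all other elements are then determined by
  expressing them as polynomials in the generator.
\<close>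

lemma hauto_level:
  assumes \<sigma>: "hauto \<sigma>" and \<nu>: "\<nu> \<in> fN"
  obtains \<gamma> where "\<gamma> \<in> cfuns C (glev \<nu>)"
    "\<And>f. f \<in> cfuns C (lev \<nu>) \<Longrightarrow> \<sigma> (tc (psing (pPsis \<nu> f))) = tc (psing (pPsis \<nu> (pact \<nu> \<gamma> f)))"
proof -
  note \<nu>p = cfunsD[OF \<nu>]
  have "tdec (\<lambda>z. trivial_stab (psnd (pfst z)) (psnd z))" by (intro rec_intros)
  moreover have "\<forall>\<^sub>F i in ae C. \<exists>m. trivial_stab (the (\<nu> i)) m"
    using exists_trivial_stab by simp
  \<comment> \<open>\<open>\<theta>\<close> picks a generator of each level by search.\<close>
  ultimately obtain \<theta> where \<theta>: "partrec \<theta>" "\<forall>\<^sub>F i in ae C. \<theta> i \<noteq> None"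
    "\<And>i m. \<theta> i = Some m \<Longrightarrow> \<nu> i \<noteq> None \<and> trivial_stab (the (\<nu> i)) m"
    using partrec_selection[where P = "\<lambda>i n m. trivial_stab n m", OF \<nu>p] by blast
  have \<theta>l: "\<theta> \<in> cfuns C (lev \<nu>)"
    by (rule levI[OF \<theta>(1,2)]) (use \<theta>(3) in \<open>auto simp: trivial_stab_def\<close>)
  note yK = pPsis_fK[OF \<nu>p(1) \<theta>l]
  obtain y' where y': "y' \<in> fK" "\<sigma> (tc (psing (pPsis \<nu> \<theta>))) = tc (psing y')"
    using hauto_sing[OF \<sigma> yK] .
  \<comment> \<open>Dichotomy and selection refer to one partial recursive function, so all data
    that the following searches depend on are packed into \<open>w\<close>.\<close>
  define w where "w = ppair (ppair \<nu> \<theta>) y'"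
  have w: "partrec w" "\<forall>\<^sub>F i in ae C. w i \<noteq> None"
    using \<nu>p \<theta>(1,2) cfunsD[OF y'(1)]
    by (auto simp: w_def intro!: partrec_ppair eventually_conj eventually_elim2)
  have wdef: "\<forall>\<^sub>F i in ae C. the (w i) = prod_encode (prod_encode (the (\<nu> i), the (\<theta> i)), the (y' i))
      \<and> trivial_stab (the (\<nu> i)) (the (\<theta> i)) \<and> the (y' i) \<in> carrier K
      \<and> the (pPsis \<nu> \<theta> i) = Psis (the (\<nu> i)) (the (\<theta> i))"
    using \<nu>p(2) \<theta>(2) cfunsD(2)[OF y'(1)]
  proof eventually_elim
    case (elim i)
    then show ?case using \<theta>(3)[of i] cfuns_constD[OF y'(1), of i]
      by (auto simp: w_def the_ppair the_pPsis)
  qed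
  let ?conj = "\<lambda>i x. \<exists>g\<in>carrier (G (pfst (pfst x))). tPsis (pfst (pfst x)) (tact (pfst (pfst x)) g (psnd (pfst x))) = psnd x"
  have "tdec (\<lambda>z. ?conj (pfst z) (psnd z))" by (intro rec_intros)
  from cohesive_dichotomy[OF C w this]
  have conj: "\<forall>\<^sub>F i in ae C. ?conj i (the (w i))"
  proof
    \<comment> \<open>Conjugacy is decidable because the group is finite and listed, so this is the
      only alternative to conjugacy almost everywhere.\<close>
    assume nc: "\<forall>\<^sub>F i in ae C. \<not> ?conj i (the (w i))"
    let ?P = "\<lambda>i x m. (\<forall>d\<in>set (list_decode (psnd m)). d \<in> carrier F) \<and>
       poly_var (pfst m) = Suc (length (list_decode (psnd m))) \<and>
       tpoly_eval K (pfst m) (tcons (tPsis (pfst (pfst x)) (psnd (pfst x))) (tbase (psnd m))) = \<zero>\<^bsub>K\<^esub> \<and>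
       tpoly_eval K (pfst m) (tcons (psnd x) (tbase (psnd m))) \<noteq> \<zero>\<^bsub>K\<^esub>"
    have "tdec (\<lambda>z. ?P (pfst (pfst z)) (psnd (pfst z)) (psnd z))" by (intro rec_intros)
    moreover have "\<forall>\<^sub>F i in ae C. \<exists>m. ?P i (the (w i)) m"
      using wdef nc
    proof eventually_elim
      case (elim i)
      let ?n = "the (\<nu> i)" and ?t = "the (\<theta> i)" and ?y = "the (y' i)"
      have t: "?t \<in> carrier (Ks ?n)" using elim by (simp add: trivial_stab_def)
      have e: "the (w i) = prod_encode (prod_encode (?n, ?t), ?y)" and y: "?y \<in> carrier K"
        and nc': "\<not> ?conj i (the (w i))"
        using elim by blast+
      have "?y \<noteq> Psis ?n (act ?n g ?t)" if "g \<in> carrier (G ?n)" for g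
      proof -
        have "tPsis ?n (tact ?n g ?t) \<noteq> ?y"
          using nc' that unfolding e prod_encode_inverse fst_conv snd_conv by blast
        then show ?thesis using that t by (simp add: tPsis_def tact_def)
      qed
      then have nb: "\<not> (\<exists>g\<in>carrier (G ?n). ?y = Psis ?n (act ?n g ?t))" by blast
      obtain q d where qd: "set d \<subseteq> carrier F" "poly_var q = Suc (length d)"
        "poly_eval K q (Psis ?n ?t # map Psi d) = \<zero>\<^bsub>K\<^esub>" "poly_eval K q (?y # map Psi d) \<noteq> \<zero>\<^bsub>K\<^esub>"
        using separating_polynomial[OF t y nb] .
      have te: "tpoly_eval K q (tcons z (tbase (list_encode d))) = poly_eval K q (z # map Psi d)"
        if "z \<in> carrier K" for z
        using tpoly_eval_base[of "list_encode d" z q] qd that by simp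
      have "?P i (the (w i)) (prod_encode (q, list_encode d))"
        unfolding e prod_encode_inverse fst_conv snd_conv list_encode_inverse
        using qd t y by (simp add: tPsis_def te subset_iff)
      then show ?case by blast
    qed
    ultimately obtain s where s: "partrec s" "\<forall>\<^sub>F i in ae C. s i \<noteq> None"
      "\<And>i m. s i = Some m \<Longrightarrow> w i \<noteq> None \<and> ?P i (the (w i)) m"
      using partrec_selection[where P = ?P, OF w] by blast
    define q where "q i = map_option pfst (s i)" for i
    define c where "c i = map_option psnd (s i)" for i
    have qc: "q \<in> fN" "c \<in> fB"
      unfolding q_def[abs_def] c_def[abs_def] using s(3) by (intro split_poly_code[OF s(1,2)]; blast)+
    have all: "\<forall>\<^sub>F i in ae C. poly_var (the (q i)) = Suc (length (list_decode (the (c i)))) \<and>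
      poly_eval K (the (q i)) (the (pPsis \<nu> \<theta> i) # map Psi (list_decode (the (c i)))) = \<zero>\<^bsub>K\<^esub> \<and>
      poly_eval K (the (q i)) (the (y' i) # map Psi (list_decode (the (c i)))) \<noteq> \<zero>\<^bsub>K\<^esub>"
      using wdef s(2)
    proof eventually_elim
      case (elim i)
      then obtain m where m: "s i = Some m" by auto
      have t: "the (\<theta> i) \<in> carrier (Ks (the (\<nu> i)))" using elim by (simp add: trivial_stab_def)
      have e: "the (w i) = prod_encode (prod_encode (the (\<nu> i), the (\<theta> i)), the (y' i))"
        and y: "the (y' i) \<in> carrier K" "the (pPsis \<nu> \<theta> i) = Psis (the (\<nu> i)) (the (\<theta> i))"
        using elim by blast+
      have P: "?P i (the (w i)) m" using s(3)[OF m] by blast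
      have d: "set (list_decode (psnd m)) \<subseteq> carrier F" "poly_var (pfst m) = Suc (length (list_decode (psnd m)))"
        using P by blast+
      show ?case
        using P[unfolded e prod_encode_inverse fst_conv snd_conv] t y tpoly_eval_base[OF d(1) _ d(2)]
        by (simp add: q_def c_def m tPsis_def)
    qed
    \<comment> \<open>The polynomial vanishes at the generator and \<open>\<sigma>\<close> fixes 0,
      so its value at the image would be 0 almost everywhere, contrary to its choice.\<close>
    have z: "cst \<zero>\<^bsub>K\<^esub> \<in> fK" by (rule cst_cfuns) simp
    obtain z' where z': "z' \<in> fK" "\<sigma> (tc (psing (cst \<zero>\<^bsub>K\<^esub>))) = tc (psing z')"
      "\<forall>\<^sub>F i in ae C. poly_eval K (the (q i)) (the (y' i) # map Psi (list_decode (the (c i)))) = the (z' i)"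
    proof (rule hauto_poly[OF \<sigma> yK y' qc _ z])
      show "\<forall>\<^sub>F i in ae C. poly_var (the (q i)) = Suc (length (list_decode (the (c i))))"
        using all by eventually_elim simp
      show "\<forall>\<^sub>F i in ae C. poly_eval K (the (q i)) (the (pPsis \<nu> \<theta> i) # map Psi (list_decode (the (c i)))) = the (cst \<zero>\<^bsub>K\<^esub> i)"
        using all by eventually_elim simp
    qed blast
    have "tc (psing (cst \<zero>\<^bsub>K\<^esub>)) = tc (psing z')"
      using hauto_k[OF \<sigma>, of "\<zero>\<^bsub>F\<^esub>"] z'(2) by (simp add: Psi_zero)
    then have "\<forall>\<^sub>F i in ae C. \<zero>\<^bsub>K\<^esub> = the (z' i)"
      using psing_tc_eq_iff[OF z z'(1)] by simp
    with all z'(3) have "\<forall>\<^sub>F i in ae C. False" by eventually_elim simp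
    then show ?thesis using ae_C by simp
  qed
  \<comment> \<open>With conjugacy established almost everywhere, the group element itself can be
    searched for.\<close>
  let ?Q = "\<lambda>i x g. g \<in> carrier (G (pfst (pfst x))) \<and> tPsis (pfst (pfst x)) (tact (pfst (pfst x)) g (psnd (pfst x))) = psnd x"
  have "tdec (\<lambda>z. ?Q (pfst (pfst z)) (psnd (pfst z)) (psnd z))" by (intro rec_intros)
  moreover have "\<forall>\<^sub>F i in ae C. \<exists>g. ?Q i (the (w i)) g"
    using conj by eventually_elim blast
  ultimately obtain \<gamma> where \<gamma>: "partrec \<gamma>" "\<forall>\<^sub>F i in ae C. \<gamma> i \<noteq> None"
    "\<And>i g. \<gamma> i = Some g \<Longrightarrow> w i \<noteq> None \<and> ?Q i (the (w i)) g"
    using partrec_selection[where P = ?Q, OF w] by blast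
  have \<gamma>l: "\<gamma> \<in> cfuns C (glev \<nu>)"
  proof (rule glevI[OF \<gamma>(1,2)])
    fix i g assume "\<gamma> i = Some g"
    from \<gamma>(3)[OF this] show "\<nu> i \<noteq> None \<and> g \<in> carrier (G (the (\<nu> i)))"
      by (auto simp: w_def the_ppair)
  qed
  have "\<sigma> (tc (psing (pPsis \<nu> f))) = tc (psing (pPsis \<nu> (pact \<nu> \<gamma> f)))" if f: "f \<in> cfuns C (lev \<nu>)" for f
  proof -
    define v where "v = ppair (ppair \<nu> \<theta>) f"
    have v: "partrec v" "\<forall>\<^sub>F i in ae C. v i \<noteq> None"
      using \<nu>p \<theta>(1,2) cfunsD[OF f]
      by (auto simp: v_def intro!: partrec_ppair eventually_conj eventually_elim2)
    have vdef: "\<forall>\<^sub>F i in ae C. the (v i) = prod_encode (prod_encode (the (\<nu> i), the (\<theta> i)), the (f i))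
      \<and> the (f i) \<in> carrier (Ks (the (\<nu> i))) \<and> the (pPsis \<nu> f i) = Psis (the (\<nu> i)) (the (f i))"
      using \<nu>p(2) \<theta>(2) lev_ae[OF f] by eventually_elim (auto simp: v_def the_ppair the_pPsis)
    \<comment> \<open>At each index the polynomial found expresses the given element of the level in
      terms of the generator.\<close>
    let ?P = "\<lambda>i x m. (\<forall>d\<in>set (list_decode (psnd m)). d \<in> carrier F) \<and>
       poly_var (pfst m) = Suc (length (list_decode (psnd m))) \<and>
       tpoly_eval K (pfst m) (tcons (tPsis (pfst (pfst x)) (psnd (pfst x))) (tbase (psnd m)))
         = tPsis (pfst (pfst x)) (psnd x)"
    have "tdec (\<lambda>z. ?P (pfst (pfst z)) (psnd (pfst z)) (psnd z))" by (intro rec_intros)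
    moreover have "\<forall>\<^sub>F i in ae C. \<exists>m. ?P i (the (v i)) m"
      using wdef vdef
    proof eventually_elim
      case (elim i)
      let ?n = "the (\<nu> i)" and ?t = "the (\<theta> i)" and ?x = "the (f i)"
      have t: "?t \<in> carrier (Ks ?n)" using elim by (simp add: trivial_stab_def)
      have gen: "trivial_stab ?n ?t" "?x \<in> carrier (Ks ?n)" using elim by blast+
      obtain q d where qd: "set d \<subseteq> carrier F" "poly_var q = Suc (length d)"
        "poly_eval K q (Psis ?n ?t # map Psi d) = Psis ?n ?x"
        using generating_polynomial[OF gen] .
      have e: "the (v i) = prod_encode (prod_encode (?n, ?t), ?x)" and x: "?x \<in> carrier (Ks ?n)"
        using elim by blast+
      have te: "tpoly_eval K q (tcons z (tbase (list_encode d))) = poly_eval K q (z # map Psi d)"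
        if "z \<in> carrier K" for z
        using tpoly_eval_base[of "list_encode d" z q] qd that by simp
      have "?P i (the (v i)) (prod_encode (q, list_encode d))"
        unfolding e prod_encode_inverse fst_conv snd_conv list_encode_inverse
        using qd t x by (simp add: tPsis_def te subset_iff)
      then show ?case by blast
    qed
    ultimately obtain s where s: "partrec s" "\<forall>\<^sub>F i in ae C. s i \<noteq> None"
      "\<And>i m. s i = Some m \<Longrightarrow> v i \<noteq> None \<and> ?P i (the (v i)) m"
      using partrec_selection[where P = ?P, OF v] by blast
    define q where "q i = map_option pfst (s i)" for i
    define c where "c i = map_option psnd (s i)" for i
    have qc: "q \<in> fN" "c \<in> fB"
      unfolding q_def[abs_def] c_def[abs_def] using s(3) by (intro split_poly_code[OF s(1,2)]; blast)+
    have all: "\<forall>\<^sub>F i in ae C. poly_var (the (q i)) = Suc (length (list_decode (the (c i)))) \<and>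
      set (list_decode (the (c i))) \<subseteq> carrier F \<and>
      poly_eval K (the (q i)) (the (pPsis \<nu> \<theta> i) # map Psi (list_decode (the (c i)))) = the (pPsis \<nu> f i)"
      using wdef vdef s(2)
    proof eventually_elim
      case (elim i)
      then obtain m where m: "s i = Some m" by auto
      have t: "the (\<theta> i) \<in> carrier (Ks (the (\<nu> i)))" using elim by (simp add: trivial_stab_def)
      have e: "the (v i) = prod_encode (prod_encode (the (\<nu> i), the (\<theta> i)), the (f i))"
        and y: "the (f i) \<in> carrier (Ks (the (\<nu> i)))" "the (pPsis \<nu> \<theta> i) = Psis (the (\<nu> i)) (the (\<theta> i))"
          "the (pPsis \<nu> f i) = Psis (the (\<nu> i)) (the (f i))"
        using elim by blast+
      have P: "?P i (the (v i)) m" using s(3)[OF m] by blast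
      have d: "set (list_decode (psnd m)) \<subseteq> carrier F" "poly_var (pfst m) = Suc (length (list_decode (psnd m)))"
        using P by blast+
      show ?case
        using P[unfolded e prod_encode_inverse fst_conv snd_conv] t y tpoly_eval_base[OF d(1) _ d(2)]
        by (simp add: q_def c_def m tPsis_def d)
    qed
    note zK = pPsis_fK[OF \<nu>p(1) f]
    obtain z' where z': "z' \<in> fK" "\<sigma> (tc (psing (pPsis \<nu> f))) = tc (psing z')"
      "\<forall>\<^sub>F i in ae C. poly_eval K (the (q i)) (the (y' i) # map Psi (list_decode (the (c i)))) = the (z' i)"
    proof (rule hauto_poly[OF \<sigma> yK y' qc _ zK])
      show "\<forall>\<^sub>F i in ae C. poly_var (the (q i)) = Suc (length (list_decode (the (c i))))"
        using all by eventually_elim simp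
      show "\<forall>\<^sub>F i in ae C. poly_eval K (the (q i)) (the (pPsis \<nu> \<theta> i) # map Psi (list_decode (the (c i)))) = the (pPsis \<nu> f i)"
        using all by eventually_elim simp
    qed blast
    have fK': "pPsis \<nu> (pact \<nu> \<gamma> f) \<in> fK"
      by (rule pPsis_fK[OF \<nu>p(1) pact_lev[OF \<nu>p(1) \<gamma>l f]])
    have "\<forall>\<^sub>F i in ae C. the (z' i) = the (pPsis \<nu> (pact \<nu> \<gamma> f) i)"
      using z'(3) all wdef vdef \<gamma>(2) \<nu>p(2) cfunsD(2)[OF f] cfunsD(2)[OF pact_lev[OF \<nu>p(1) \<gamma>l f]]
    proof eventually_elim
      case (elim i)
      let ?n = "the (\<nu> i)" and ?t = "the (\<theta> i)" and ?x = "the (f i)" and ?g = "the (\<gamma> i)"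
      have t: "?t \<in> carrier (Ks ?n)" using elim by (simp add: trivial_stab_def)
      from elim obtain g where g: "\<gamma> i = Some g" by auto
      have gy: "g \<in> carrier (G ?n)" "the (y' i) = Psis ?n (act ?n g ?t)"
      proof -
        have e: "the (w i) = prod_encode (prod_encode (?n, ?t), the (y' i))" using elim by blast
        have "?Q i (the (w i)) g" using \<gamma>(3)[OF g] by blast
        from this[unfolded e prod_encode_inverse fst_conv snd_conv]
        show "g \<in> carrier (G ?n)" "the (y' i) = Psis ?n (act ?n g ?t)"
          using t by (auto simp: tPsis_def tact_def)
      qed
      \<comment> \<open>The group element commutes with the polynomial, so the image of the
        generator determines the image of \<open>f\<close>.\<close>
      have "poly_eval K (the (q i)) (Psis ?n (act ?n g ?t) # map Psi (list_decode (the (c i)))) = Psis ?n (act ?n g ?x)"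
        by (rule poly_eval_act) (use gy t elim in auto)
      then show ?case
        using elim gy g by (simp add: the_pPsis the_pact)
    qed
    then show ?thesis
      using psing_tc_eq_iff[OF z'(1) fK'] z'(2) by simp
  qed
  with \<gamma>l show thesis using that by blast
qed

end

section \<open>The automorphism of K induced by a hyper-automorphism\<close>

section \<open>Restriction to the standard part\<close>

context cohesive_galois
begin

abbreviation pt :: "nat \<Rightarrow> (nat \<rightharpoonup> nat) set" where "pt x \<equiv> tc (psing (cst x))"

lemma sing_cconst: "x \<in> carrier K \<Longrightarrow> sing (cconst C (carrier K) x) = pt x"
  unfolding cconst_def by (rule sing_kc[OF cst_cfuns])

lemma pt_H [simp]: "x \<in> carrier K \<Longrightarrow> pt x \<in> H"
  by (intro tc_H psing_cfuns cst_cfuns)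

lemma pt_eq_iff: "x \<in> carrier K \<Longrightarrow> y \<in> carrier K \<Longrightarrow> pt x = pt y \<longleftrightarrow> x = y"
  using psing_tc_eq_iff[OF cst_cfuns cst_cfuns, of x y] ae_C by (simp add: eventually_const_iff)

text \<open>The levels are nested only through their images in K, so an element of a lower level is
  found again in the presentation of the higher one by search.\<close>

lemma change_level:
  assumes \<nu>: "\<nu> \<in> fN" and \<mu>: "\<mu> \<in> fN" and le: "\<forall>\<^sub>F i in ae C. the (\<nu> i) \<le> the (\<mu> i)"
    and f: "f \<in> cfuns C (lev \<nu>)"
  obtains f' where "f' \<in> cfuns C (lev \<mu>)" "tc (psing (pPsis \<nu> f)) = tc (psing (pPsis \<mu> f'))"
    "\<forall>\<^sub>F i in ae C. Psis (the (\<mu> i)) (the (f' i)) = Psis (the (\<nu> i)) (the (f i))"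
proof -
  define w where "w = ppair \<mu> (ppair \<nu> f)"
  have w: "partrec w" "\<forall>\<^sub>F i in ae C. w i \<noteq> None"
    using cfunsD[OF \<nu>] cfunsD[OF \<mu>] cfunsD[OF f]
    by (auto simp: w_def intro!: partrec_ppair eventually_conj eventually_elim2)
  let ?P = "\<lambda>i w m. m \<in> carrier (Ks (pfst w)) \<and> tPsis (pfst w) m = tPsis (pfst (psnd w)) (psnd (psnd w))"
  have wdef: "\<forall>\<^sub>F i in ae C. the (w i) = prod_encode (the (\<mu> i), prod_encode (the (\<nu> i), the (f i)))"
    using cfunsD(2)[OF \<nu>] cfunsD(2)[OF \<mu>] cfunsD(2)[OF f]
    by eventually_elim (simp add: w_def the_ppair)
  have "tdec (\<lambda>z. ?P (pfst (pfst z)) (psnd (pfst z)) (psnd z))" by (intro rec_intros)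
  moreover have "\<forall>\<^sub>F i in ae C. \<exists>m. ?P i (the (w i)) m"
    using wdef le lev_ae[OF f]
  proof eventually_elim
    case (elim i)
    then have x: "the (f i) \<in> carrier (Ks (the (\<nu> i)))" by blast
    then obtain m where "m \<in> carrier (Ks (the (\<mu> i)))" "Psis (the (\<mu> i)) m = Psis (the (\<nu> i)) (the (f i))"
      using Psis_mono elim(2) by (metis image_iff subset_iff)
    then have "?P i (the (w i)) m" using elim(1) x by (simp add: tPsis_def)
    then show ?case by blast
  qed
  ultimately obtain f' where f': "partrec f'" "\<forall>\<^sub>F i in ae C. f' i \<noteq> None"
    "\<And>i m. f' i = Some m \<Longrightarrow> w i \<noteq> None \<and> ?P i (the (w i)) m"
    using partrec_selection[where P = ?P, OF w] by blast
  have l: "f' \<in> cfuns C (lev \<mu>)"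
  proof (rule levI[OF f'(1,2)])
    fix i m assume "f' i = Some m"
    from f'(3)[OF this] show "\<mu> i \<noteq> None \<and> m \<in> carrier (Ks (the (\<mu> i)))"
      by (auto simp: w_def the_ppair)
  qed
  have ev: "\<forall>\<^sub>F i in ae C. Psis (the (\<mu> i)) (the (f' i)) = Psis (the (\<nu> i)) (the (f i))"
    using f'(2) wdef lev_ae[OF f]
  proof eventually_elim
    case (elim i)
    then obtain m where m: "f' i = Some m" by auto
    have "?P i (the (w i)) m" using f'(3)[OF m] by blast
    then show ?case using elim m by (auto simp: tPsis_def)
  qed
  have "tc (psing (pPsis \<nu> f)) = tc (psing (pPsis \<mu> f'))"
    unfolding psing_tc_eq_iff[OF pPsis_fK[OF cfunsD(1)[OF \<nu>] f] pPsis_fK[OF cfunsD(1)[OF \<mu>] l]]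
    using ev cfunsD(2)[OF \<nu>] cfunsD(2)[OF \<mu>] cfunsD(2)[OF f] f'(2)
    by eventually_elim (simp add: the_pPsis)
  then show thesis using that l ev by blast
qed

text \<open>At each index a level and a preimage in it are searched for, which succeeds because K is
  the union of the levels. The level found may vary with the index, so \<open>\<nu>\<close> need not
  be standard.\<close>

lemma exists_level:
  assumes y: "y \<in> fK"
  obtains \<nu> f where "\<nu> \<in> fN" "f \<in> cfuns C (lev \<nu>)" "tc (psing y) = tc (psing (pPsis \<nu> f))"
proof -
  let ?P = "\<lambda>i y m. psnd m \<in> carrier (Ks (pfst m)) \<and> tPsis (pfst m) (psnd m) = y"
  have "tdec (\<lambda>z. ?P (pfst (pfst z)) (psnd (pfst z)) (psnd z))" by (intro rec_intros)
  moreover have "\<forall>\<^sub>F i in ae C. \<exists>m. ?P i (the (y i)) m"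
    using cfunsD(2)[OF y]
  proof eventually_elim
    case (elim i)
    then have "the (y i) \<in> carrier K" using cfuns_constD[OF y] by fastforce
    then obtain n x where "x \<in> carrier (Ks n)" "the (y i) = Psis n x" by (auto simp: K_Union)
    then have "?P i (the (y i)) (prod_encode (n, x))" by (simp add: tPsis_def)
    then show ?case by blast
  qed
  ultimately obtain s where s: "partrec s" "\<forall>\<^sub>F i in ae C. s i \<noteq> None"
    "\<And>i m. s i = Some m \<Longrightarrow> y i \<noteq> None \<and> ?P i (the (y i)) m"
    using partrec_selection[where P = ?P, OF cfunsD[OF y]] by blast
  define \<nu> where "\<nu> i = map_option pfst (s i)" for i
  define f where "f i = map_option psnd (s i)" for i
  have \<nu>: "\<nu> \<in> fN"
    unfolding \<nu>_def[abs_def]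
    by (rule cfuns_constI; (intro partrec_map s(1) rec_intros)?)
      (use s(2) in \<open>auto elim: eventually_mono\<close>)
  have f: "f \<in> cfuns C (lev \<nu>)"
  proof (rule levI)
    show "partrec f" unfolding f_def[abs_def] by (intro partrec_map s(1) rec_intros)
    show "\<forall>\<^sub>F i in ae C. f i \<noteq> None" using s(2) by eventually_elim (simp add: f_def)
    show "\<nu> i \<noteq> None \<and> x \<in> carrier (Ks (the (\<nu> i)))" if "f i = Some x" for i x
      using that s(3) by (auto simp: f_def \<nu>_def)
  qed
  have "tc (psing y) = tc (psing (pPsis \<nu> f))"
    unfolding psing_tc_eq_iff[OF y pPsis_fK[OF cfunsD(1)[OF \<nu>] f]]
    using s(2)
  proof eventually_elim
    case (elim i)
    then obtain m where m: "s i = Some m" by auto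
    show ?case using s(3)[OF m] m by (auto simp: pPsis_def \<nu>_def f_def tPsis_def)
  qed
  then show thesis using that \<nu> f by blast
qed

text \<open>At a constant level the group element takes its values in a single finite group, so
  \<open>cohesive_constant\<close> applies.\<close>

lemma hauto_constant_level:
  assumes \<sigma>: "hauto \<sigma>"
  obtains g where "g \<in> carrier (G n)"
    "\<And>f. f \<in> cfuns C (lev (cst n)) \<Longrightarrow> \<sigma> (tc (psing (pPsis (cst n) f))) = tc (psing (pPsis (cst n) (pact (cst n) (cst g) f)))"
proof -
  have n: "cst n \<in> fN" by (rule cst_cfuns) simp
  obtain \<gamma> where \<gamma>: "\<gamma> \<in> cfuns C (glev (cst n))"
    "\<And>f. f \<in> cfuns C (lev (cst n)) \<Longrightarrow> \<sigma> (tc (psing (pPsis (cst n) f))) = tc (psing (pPsis (cst n) (pact (cst n) \<gamma> f)))"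
    using hauto_level[OF \<sigma> n] by blast
  have "\<forall>\<^sub>F i in ae C. the (\<gamma> i) \<in> carrier (G n)"
    using glev_ae[OF \<gamma>(1)] by eventually_elim simp
  then obtain g where g: "g \<in> carrier (G n)" "\<forall>\<^sub>F i in ae C. the (\<gamma> i) = g"
    using cohesive_constant[OF C cfunsD[OF \<gamma>(1)] finite_G] by blast
  have cg: "cst g \<in> cfuns C (glev (cst n))"
    by (rule glevI) (auto intro: partrec_Some rec_intros g)
  have "tc (psing (pPsis (cst n) (pact (cst n) \<gamma> f))) = tc (psing (pPsis (cst n) (pact (cst n) (cst g) f)))"
    if f: "f \<in> cfuns C (lev (cst n))" for f
    unfolding psing_tc_eq_iff[OF pPsis_fK[OF cfunsD(1)[OF n] pact_lev[OF cfunsD(1)[OF n] \<gamma>(1) f]]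
        pPsis_fK[OF cfunsD(1)[OF n] pact_lev[OF cfunsD(1)[OF n] cg f]]]
    using g(2) cfunsD(2)[OF \<gamma>(1)]
    by eventually_elim (auto simp: pPsis_def pact_def)
  then show thesis using that g(1) \<gamma>(2) by simp
qed

text \<open>The restriction of \<open>\<sigma>\<close> to K. The description denotes because
  constants are sent to constants, as \<open>rmap_pt\<close> shows; the elements of
  \<open>gal\<close> are extensional, whence the restricted abstraction.\<close>

definition rmap :: "((nat \<rightharpoonup> nat) set \<Rightarrow> (nat \<rightharpoonup> nat) set) \<Rightarrow> nat \<Rightarrow> nat" where
  "rmap \<sigma> = (\<lambda>x\<in>carrier K. THE y. y \<in> carrier K \<and> \<sigma> (pt x) = pt y)"

lemma rmapI: "x \<in> carrier K \<Longrightarrow> y \<in> carrier K \<Longrightarrow> \<sigma> (pt x) = pt y \<Longrightarrow> rmap \<sigma> x = y"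
  unfolding rmap_def by (auto simp: pt_eq_iff intro!: the_equality)

definition level_elem :: "((nat \<rightharpoonup> nat) set \<Rightarrow> (nat \<rightharpoonup> nat) set) \<Rightarrow> nat \<Rightarrow> nat" where
  "level_elem \<sigma> n = (SOME g. g \<in> carrier (G n) \<and> (\<forall>f\<in>cfuns C (lev (cst n)).
     \<sigma> (tc (psing (pPsis (cst n) f))) = tc (psing (pPsis (cst n) (pact (cst n) (cst g) f)))))"

text \<open>The last clause concerns all elements of the power of \<open>Ks n\<close>, not only
  constants. It is what lets the restriction to K control \<open>\<sigma>\<close> on every standard
  level.\<close>

lemma level_elem:
  assumes \<sigma>: "hauto \<sigma>"
  shows "level_elem \<sigma> n \<in> carrier (G n)"
    and "x \<in> carrier (Ks n) \<Longrightarrow> rmap \<sigma> (Psis n x) = Psis n (act n (level_elem \<sigma> n) x)"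
    and "x \<in> carrier (Ks n) \<Longrightarrow> \<sigma> (pt (Psis n x)) = pt (Psis n (act n (level_elem \<sigma> n) x))"
    and "f \<in> cfuns C (lev (cst n)) \<Longrightarrow> \<sigma> (tc (psing (pPsis (cst n) f)))
      = tc (psing (pPsis (cst n) (pact (cst n) (cst (level_elem \<sigma> n)) f)))"
proof -
  define g where "g = level_elem \<sigma> n"
  have "g \<in> carrier (G n) \<and> (\<forall>f\<in>cfuns C (lev (cst n)).
     \<sigma> (tc (psing (pPsis (cst n) f))) = tc (psing (pPsis (cst n) (pact (cst n) (cst g) f))))"
    unfolding g_def level_elem_def
    by (rule someI_ex, rule hauto_constant_level[OF \<sigma>, of n]) blast
  then have g: "g \<in> carrier (G n)"
    "\<And>f. f \<in> cfuns C (lev (cst n)) \<Longrightarrow> \<sigma> (tc (psing (pPsis (cst n) f))) = tc (psing (pPsis (cst n) (pact (cst n) (cst g) f)))"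
    by blast+
  have p: "\<sigma> (pt (Psis n x)) = pt (Psis n (act n g x))" if x: "x \<in> carrier (Ks n)" for x
  proof -
    have "cst x \<in> cfuns C (lev (cst n))"
      by (rule levI) (auto intro: partrec_Some rec_intros x)
    from g(2)[OF this] show ?thesis by (simp add: pPsis_def[abs_def] pact_def[abs_def])
  qed
  show "level_elem \<sigma> n \<in> carrier (G n)" using g(1) by (simp add: g_def)
  show "rmap \<sigma> (Psis n x) = Psis n (act n (level_elem \<sigma> n) x)" if x: "x \<in> carrier (Ks n)"
    by (rule rmapI) (use p[OF x] x g(1) in \<open>auto simp: g_def\<close>)
  show "\<sigma> (pt (Psis n x)) = pt (Psis n (act n (level_elem \<sigma> n) x))" if "x \<in> carrier (Ks n)"
    using p[OF that] by (simp add: g_def)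
  show "\<sigma> (tc (psing (pPsis (cst n) f)))
      = tc (psing (pPsis (cst n) (pact (cst n) (cst (level_elem \<sigma> n)) f)))" if "f \<in> cfuns C (lev (cst n))"
    using g(2)[OF that] by (simp add: g_def)
qed

lemma rmap_pt:
  assumes "hauto \<sigma>" "x \<in> carrier K"
  shows "rmap \<sigma> x \<in> carrier K" "\<sigma> (pt x) = pt (rmap \<sigma> x)"
proof -
  obtain n z where z: "z \<in> carrier (Ks n)" "x = Psis n z" using assms(2) by (auto simp: K_Union)
  define g where "g = level_elem \<sigma> n"
  note g = level_elem[OF assms(1), where n = n, folded g_def]
  show "rmap \<sigma> x \<in> carrier K" "\<sigma> (pt x) = pt (rmap \<sigma> x)"
    using g(1) g(2,3)[OF z(1)] z by auto
qed

lemma common_level: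
  assumes "x \<in> carrier K" "y \<in> carrier K"
  obtains n a b where "a \<in> carrier (Ks n)" "b \<in> carrier (Ks n)" "x = Psis n a" "y = Psis n b"
proof -
  obtain m l where "x \<in> Psis m ` carrier (Ks m)" "y \<in> Psis l ` carrier (Ks l)"
    using assms by (auto simp: K_Union)
  then have "x \<in> Psis (max m l) ` carrier (Ks (max m l))" "y \<in> Psis (max m l) ` carrier (Ks (max m l))"
    using Psis_mono[of m "max m l"] Psis_mono[of l "max m l"] by (meson max.cobounded1 max.cobounded2 subsetD)+
  then show thesis using that by (elim imageE)
qed

text \<open>On each level \<open>rmap \<sigma>\<close> is the action of a group element. Any two
  elements of K lie in a common level, so the ring laws and surjectivity reduce to that
  action.\<close>

lemma rmap_gal:
  assumes \<sigma>: "hauto \<sigma>"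
  shows "rmap \<sigma> \<in> carrier (gal K k)"
proof -
  have "rmap \<sigma> \<in> ring_hom K K"
  proof (rule ring_hom_memI)
    fix x y assume xy: "x \<in> carrier K" "y \<in> carrier K"
    obtain n a b where ab: "a \<in> carrier (Ks n)" "b \<in> carrier (Ks n)" "x = Psis n a" "y = Psis n b"
      using common_level[OF xy] .
    interpret L: field "Ks n" by (rule Ks_field)
    interpret h: ring_hom_cring "Ks n" K "Psis n" by (rule Psis_cring_hom)
    define g where "g = level_elem \<sigma> n"
    note g = level_elem[OF \<sigma>, where n = n, folded g_def]
    have "rmap \<sigma> (Psis n (a \<otimes>\<^bsub>Ks n\<^esub> b)) = Psis n (act n g a \<otimes>\<^bsub>Ks n\<^esub> act n g b)"
      using g(2)[of "a \<otimes>\<^bsub>Ks n\<^esub> b"] ring_hom_mult[OF act_hom[OF g(1)] ab(1,2)] ab by simp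
    then show "rmap \<sigma> (x \<otimes>\<^bsub>K\<^esub> y) = rmap \<sigma> x \<otimes>\<^bsub>K\<^esub> rmap \<sigma> y"
      using ab g by simp
    have "rmap \<sigma> (Psis n (a \<oplus>\<^bsub>Ks n\<^esub> b)) = Psis n (act n g a \<oplus>\<^bsub>Ks n\<^esub> act n g b)"
      using g(2)[of "a \<oplus>\<^bsub>Ks n\<^esub> b"] ring_hom_add[OF act_hom[OF g(1)] ab(1,2)] ab by simp
    then show "rmap \<sigma> (x \<oplus>\<^bsub>K\<^esub> y) = rmap \<sigma> x \<oplus>\<^bsub>K\<^esub> rmap \<sigma> y"
      using ab g by simp
  next
    interpret L: field "Ks 0" by (rule Ks_field)
    interpret h: ring_hom_cring "Ks 0" K "Psis 0" by (rule Psis_cring_hom)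
    define g where "g = level_elem \<sigma> 0"
    note g = level_elem[OF \<sigma>, where n = 0, folded g_def]
    show "rmap \<sigma> \<one>\<^bsub>K\<^esub> = \<one>\<^bsub>K\<^esub>"
      using g(2)[of "\<one>\<^bsub>Ks 0\<^esub>"] ring_hom_one[OF act_hom[OF g(1)]] by simp
  qed (rule rmap_pt[OF \<sigma>])
  moreover have "rmap \<sigma> \<in> Bij (carrier K)"
  proof -
    have "inj_on (rmap \<sigma>) (carrier K)"
    proof (rule inj_onI)
      fix x y assume xy: "x \<in> carrier K" "y \<in> carrier K" "rmap \<sigma> x = rmap \<sigma> y"
      then have "\<sigma> (pt x) = \<sigma> (pt y)" using rmap_pt[OF \<sigma>] by metis
      moreover have "inj_on \<sigma> H" using \<sigma> by (simp add: hauto_def Bij_def bij_betw_def)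
      ultimately have "pt x = pt y" using pt_H xy by (auto dest: inj_onD)
      then show "x = y" using pt_eq_iff xy by blast
    qed
    moreover have "y \<in> rmap \<sigma> ` carrier K" if y: "y \<in> carrier K" for y
    proof -
      obtain n b where b: "b \<in> carrier (Ks n)" "y = Psis n b" using y by (auto simp: K_Union)
      define g where "g = level_elem \<sigma> n"
      note g = level_elem[OF \<sigma>, where n = n, folded g_def]
      obtain a where a: "a \<in> carrier (Ks n)" "b = act n g a"
        using act_bij[OF g(1)] b(1) by (auto simp: bij_betw_def)
      have "y = rmap \<sigma> (Psis n a)" unfolding g(2)[OF a(1)] a(2)[symmetric] by (rule b(2))
      then show ?thesis using imageI[OF Psis_closed[OF a(1)], of "rmap \<sigma>"] by simp
    qed
    moreover have "rmap \<sigma> \<in> extensional (carrier K)" by (simp add: rmap_def)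
    ultimately show ?thesis using rmap_pt(1)[OF \<sigma>] by (auto simp: Bij_def bij_betw_def)
  qed
  moreover have "rmap \<sigma> (Psi a) = Psi a" if "a \<in> carrier F" for a
    using hauto_k[OF \<sigma> that] that by (intro rmapI) auto
  ultimately show ?thesis by (auto simp: gal_def)
qed

lemma galK_group: "group (gal K k)"
  by (rule gal_group[OF k_in_K K.ring_axioms])

lemma rmap_hom: "group_hom HA (gal K k) rmap"
proof -
  have "rmap (\<sigma> \<otimes>\<^bsub>HA\<^esub> \<tau>) = rmap \<sigma> \<otimes>\<^bsub>gal K k\<^esub> rmap \<tau>"
    if st: "\<sigma> \<in> carrier HA" "\<tau> \<in> carrier HA" for \<sigma> \<tau>
  proof -
    have h: "hauto \<sigma>" "hauto \<tau>" using st by (simp_all add: HA_carrier)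
    have "rmap (\<sigma> \<otimes>\<^bsub>HA\<^esub> \<tau>) x = compose (carrier K) (rmap \<sigma>) (rmap \<tau>) x" for x
    proof (cases "x \<in> carrier K")
      case True
      have "(\<sigma> \<otimes>\<^bsub>HA\<^esub> \<tau>) (pt x) = pt (rmap \<sigma> (rmap \<tau> x))"
        using True rmap_pt[OF h(1)] rmap_pt[OF h(2)] by (simp add: HA_mult[OF st] compose_def)
      then show ?thesis
        using True rmap_pt(1)[OF h(1)] rmap_pt(1)[OF h(2)] by (auto simp: compose_def intro!: rmapI)
    qed (simp add: rmap_def compose_def)
    then show ?thesis
      using gal_mult[OF rmap_gal[OF h(1)] rmap_gal[OF h(2)]] by (simp add: fun_eq_iff)
  qed
  then show ?thesis
    using rmap_gal by (auto intro!: group_hom.intro group_hom_axioms.intro homI HA_group galK_group simp: HA_carrier)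
qed

text \<open>By faithfulness the restriction to K determines the group element at the standard level
  n, and this element determines the action on the whole power of \<open>Ks n\<close>; elements of
  lower levels are moved up to n.\<close>

lemma hauto_eq_on_level:
  assumes \<sigma>: "hauto \<sigma>" and \<tau>: "hauto \<tau>"
    and eq: "\<And>x. x \<in> carrier (Ks n) \<Longrightarrow> rmap \<sigma> (Psis n x) = rmap \<tau> (Psis n x)"
    and \<nu>: "\<nu> \<in> fN" "\<forall>\<^sub>F i in ae C. the (\<nu> i) \<le> n" and f: "f \<in> cfuns C (lev \<nu>)"
  shows "\<sigma> (tc (psing (pPsis \<nu> f))) = \<tau> (tc (psing (pPsis \<nu> f)))"
proof -
  have n: "cst n \<in> fN" by (rule cst_cfuns) simp
  have "\<forall>\<^sub>F i in ae C. the (\<nu> i) \<le> the (cst n i)" using \<nu>(2) by simp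
  from change_level[OF \<nu>(1) n this f] obtain f' where
    f': "f' \<in> cfuns C (lev (cst n))" "tc (psing (pPsis \<nu> f)) = tc (psing (pPsis (cst n) f'))"
      "\<forall>\<^sub>F i in ae C. Psis (the (cst n i)) (the (f' i)) = Psis (the (\<nu> i)) (the (f i))" .
  define g where "g = level_elem \<sigma> n"
  note g = level_elem[OF \<sigma>, where n = n, folded g_def]
  define h where "h = level_elem \<tau> n"
  note h = level_elem[OF \<tau>, where n = n, folded h_def]
  have "g = h"
  proof (rule act_faithful[OF g(1) h(1)])
    fix x assume x: "x \<in> carrier (Ks n)"
    then have "Psis n (act n g x) = Psis n (act n h x)" using eq g(2) h(2) by metis
    then show "act n g x = act n h x"
      using Psis_eqD act_closed[OF g(1) x] act_closed[OF h(1) x] by blast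
  qed
  then show ?thesis using g(4)[OF f'(1)] h(4)[OF f'(1)] f'(2) by simp
qed

text \<open>The element \<open>\<gamma>\<close> describing the action at \<open>\<nu>\<close> acts
  on lower levels through its restrictions. Being fixed by \<open>\<sigma>\<close> thus becomes a
  condition at almost every index on the presented groups and fields.\<close>

lemma hauto_sublevel:
  assumes \<sigma>: "hauto \<sigma>" and \<nu>: "\<nu> \<in> fN" and \<gamma>: "\<gamma> \<in> cfuns C (glev \<nu>)"
    "\<And>f. f \<in> cfuns C (lev \<nu>) \<Longrightarrow> \<sigma> (tc (psing (pPsis \<nu> f))) = tc (psing (pPsis \<nu> (pact \<nu> \<gamma> f)))"
    and \<mu>: "\<mu> \<in> fN" "\<forall>\<^sub>F i in ae C. the (\<mu> i) \<le> the (\<nu> i)" and f: "f \<in> cfuns C (lev \<mu>)"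
  shows "\<sigma> (tc (psing (pPsis \<mu> f))) = tc (psing (pPsis \<mu> f)) \<longleftrightarrow>
    (\<forall>\<^sub>F i in ae C. act (the (\<mu> i)) (resm (the (\<nu> i)) (the (\<mu> i)) (the (\<gamma> i))) (the (f i)) = the (f i))"
proof -
  obtain f' where f': "f' \<in> cfuns C (lev \<nu>)" "tc (psing (pPsis \<mu> f)) = tc (psing (pPsis \<nu> f'))"
    "\<forall>\<^sub>F i in ae C. Psis (the (\<nu> i)) (the (f' i)) = Psis (the (\<mu> i)) (the (f i))"
    using change_level[OF \<mu>(1) \<nu> \<mu>(2) f] .
  have "\<sigma> (tc (psing (pPsis \<mu> f))) = tc (psing (pPsis \<mu> f)) \<longleftrightarrow>
    tc (psing (pPsis \<nu> (pact \<nu> \<gamma> f'))) = tc (psing (pPsis \<nu> f'))"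
    using \<gamma>(2)[OF f'(1)] f'(2) by simp
  also have "\<dots> \<longleftrightarrow> (\<forall>\<^sub>F i in ae C. the (pPsis \<nu> (pact \<nu> \<gamma> f') i) = the (pPsis \<nu> f' i))"
    by (rule psing_tc_eq_iff[OF pPsis_fK[OF cfunsD(1)[OF \<nu>] pact_lev[OF cfunsD(1)[OF \<nu>] \<gamma>(1) f'(1)]]
        pPsis_fK[OF cfunsD(1)[OF \<nu>] f'(1)]])
  also have "\<dots> \<longleftrightarrow> (\<forall>\<^sub>F i in ae C. act (the (\<mu> i)) (resm (the (\<nu> i)) (the (\<mu> i)) (the (\<gamma> i))) (the (f i)) = the (f i))"
    using lev_ae[OF f] lev_ae[OF f'(1)] glev_ae[OF \<gamma>(1)] f'(3) \<mu>(2)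
  proof (intro eventually_subst, eventually_elim)
    case (elim i)
    let ?n = "the (\<nu> i)" and ?m = "the (\<mu> i)" and ?g = "the (\<gamma> i)" and ?x = "the (f i)" and ?y = "the (f' i)"
    have mem: "?x \<in> carrier (Ks ?m)" "?y \<in> carrier (Ks ?n)" "?g \<in> carrier (G ?n)" "?m \<le> ?n"
      "Psis ?n ?y = Psis ?m ?x" and some: "\<nu> i \<noteq> None" "\<gamma> i \<noteq> None" "f' i \<noteq> None"
      using elim by blast+
    have r: "resm ?n ?m ?g \<in> carrier (G ?m)" by (rule resm_closed[OF mem(4,3)])
    have "the (pPsis \<nu> (pact \<nu> \<gamma> f') i) = Psis ?n (act ?n ?g ?y)"
      using some by (auto simp: pPsis_def pact_def)
    also have "\<dots> = Psis ?m (act ?m (resm ?n ?m ?g) ?x)"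
      by (rule resm_act[OF mem(4,3,1,2,5)])
    finally have "the (pPsis \<nu> (pact \<nu> \<gamma> f') i) = Psis ?m (act ?m (resm ?n ?m ?g) ?x)" .
    moreover have "the (pPsis \<nu> f' i) = Psis ?m ?x" using some mem(5) by (auto simp: pPsis_def)
    ultimately show ?case
      using inj_on_eq_iff[OF Psis_inj act_closed[OF r mem(1)] mem(1)] by simp
  qed
  finally show ?thesis .
qed

end

section \<open>Least differing levels, infinitesimals and the kernel of restriction\<close>

section \<open>The hyper-metric\<close>

lemma inj_rat_encode: "inj rat_encode"
proof (rule injI)
  fix p q assume "rat_encode p = rat_encode q"
  then have "quotient_of p = quotient_of q"
    by (auto simp: rat_encode_def prod_encode_eq int_encode_eq split: prod.splits)
  then show "p = q" by (rule quotient_of_inject)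
qed

lemma restrict_neq_iff: "restrict f A \<noteq> restrict g A \<longleftrightarrow> (\<exists>a\<in>A. f a \<noteq> g a)"
  by (auto simp: restrict_def fun_eq_iff)

context cohesive_galois
begin

lemma differ_iff:
  assumes "N \<in> cpow C UNIV"
  shows "hyper_differ C K Ks Psis \<sigma> \<tau> N \<longleftrightarrow>
    (\<exists>\<nu>\<in>N. \<exists>f\<in>cfuns C (lev \<nu>). \<sigma> (tc (psing (pPsis \<nu> f))) \<noteq> \<tau> (tc (psing (pPsis \<nu> f))))"
proof -
  have N: "\<nu> \<in> fN" if "\<nu> \<in> N" for \<nu>
    using assms that by (auto simp: cprod_iff mem_cclass)
  have sub: "s \<in> hyper_subfield C K Ks Psis N \<longleftrightarrow> (\<exists>\<nu> f. s = kc (pPsis \<nu> f) \<and> \<nu> \<in> N \<and> f \<in> cfuns C (lev \<nu>))" for s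
    unfolding hyper_subfield_def pPsis_def[abs_def] mem_Collect_eq ..
  have sing: "sing (kc (pPsis \<nu> f)) = tc (psing (pPsis \<nu> f))" if "\<nu> \<in> N" "f \<in> cfuns C (lev \<nu>)" for \<nu> f
    by (rule sing_kc[OF pPsis_fK[OF cfunsD(1)[OF N[OF that(1)]] that(2)]])
  have "hyper_differ C K Ks Psis \<sigma> \<tau> N \<longleftrightarrow>
      (\<exists>s\<in>hyper_subfield C K Ks Psis N. \<sigma> (sing s) \<noteq> \<tau> (sing s))"
    unfolding hyper_differ_def restrict_neq_iff by (simp only: bex_simps)
  also have "\<dots> \<longleftrightarrow> (\<exists>\<nu>\<in>N. \<exists>f\<in>cfuns C (lev \<nu>). \<sigma> (sing (kc (pPsis \<nu> f))) \<noteq> \<tau> (sing (kc (pPsis \<nu> f))))"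
    unfolding Bex_def sub by blast
  also have "\<dots> \<longleftrightarrow> (\<exists>\<nu>\<in>N. \<exists>f\<in>cfuns C (lev \<nu>). \<sigma> (tc (psing (pPsis \<nu> f))) \<noteq> \<tau> (tc (psing (pPsis \<nu> f))))"
    by (intro bex_cong refl) (simp only: sing)
  finally show ?thesis .
qed

text \<open>\<open>hyper_subfield\<close> admits every representative of M, so M is presented as the
  class of the one that occurs in the witness.\<close>

lemma differ_witness:
  assumes "M \<in> cpow C UNIV" "hyper_differ C K Ks Psis \<sigma> \<tau> M"
  obtains \<nu> f where "\<nu> \<in> fN" "M = nc \<nu>" "f \<in> cfuns C (lev \<nu>)"
    "\<sigma> (tc (psing (pPsis \<nu> f))) \<noteq> \<tau> (tc (psing (pPsis \<nu> f)))"
proof -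
  obtain \<nu> f where w: "\<nu> \<in> M" "f \<in> cfuns C (lev \<nu>)"
    "\<sigma> (tc (psing (pPsis \<nu> f))) \<noteq> \<tau> (tc (psing (pPsis \<nu> f)))"
    using assms(2) unfolding differ_iff[OF assms(1)] by (elim bexE)
  obtain \<mu> where \<mu>: "\<mu> \<in> fN" "M = nc \<mu>" using assms(1) unfolding cprod_iff by (elim bexE)
  have "\<nu> \<in> fN" "M = nc \<nu>"
    using w(1) cclass_rep[of \<nu> C "const_seq UNIV" \<mu>] by (simp_all add: \<mu>(2) mem_cclass)
  then show thesis using that[OF _ _ w(2,3)] by simp
qed

lemma differI:
  assumes "\<nu> \<in> fN" "f \<in> cfuns C (lev \<nu>)" "\<sigma> (tc (psing (pPsis \<nu> f))) \<noteq> \<tau> (tc (psing (pPsis \<nu> f)))"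
  shows "hyper_differ C K Ks Psis \<sigma> \<tau> (nc \<nu>)"
  unfolding differ_iff[OF cclass_in_cprod[OF assms(1)]]
  using assms(2,3) cclass_self[OF assms(1)] by blast

lemma hyper_le_iff: "f \<in> fN \<Longrightarrow> g \<in> fN \<Longrightarrow> hyper_le C (nc f) (nc g) \<longleftrightarrow> (\<forall>\<^sub>F i in ae C. the (f i) \<le> the (g i))"
  unfolding hyper_le_def by (rule clift_rel_cclass)

text \<open>Comparing two values is decidable, so by dichotomy one of the two orders holds at almost
  every index.\<close>

lemma hyper_le_cases:
  assumes "f \<in> fN" "g \<in> fN"
  shows "hyper_le C (nc f) (nc g) \<or> (\<forall>\<^sub>F i in ae C. the (g i) < the (f i))"
proof -
  have p: "partrec (ppair f g)" "\<forall>\<^sub>F i in ae C. ppair f g i \<noteq> None"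
    using cfunsD[OF assms(1)] cfunsD[OF assms(2)]
    by (auto intro!: partrec_ppair eventually_conj eventually_elim2)
  have e: "\<forall>\<^sub>F i in ae C. the (ppair f g i) = prod_encode (the (f i), the (g i))"
    using cfunsD(2)[OF assms(1)] cfunsD(2)[OF assms(2)] by eventually_elim (simp add: the_ppair)
  have "tdec (\<lambda>z. pfst (psnd z) \<le> psnd (psnd z))" by (intro rec_intros)
  from cohesive_dichotomy[OF C p this] show ?thesis
  proof
    assume "\<forall>\<^sub>F i in ae C. pfst (the (ppair f g i)) \<le> psnd (the (ppair f g i))"
    with e have "\<forall>\<^sub>F i in ae C. the (f i) \<le> the (g i)" by eventually_elim simp
    then show ?thesis using hyper_le_iff[OF assms] by simp
  next
    assume "\<forall>\<^sub>F i in ae C. \<not> pfst (the (ppair f g i)) \<le> psnd (the (ppair f g i))"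
    with e have "\<forall>\<^sub>F i in ae C. the (g i) < the (f i)" by eventually_elim simp
    then show ?thesis by simp
  qed
qed

text \<open>The condition in the definite description of \<open>hyper_dist\<close>.\<close>

definition least_differ :: "((nat \<rightharpoonup> nat) set \<Rightarrow> (nat \<rightharpoonup> nat) set) \<Rightarrow> ((nat \<rightharpoonup> nat) set \<Rightarrow> (nat \<rightharpoonup> nat) set) \<Rightarrow>
    (nat \<rightharpoonup> nat) set \<Rightarrow> bool" where
  "least_differ \<sigma> \<tau> N \<longleftrightarrow> N \<in> cpow C UNIV \<and> hyper_differ C K Ks Psis \<sigma> \<tau> N \<and>
     (\<forall>M\<in>cpow C UNIV. hyper_differ C K Ks Psis \<sigma> \<tau> M \<longrightarrow> hyper_le C N M)"

lemma least_differ_unique: "least_differ \<sigma> \<tau> N \<Longrightarrow> least_differ \<sigma> \<tau> M \<Longrightarrow> N = M"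
proof -
  assume N: "least_differ \<sigma> \<tau> N" and M: "least_differ \<sigma> \<tau> M"
  then obtain f g where fg: "f \<in> fN" "N = nc f" "g \<in> fN" "M = nc g"
    by (auto simp: least_differ_def cprod_iff)
  have "hyper_le C N M" "hyper_le C M N" using N M by (auto simp: least_differ_def)
  then have "\<forall>\<^sub>F i in ae C. the (f i) = the (g i)"
    using fg by (auto simp: hyper_le_iff elim: eventually_elim2)
  then show "N = M" using cclass_cong_ae[OF fg(1,3)] fg by simp
qed

lemma hyper_dist_eq:
  assumes "least_differ \<sigma> \<tau> N" "\<sigma> \<noteq> \<tau>"
  shows "hyper_dist C K Ks Psis \<sigma> \<tau> = hyper_half_pow C N"
proof -
  have "(THE N. least_differ \<sigma> \<tau> N) = N"
    using least_differ_unique assms(1) by (intro the_equality) blast+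
  then show ?thesis using assms(2) by (simp add: hyper_dist_def least_differ_def)
qed

text \<open>A differing level not above n would have a representative below n, hence at most n - 1,
  almost everywhere; there equal restrictions to K force equal actions by
  \<open>hauto_eq_on_level\<close>.\<close>

lemma least_differ_standard:
  assumes \<sigma>: "hauto \<sigma>" and \<tau>: "hauto \<tau>"
    and x: "x \<in> carrier (Ks n)" "rmap \<sigma> (Psis n x) \<noteq> rmap \<tau> (Psis n x)"
    and min: "\<And>m x. m < n \<Longrightarrow> x \<in> carrier (Ks m) \<Longrightarrow> rmap \<sigma> (Psis m x) = rmap \<tau> (Psis m x)"
  shows "least_differ \<sigma> \<tau> (nc (cst n))"
  unfolding least_differ_def
proof (intro conjI ballI impI)
  have n: "cst n \<in> fN" by (rule cst_cfuns) simp
  show "nc (cst n) \<in> cpow C UNIV" by (rule cclass_in_cprod[OF n])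
  have xl: "cst x \<in> cfuns C (lev (cst n))"
    by (rule levI) (auto intro: partrec_Some rec_intros x)
  have "tc (psing (pPsis (cst n) (cst x))) = pt (Psis n x)"
    by (simp add: pPsis_def[abs_def])
  moreover have "\<sigma> (pt (Psis n x)) \<noteq> \<tau> (pt (Psis n x))"
    using x rmap_pt[OF \<sigma> Psis_closed[OF x(1)]] rmap_pt[OF \<tau> Psis_closed[OF x(1)]] by (simp add: pt_eq_iff)
  ultimately show "hyper_differ C K Ks Psis \<sigma> \<tau> (nc (cst n))"
    by (intro differI[OF n xl]) simp
  fix M assume M: "M \<in> cpow C UNIV" "hyper_differ C K Ks Psis \<sigma> \<tau> M"
  obtain \<nu> f where w: "\<nu> \<in> fN" "M = nc \<nu>" "f \<in> cfuns C (lev \<nu>)"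
    "\<sigma> (tc (psing (pPsis \<nu> f))) \<noteq> \<tau> (tc (psing (pPsis \<nu> f)))"
    using differ_witness[OF M] .
  show "hyper_le C (nc (cst n)) M"
  proof (rule ccontr)
    assume "\<not> hyper_le C (nc (cst n)) M"
    then have lt: "\<forall>\<^sub>F i in ae C. the (\<nu> i) < n"
      using hyper_le_cases[OF n w(1)] w(2) by simp
    show False
    proof (cases n)
      case 0
      then show False using lt ae_C by simp
    next
      case (Suc m)
      have le: "\<forall>\<^sub>F i in ae C. the (\<nu> i) \<le> m" using lt Suc by (auto elim: eventually_mono)
      have "\<sigma> (tc (psing (pPsis \<nu> f))) = \<tau> (tc (psing (pPsis \<nu> f)))"
        by (rule hauto_eq_on_level[OF \<sigma> \<tau> min w(1) le w(3)]) (simp_all add: Suc)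
      then show False using w(4) by blast
    qed
  qed
qed

text \<open>Hyper-automorphisms act on tuples, whereas levels and metric only concern arity 1. At
  almost every index the moved tuple is cut into u, x, v at an entry x that differs from the entry
  of the image. If x were fixed, the image would carry x at the same place, since the arity of u is
  preserved.\<close>

lemma moved_singleton:
  assumes \<sigma>: "hauto \<sigma>" and a: "a \<in> H" "\<sigma> a \<noteq> a"
  obtains y where "y \<in> fK" "\<sigma> (tc (psing y)) \<noteq> tc (psing y)"
proof -
  obtain \<alpha> where \<alpha>: "\<alpha> \<in> fT" "a = tc \<alpha>" using H_cases[OF a(1)] .
  obtain \<beta> where \<beta>: "\<beta> \<in> fT" "\<sigma> a = tc \<beta>" using H_cases[OF hauto_H[OF \<sigma> a(1)]] .
  define w where "w = ppair \<alpha> \<beta>"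
  have w: "partrec w" "\<forall>\<^sub>F i in ae C. w i \<noteq> None"
    using cfunsD[OF \<alpha>(1)] cfunsD[OF \<beta>(1)]
    by (auto simp: w_def intro!: partrec_ppair eventually_conj eventually_elim2)
  have wdef: "\<forall>\<^sub>F i in ae C. the (w i) = prod_encode (the (\<alpha> i), the (\<beta> i)) \<and> \<alpha> i \<noteq> None \<and> \<beta> i \<noteq> None"
    using cfunsD(2)[OF \<alpha>(1)] cfunsD(2)[OF \<beta>(1)] by eventually_elim (simp add: w_def the_ppair)
  \<comment> \<open>Distinct classes only fail to agree almost everywhere; dichotomy makes the
    tuples differ at almost every index.\<close>
  have "tdec (\<lambda>z. pfst (psnd z) = psnd (psnd z))" by (intro rec_intros)
  from cohesive_dichotomy[OF C w this]
  have ne: "\<forall>\<^sub>F i in ae C. the (\<alpha> i) \<noteq> the (\<beta> i)"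
  proof
    assume "\<forall>\<^sub>F i in ae C. pfst (the (w i)) = psnd (the (w i))"
    with wdef have "\<forall>\<^sub>F i in ae C. the (\<alpha> i) = the (\<beta> i)" by eventually_elim simp
    then have "tc \<alpha> = tc \<beta>" using tc_eq_iff[OF \<alpha>(1) \<beta>(1)] by simp
    then show ?thesis using a(2) \<alpha>(2) \<beta>(2) by simp
  next
    assume "\<forall>\<^sub>F i in ae C. pfst (the (w i)) \<noteq> psnd (the (w i))"
    with wdef show ?thesis by eventually_elim simp
  qed
  have ar: "\<forall>\<^sub>F i in ae C. tup_arity (the (\<beta> i)) = tup_arity (the (\<alpha> i))"
    using hauto_arity[OF \<sigma> a(1)] \<alpha>(2) \<beta>(2) arity_eq_iff[OF \<beta>(1) \<alpha>(1)] by simp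
  \<comment> \<open>A search result codes the three parts u, x, v; the position compared in the
    image is the length of u.\<close>
  let ?u = "\<lambda>m. pfst m" and ?x = "\<lambda>m. pfst (psnd m)" and ?v = "\<lambda>m. psnd (psnd m)"
  let ?P = "\<lambda>i w m. tup_append (?u m) (tup_append (list_encode [?x m]) (?v m)) = pfst w \<and>
     lnth (psnd w) (tup_arity (?u m)) \<noteq> ?x m"
  have "tdec (\<lambda>z. ?P (pfst (pfst z)) (psnd (pfst z)) (psnd z))" by (intro rec_intros)
  moreover have "\<forall>\<^sub>F i in ae C. \<exists>m. ?P i (the (w i)) m"
    using wdef ne ar
  proof eventually_elim
    case (elim i)
    let ?a = "list_decode (the (\<alpha> i))" and ?b = "list_decode (the (\<beta> i))"
    have len: "length ?b = length ?a" using elim by (simp add: tup_arity_def)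
    have "?a \<noteq> ?b" using elim by (metis list_decode_inverse)
    then obtain j where j: "j < length ?a" "?a ! j \<noteq> ?b ! j"
      using len by (metis nth_equalityI)
    have "?P i (the (w i)) (prod_encode (list_encode (take j ?a), prod_encode (?a ! j, list_encode (drop (Suc j) ?a))))"
      using elim j len id_take_nth_drop[OF j(1)]
      by (simp add: tup_append_def tup_arity_def lnth_def del: list_encode.simps)
    then show ?case by blast
  qed
  ultimately obtain s where s: "partrec s" "\<forall>\<^sub>F i in ae C. s i \<noteq> None"
    "\<And>i m. s i = Some m \<Longrightarrow> w i \<noteq> None \<and> ?P i (the (w i)) m"
    using partrec_selection[where P = ?P, OF w] by blast
  have dec: "\<alpha> i \<noteq> None \<and> the (\<alpha> i) = tup_append (?u m) (tup_append (list_encode [?x m]) (?v m)) \<and>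
    \<beta> i \<noteq> None \<and> lnth (the (\<beta> i)) (tup_arity (?u m)) \<noteq> ?x m" if "s i = Some m" for i m
    using s(3)[OF that] by (auto simp: w_def the_ppair simp del: list_encode.simps)
  have memK: "set (list_decode (?u m)) \<subseteq> carrier K \<and> ?x m \<in> carrier K \<and> set (list_decode (?v m)) \<subseteq> carrier K"
    if "s i = Some m" for i m
  proof -
    have "the (\<alpha> i) \<in> tuples (carrier K)"
      using dec[OF that] cfuns_constD[OF \<alpha>(1), of i] by auto
    then show ?thesis
      using dec[OF that] by (simp add: tuples_iff tup_append_def del: list_encode.simps)
  qed
  define U where "U i = map_option ?u (s i)" for i
  define Z where "Z i = map_option ?x (s i)" for i
  define V where "V i = map_option ?v (s i)" for i
  have U: "U \<in> fT"
    unfolding U_def[abs_def]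
    by (rule cfuns_constI; (intro partrec_map s(1) rec_intros)?)
      (use s(2) memK in \<open>auto elim: eventually_mono simp: tuples_iff\<close>)
  have V: "V \<in> fT"
    unfolding V_def[abs_def]
    by (rule cfuns_constI; (intro partrec_map s(1) rec_intros)?)
      (use s(2) memK in \<open>auto elim: eventually_mono simp: tuples_iff\<close>)
  have Z: "Z \<in> fK"
    unfolding Z_def[abs_def]
    by (rule cfuns_constI; (intro partrec_map s(1) rec_intros)?)
      (use s(2) memK in \<open>auto elim: eventually_mono\<close>)
  note PX = psing_cfuns[OF Z]
  have XV: "papp (psing Z) V \<in> fT" by (rule papp_cfuns[OF PX V])
  have UXV: "papp U (papp (psing Z) V) \<in> fT" by (rule papp_cfuns[OF U XV])
  have "\<forall>\<^sub>F i in ae C. the (\<alpha> i) = the (papp U (papp (psing Z) V) i)"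
    using s(2)
  proof eventually_elim
    case (elim i)
    then obtain m where m: "s i = Some m" by auto
    show ?case using dec[OF m] m by (simp add: papp_def psing_def U_def Z_def V_def del: list_encode.simps)
  qed
  then have aeq: "a = hyper_append C K (tc U) (hyper_append C K (tc (psing Z)) (tc V))"
    using tc_eq_iff[OF \<alpha>(1) UXV] \<alpha>(2) by (simp add: append_tc U V PX XV)
  obtain U' where U': "U' \<in> fT" "\<sigma> (tc U) = tc U'" using H_cases[OF hauto_H[OF \<sigma> tc_H[OF U]]] .
  obtain V' where V': "V' \<in> fT" "\<sigma> (tc V) = tc V'" using H_cases[OF hauto_H[OF \<sigma> tc_H[OF V]]] .
  have arU: "\<forall>\<^sub>F i in ae C. tup_arity (the (U' i)) = tup_arity (the (U i))"
    using hauto_arity[OF \<sigma> tc_H[OF U]] U'(2) arity_eq_iff[OF U'(1) U] by simp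
  have "\<sigma> (tc (psing Z)) \<noteq> tc (psing Z)"
  proof
    assume fix': "\<sigma> (tc (psing Z)) = tc (psing Z)"
    have XV': "papp (psing Z) V' \<in> fT" by (rule papp_cfuns[OF PX V'(1)])
    have UXV': "papp U' (papp (psing Z) V') \<in> fT" by (rule papp_cfuns[OF U'(1) XV'])
    have "\<sigma> a = hyper_append C K (tc U') (hyper_append C K (tc (psing Z)) (tc V'))"
      unfolding aeq using fix' U' V'
      by (simp add: hauto_append[OF \<sigma>] append_H U V PX)
    then have "tc \<beta> = tc (papp U' (papp (psing Z) V'))"
      using \<beta>(2) by (simp add: append_tc U'(1) V'(1) PX XV')
    then have "\<forall>\<^sub>F i in ae C. the (\<beta> i) = the (papp U' (papp (psing Z) V') i)"
      using tc_eq_iff[OF \<beta>(1) UXV'] by simp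
    then have "\<forall>\<^sub>F i in ae C. False"
      using arU s(2) cfunsD(2)[OF U'(1)] cfunsD(2)[OF V'(1)]
    proof eventually_elim
      case (elim i)
      then obtain m where m: "s i = Some m" by auto
      have "the (\<beta> i) = tup_append (the (U' i)) (tup_append (list_encode [?x m]) (the (V' i)))"
        using elim m by (auto simp: papp_def psing_def Z_def simp del: list_encode.simps)
      moreover have "tup_arity (the (U' i)) = tup_arity (?u m)"
        using elim m by (simp add: U_def)
      ultimately have "lnth (the (\<beta> i)) (tup_arity (?u m)) = ?x m"
        by (simp add: lnth_def tup_append_def tup_arity_def nth_append del: list_encode.simps)
      then show False using dec[OF m] by simp
    qed
    then show False using ae_C by simp
  qed
  then show thesis using that Z by blast
qed

lemma act_nontrivial:
  assumes "g \<in> carrier (G n)" "g \<otimes>\<^bsub>G n\<^esub> g \<noteq> g"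
  shows "\<exists>x\<in>carrier (Ks n). act n g x \<noteq> x"
proof (rule ccontr)
  assume "\<not> ?thesis"
  then have "g = \<one>\<^bsub>G n\<^esub>"
    using act_faithful[OF assms(1), of "\<one>\<^bsub>G n\<^esub>"] act_one group.is_monoid[OF G_group]
    by (metis monoid.one_closed)
  then show False using assms(2) group.is_monoid[OF G_group] by (simp add: monoid.l_one monoid.one_closed)
qed

lemma act_trivial:
  assumes "g \<in> carrier (G n)" "g \<otimes>\<^bsub>G n\<^esub> g = g" "x \<in> carrier (Ks n)"
  shows "act n g x = x"
proof -
  have "g = \<one>\<^bsub>G n\<^esub>" using group.idempotent_eq_one[OF G_group] assms(1,2) by blast
  then show ?thesis using act_one[OF assms(3)] by simp
qed

abbreviation "idH \<equiv> (\<lambda>a\<in>H. a)"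

lemma hauto_id: "hauto idH"
  using group.is_monoid[OF HA_group] monoid.one_closed[of HA] by (simp add: HA_carrier HA_one)

lemma rmap_id: "rmap idH = \<one>\<^bsub>gal K k\<^esub>"
  using group_hom.hom_one[OF rmap_hom] by (simp add: HA_one)

lemma pPsis_H: "\<nu> \<in> fN \<Longrightarrow> f \<in> cfuns C (lev \<nu>) \<Longrightarrow> tc (psing (pPsis \<nu> f)) \<in> H"
  by (intro tc_H psing_cfuns pPsis_fK cfunsD(1))

text \<open>
  If \<open>\<sigma>\<close> acts as \<open>\<gamma>\<close> on the product of the \<open>K\<^bsub>\<nu>(i)\<^esub>\<close> and moves an element of it, the least
  witness is the function sending i to the first level at which the restriction of
  \<open>\<gamma>(i)\<close> is not the identity.
\<close>

lemma least_differ_exists: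
  assumes \<sigma>: "hauto \<sigma>" and ne: "\<sigma> \<noteq> idH"
  obtains N where "least_differ idH \<sigma> N"
proof -
  have "\<exists>a\<in>H. \<sigma> a \<noteq> a"
  proof (rule ccontr)
    assume "\<not> ?thesis"
    then have "\<sigma> = idH"
      using \<sigma> by (intro extensionalityI[of _ H]) (auto simp: hauto_def Bij_def)
    then show False using ne by simp
  qed
  then obtain a where a: "a \<in> H" "\<sigma> a \<noteq> a" by (elim bexE)
  \<comment> \<open>One moved element of the power of K fixes a level \<open>\<nu>\<close>, which
    then bounds the search for the first nontrivial level.\<close>
  obtain y where y: "y \<in> fK" "\<sigma> (tc (psing y)) \<noteq> tc (psing y)" using moved_singleton[OF \<sigma> a] .
  obtain \<nu> f where \<nu>: "\<nu> \<in> fN" and f: "f \<in> cfuns C (lev \<nu>)" and yf: "tc (psing y) = tc (psing (pPsis \<nu> f))"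
    using exists_level[OF y(1)] .
  obtain \<gamma> where \<gamma>: "\<gamma> \<in> cfuns C (glev \<nu>)"
    "\<And>f. f \<in> cfuns C (lev \<nu>) \<Longrightarrow> \<sigma> (tc (psing (pPsis \<nu> f))) = tc (psing (pPsis \<nu> (pact \<nu> \<gamma> f)))"
    using hauto_level[OF \<sigma> \<nu>] by blast
  have sub: "\<sigma> (tc (psing (pPsis \<mu> f))) = tc (psing (pPsis \<mu> f)) \<longleftrightarrow>
    (\<forall>\<^sub>F i in ae C. act (the (\<mu> i)) (resm (the (\<nu> i)) (the (\<mu> i)) (the (\<gamma> i))) (the (f i)) = the (f i))"
    if "\<mu> \<in> fN" "\<forall>\<^sub>F i in ae C. the (\<mu> i) \<le> the (\<nu> i)" "f \<in> cfuns C (lev \<mu>)" for \<mu> f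
    by (rule hauto_sublevel[OF \<sigma> \<nu> \<gamma>(1) _ that]) (rule \<gamma>(2))
  define w where "w = ppair \<nu> \<gamma>"
  have w: "partrec w" "\<forall>\<^sub>F i in ae C. w i \<noteq> None"
    using cfunsD[OF \<nu>] cfunsD[OF \<gamma>(1)]
    by (auto simp: w_def intro!: partrec_ppair eventually_conj eventually_elim2)
  have wdef: "\<forall>\<^sub>F i in ae C. the (w i) = prod_encode (the (\<nu> i), the (\<gamma> i)) \<and> the (\<gamma> i) \<in> carrier (G (the (\<nu> i)))"
    using glev_ae[OF \<gamma>(1)] by eventually_elim (simp add: w_def the_ppair)
  let ?r = "\<lambda>w m. tresm (pfst w) m (psnd w)"
  \<comment> \<open>The restriction to level \<open>m\<close> is not the identity, in the decidable
    form of not being idempotent.\<close>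
  let ?nt = "\<lambda>w m. tmult m (?r w m) (?r w m) \<noteq> ?r w m"
  have tr: "?r (prod_encode (n, g)) m = resm n m g" "resm n m g \<in> carrier (G m)"
    "?nt (prod_encode (n, g)) m \<longleftrightarrow> resm n m g \<otimes>\<^bsub>G m\<^esub> resm n m g \<noteq> resm n m g"
    if "g \<in> carrier (G n)" "m \<le> n" for n m g
    using that resm_closed[OF that(2,1)] by (simp_all add: tresm_def tmult_def)
  \<comment> \<open>The bound includes level \<open>\<nu>\<close> itself, where \<open>resm\<close>
    changes nothing. If all restrictions were trivial, the group element would be trivial there and
    \<open>\<sigma>\<close> would fix \<open>y\<close>.\<close>
  let ?E = "\<lambda>i w. \<exists>m<Suc (pfst w). ?nt w m"
  have "tdec (\<lambda>z. ?E (pfst z) (psnd z))" by (intro rec_intros)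
  from cohesive_dichotomy[OF C w this]
  have ex: "\<forall>\<^sub>F i in ae C. ?E i (the (w i))"
  proof
    assume "\<forall>\<^sub>F i in ae C. \<not> ?E i (the (w i))"
    with wdef lev_ae[OF f] have "\<forall>\<^sub>F i in ae C. act (the (\<nu> i)) (resm (the (\<nu> i)) (the (\<nu> i)) (the (\<gamma> i))) (the (f i)) = the (f i)"
    proof eventually_elim
      case (elim i)
      let ?n = "the (\<nu> i)" and ?g = "the (\<gamma> i)"
      have e: "the (w i) = prod_encode (?n, ?g)" "?g \<in> carrier (G ?n)" "the (f i) \<in> carrier (Ks ?n)"
        using elim by blast+
      have "\<not> ?nt (the (w i)) ?n" using elim(3) by (simp add: e(1))
      then show ?case using e(2,3) tr[OF e(2), of ?n] unfolding e(1) by (intro act_trivial) auto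
    qed
    then have "\<sigma> (tc (psing (pPsis \<nu> f))) = tc (psing (pPsis \<nu> f))"
      using sub[OF \<nu> _ f] by simp
    then show ?thesis using y(2) yf by simp
  qed
  let ?P = "\<lambda>i w m. m \<le> pfst w \<and> ?nt w m \<and> (\<forall>j<m. \<not> ?nt w j)"
  have "tdec (\<lambda>z. ?P (pfst (pfst z)) (psnd (pfst z)) (psnd z))" by (intro rec_intros)
  moreover have "\<forall>\<^sub>F i in ae C. \<exists>m. ?P i (the (w i)) m"
    using ex
  proof eventually_elim
    case (elim i)
    then obtain m where m: "m < Suc (pfst (the (w i)))" "?nt (the (w i)) m" by blast
    define l where "l = (LEAST m. ?nt (the (w i)) m)"
    have "?nt (the (w i)) l" unfolding l_def by (rule LeastI[of "?nt (the (w i))", OF m(2)])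
    moreover have "l \<le> m" unfolding l_def by (rule Least_le[of "?nt (the (w i))", OF m(2)])
    moreover have "\<forall>j<l. \<not> ?nt (the (w i)) j"
      unfolding l_def using not_less_Least[of _ "?nt (the (w i))"] by blast
    ultimately have "?P i (the (w i)) l" using m(1) by simp
    then show ?case by blast
  qed
  ultimately obtain \<mu> where \<mu>: "partrec \<mu>" "\<forall>\<^sub>F i in ae C. \<mu> i \<noteq> None"
    "\<And>i m. \<mu> i = Some m \<Longrightarrow> w i \<noteq> None \<and> ?P i (the (w i)) m"
    using partrec_selection[where P = ?P, OF w] by blast
  have \<mu>N: "\<mu> \<in> fN" by (rule cfuns_constI[OF \<mu>(1,2)]) simp
  have \<mu>P: "\<forall>\<^sub>F i in ae C. the (\<mu> i) \<le> the (\<nu> i) \<and> the (\<gamma> i) \<in> carrier (G (the (\<nu> i))) \<and>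
     ?nt (prod_encode (the (\<nu> i), the (\<gamma> i))) (the (\<mu> i)) \<and>
     (\<forall>j<the (\<mu> i). \<not> ?nt (prod_encode (the (\<nu> i), the (\<gamma> i))) j)"
    using wdef \<mu>(2)
  proof eventually_elim
    case (elim i)
    then obtain m where m: "\<mu> i = Some m" by auto
    have "?P i (the (w i)) m" using \<mu>(3)[OF m] by blast
    then show ?case using elim(1) m by (metis fst_conv option.sel prod_encode_inverse)
  qed
  have le: "\<forall>\<^sub>F i in ae C. the (\<mu> i) \<le> the (\<nu> i)" using \<mu>P by eventually_elim simp
  have "least_differ idH \<sigma> (nc \<mu>)"
    unfolding least_differ_def
  proof (intro conjI ballI impI)
    show "nc \<mu> \<in> cpow C UNIV" by (rule cclass_in_cprod[OF \<mu>N])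
    define v where "v = ppair \<mu> w"
    have v: "partrec v" "\<forall>\<^sub>F i in ae C. v i \<noteq> None"
      using w \<mu>(1,2) by (auto simp: v_def intro!: partrec_ppair eventually_conj eventually_elim2)
    have vdef: "\<forall>\<^sub>F i in ae C. the (v i) = prod_encode (the (\<mu> i), prod_encode (the (\<nu> i), the (\<gamma> i)))"
      using wdef w(2) \<mu>(2) by eventually_elim (simp add: v_def the_ppair)
    \<comment> \<open>A nontrivial restriction moves some point at almost every index; searching for
      these points yields one element of the product that \<open>\<sigma>\<close> moves.\<close>
    let ?Q = "\<lambda>i v x. x \<in> carrier (Ks (pfst v)) \<and> tact (pfst v) (?r (psnd v) (pfst v)) x \<noteq> x"
    have "tdec (\<lambda>z. ?Q (pfst (pfst z)) (psnd (pfst z)) (psnd z))" by (intro rec_intros)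
    moreover have "\<forall>\<^sub>F i in ae C. \<exists>x. ?Q i (the (v i)) x"
      using vdef \<mu>P
    proof eventually_elim
      case (elim i)
      let ?n = "the (\<nu> i)" and ?m = "the (\<mu> i)" and ?g = "the (\<gamma> i)"
      have mem: "?g \<in> carrier (G ?n)" "?m \<le> ?n" and nt: "?nt (prod_encode (?n, ?g)) ?m" using elim by blast+
      note t = tr[OF mem]
      obtain x where "x \<in> carrier (Ks ?m)" "act ?m (resm ?n ?m ?g) x \<noteq> x"
        using act_nontrivial[OF t(2)] nt t(3) by blast
      then have "?Q i (the (v i)) x"
        unfolding elim(1) prod_encode_inverse fst_conv snd_conv using t(1,2) mem
        by (simp add: tresm_def tact_def)
      then show ?case by blast
    qed
    ultimately obtain f2 where f2: "partrec f2" "\<forall>\<^sub>F i in ae C. f2 i \<noteq> None"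
      "\<And>i m. f2 i = Some m \<Longrightarrow> v i \<noteq> None \<and> ?Q i (the (v i)) m"
      using partrec_selection[where P = ?Q, OF v] by blast
    have f2l: "f2 \<in> cfuns C (lev \<mu>)"
    proof (rule levI[OF f2(1,2)])
      fix i x assume "f2 i = Some x"
      from f2(3)[OF this] show "\<mu> i \<noteq> None \<and> x \<in> carrier (Ks (the (\<mu> i)))"
        by (auto simp: v_def the_ppair)
    qed
    have "\<sigma> (tc (psing (pPsis \<mu> f2))) \<noteq> tc (psing (pPsis \<mu> f2))"
    proof
      assume "\<sigma> (tc (psing (pPsis \<mu> f2))) = tc (psing (pPsis \<mu> f2))"
      then have "\<forall>\<^sub>F i in ae C. act (the (\<mu> i)) (resm (the (\<nu> i)) (the (\<mu> i)) (the (\<gamma> i))) (the (f2 i)) = the (f2 i)"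
        using sub[OF \<mu>N le f2l] by simp
      then have "\<forall>\<^sub>F i in ae C. False"
        using vdef \<mu>P f2(2)
      proof eventually_elim
        case (elim i)
        let ?n = "the (\<nu> i)" and ?m = "the (\<mu> i)" and ?g = "the (\<gamma> i)"
        have mem: "?g \<in> carrier (G ?n)" "?m \<le> ?n" using elim(3) by blast+
        obtain x where x: "f2 i = Some x" using elim(4) by auto
        have "?Q i (the (v i)) x" using f2(3)[OF x] by blast
        then show False
          using elim(1) x tr(1,2)[OF mem] mem
          unfolding elim(2) prod_encode_inverse fst_conv snd_conv
          by (auto simp: tact_def tresm_def)
      qed
      then show False using ae_C by simp
    qed
    then show "hyper_differ C K Ks Psis idH \<sigma> (nc \<mu>)"
      using pPsis_H[OF \<mu>N f2l] by (intro differI[OF \<mu>N f2l]) simp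
    fix M assume M: "M \<in> cpow C UNIV" "hyper_differ C K Ks Psis idH \<sigma> M"
    obtain \<mu>' f' where w': "\<mu>' \<in> fN" "M = nc \<mu>'" "f' \<in> cfuns C (lev \<mu>')"
      "idH (tc (psing (pPsis \<mu>' f'))) \<noteq> \<sigma> (tc (psing (pPsis \<mu>' f')))"
      using differ_witness[OF M] .
    show "hyper_le C (nc \<mu>) M"
    proof (rule ccontr)
      assume "\<not> hyper_le C (nc \<mu>) M"
      then have lt: "\<forall>\<^sub>F i in ae C. the (\<mu>' i) < the (\<mu> i)"
        using hyper_le_cases[OF \<mu>N w'(1)] w'(2) by simp
      have le': "\<forall>\<^sub>F i in ae C. the (\<mu>' i) \<le> the (\<nu> i)"
        using lt le by eventually_elim simp
      have "\<forall>\<^sub>F i in ae C. act (the (\<mu>' i)) (resm (the (\<nu> i)) (the (\<mu>' i)) (the (\<gamma> i))) (the (f' i)) = the (f' i)"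
        using \<mu>P lt le' lev_ae[OF w'(3)]
      proof eventually_elim
        case (elim i)
        let ?n = "the (\<nu> i)" and ?m = "the (\<mu>' i)" and ?g = "the (\<gamma> i)"
        have mem: "?g \<in> carrier (G ?n)" "?m \<le> ?n" using elim(1,3) by blast+
        have "\<not> ?nt (prod_encode (?n, ?g)) ?m" using elim(1,2) by blast
        then show ?case
          using tr(2,3)[OF mem] elim(4) by (intro act_trivial) auto
      qed
      then have "\<sigma> (tc (psing (pPsis \<mu>' f'))) = tc (psing (pPsis \<mu>' f'))"
        using sub[OF w'(1) le' w'(3)] by simp
      then show False using w'(4) pPsis_H[OF w'(1,3)] by simp
    qed
  qed
  then show thesis by (rule that)
qed

lemma half_pow_standard: "hyper_half_pow C (nc (cst n)) = hyper_rat C (1 / 2 ^ n)"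
proof -
  have n: "cst n \<in> fN" by (rule cst_cfuns) simp
  have "(\<lambda>i. map_option (\<lambda>n. rat_encode (1 / 2 ^ n)) (cst n i)) \<in> cfuns C (const_seq (range rat_encode))"
    using cst_cfuns[of "rat_encode (1 / 2 ^ n)" "range rat_encode"] by simp
  from clift1_cclass[OF n this] show ?thesis
    by (simp add: hyper_half_pow_def hyper_rat_def cconst_def)
qed

text \<open>\<open>hyper_INF\<close> asks for some nonstandard exponent of the distance, so a
  standard distance must be shown to have no nonstandard exponent as well. This follows from
  injectivity of \<open>rat_encode\<close>.\<close>

lemma half_pow_inj:
  assumes N: "N \<in> cpow C UNIV" and eq: "hyper_half_pow C N = hyper_half_pow C (nc (cst n))"
  shows "N \<in> standard_nats C"
proof -
  obtain \<nu> where \<nu>: "\<nu> \<in> fN" "N = nc \<nu>" using N by (auto simp: cprod_iff)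
  let ?R = "const_seq (range rat_encode)"
  have n: "cst n \<in> fN" by (rule cst_cfuns) simp
  have "cst (rat_encode (1 / 2 ^ n)) \<in> cfuns C ?R"
    by (rule cst_cfuns) simp
  then have "cst (rat_encode (1 / 2 ^ n)) \<in> hyper_half_pow C (nc (cst n))"
    unfolding half_pow_standard hyper_rat_def cconst_def by (rule cclass_self)
  then have "cst (rat_encode (1 / 2 ^ n)) \<in> hyper_half_pow C N" using eq by simp
  then obtain \<mu> where \<mu>: "\<mu> \<in> nc \<nu>"
    "cst (rat_encode (1 / 2 ^ n)) \<in> cclass C ?R (\<lambda>i. map_option (\<lambda>n. rat_encode (1 / 2 ^ n)) (\<mu> i))"
    unfolding hyper_half_pow_def clift1_def \<nu>(2) by blast
  have \<mu>N: "\<mu> \<in> fN" "nc \<nu> = nc \<mu>" using \<mu>(1) cclass_rep by (auto simp: mem_cclass)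
  have inj: "m = n" if "rat_encode (1 / 2 ^ m) = rat_encode (1 / 2 ^ n)" for m
  proof -
    have "(1 / 2 ^ m :: rat) = 1 / 2 ^ n" using injD[OF inj_rat_encode that] .
    then show ?thesis by simp
  qed
  have "\<forall>\<^sub>F i in ae C. map_option (\<lambda>n. rat_encode (1 / 2 ^ n)) (\<mu> i) = cst (rat_encode (1 / 2 ^ n)) i"
    using \<mu>(2) by (auto simp: mem_cclass)
  then have "\<forall>\<^sub>F i in ae C. the (\<mu> i) = the (cst n i)"
    by eventually_elim (auto dest: inj)
  then have "nc \<mu> = nc (cst n)" by (rule cclass_cong_ae[OF \<mu>N(1) n])
  then show ?thesis using \<nu>(2) \<mu>N(2) by (simp add: standard_nats_def cconst_def)
qed

text \<open>The first level at which the restrictions to K differ satisfies the hypotheses of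
  \<open>least_differ_standard\<close>, so both metrics have the same exponent.\<close>

lemma rmap_differ_level:
  assumes "hauto \<sigma>" "hauto \<tau>" "rmap \<sigma> \<noteq> rmap \<tau>"
  obtains n where "least_differ \<sigma> \<tau> (nc (cst n))" "gal_dist Ks Psis (rmap \<sigma>) (rmap \<tau>) = 1 / 2 ^ n"
proof -
  let ?d = "\<lambda>n. restrict (rmap \<sigma>) (Psis n ` carrier (Ks n)) \<noteq> restrict (rmap \<tau>) (Psis n ` carrier (Ks n))"
  have d: "?d n \<longleftrightarrow> (\<exists>x\<in>carrier (Ks n). rmap \<sigma> (Psis n x) \<noteq> rmap \<tau> (Psis n x))" for n
    unfolding restrict_neq_iff by (simp only: bex_simps)
  have "\<exists>x\<in>carrier K. rmap \<sigma> x \<noteq> rmap \<tau> x"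
  proof (rule ccontr)
    assume "\<not> ?thesis"
    then have "rmap \<sigma> = rmap \<tau>"
      by (intro extensionalityI[of _ "carrier K"]) (auto simp: rmap_def)
    then show False using assms(3) by simp
  qed
  then obtain x m where "x \<in> Psis m ` carrier (Ks m)" "rmap \<sigma> x \<noteq> rmap \<tau> x"
    unfolding K_Union by blast
  then have "\<exists>m. ?d m" unfolding d by (metis imageE)
  define n where "n = (LEAST n. ?d n)"
  have n: "?d n" unfolding n_def by (rule LeastI_ex[of ?d]) fact
  have min: "rmap \<sigma> (Psis m x) = rmap \<tau> (Psis m x)" if "m < n" "x \<in> carrier (Ks m)" for m x
  proof -
    have "\<not> ?d m" using not_less_Least[of m ?d] that(1) unfolding n_def by blast
    then show ?thesis using that(2) unfolding d by (metis (no_types))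
  qed
  obtain x where x: "x \<in> carrier (Ks n)" "rmap \<sigma> (Psis n x) \<noteq> rmap \<tau> (Psis n x)"
    using n unfolding d by (elim bexE)
  have "least_differ \<sigma> \<tau> (nc (cst n))"
    by (rule least_differ_standard[OF assms(1,2) x min])
  moreover have "gal_dist Ks Psis (rmap \<sigma>) (rmap \<tau>) = 1 / 2 ^ n"
    using assms(3) by (simp add: gal_dist_def n_def)
  ultimately show thesis by (rule that)
qed

text \<open>A nontrivial restriction gives a standard distance, and \<open>half_pow_inj\<close>
  excludes a nonstandard exponent for it. Conversely, a nontrivial \<open>\<sigma>\<close> with
  trivial restriction has a least differing level, which cannot be standard because
  \<open>\<sigma>\<close> agrees with the identity up to every standard level.\<close>

lemma INF_eq_kernel: "hyper_INF C K F Psi Ks Psis = kernel HA (gal K k) rmap"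
proof (intro equalityI subsetI)
  fix \<sigma> assume "\<sigma> \<in> hyper_INF C K F Psi Ks Psis"
  then have \<sigma>: "\<sigma> \<in> carrier HA"
    and inf: "\<sigma> = idH \<or> (\<exists>N\<in>cpow C UNIV - standard_nats C. hyper_dist C K Ks Psis idH \<sigma> = hyper_half_pow C N)"
    by (auto simp: hyper_INF_def HA_one)
  have h: "hauto \<sigma>" using \<sigma> by (simp add: HA_carrier)
  have "rmap \<sigma> = rmap idH"
  proof (rule ccontr)
    assume ne: "rmap \<sigma> \<noteq> rmap idH"
    then have "rmap idH \<noteq> rmap \<sigma>" by (rule not_sym)
    then obtain n where n: "least_differ idH \<sigma> (nc (cst n))"
      by (rule rmap_differ_level[OF hauto_id h])
    have ne': "idH \<noteq> \<sigma>" using ne by auto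
    then obtain N where N: "N \<in> cpow C UNIV - standard_nats C" "hyper_dist C K Ks Psis idH \<sigma> = hyper_half_pow C N"
      using inf by blast
    have "hyper_half_pow C N = hyper_half_pow C (nc (cst n))"
      using hyper_dist_eq[OF n ne'] N(2) by simp
    then show False using half_pow_inj N(1) by blast
  qed
  then show "\<sigma> \<in> kernel HA (gal K k) rmap"
    using \<sigma> by (simp add: kernel_def rmap_id)
next
  fix \<sigma> assume "\<sigma> \<in> kernel HA (gal K k) rmap"
  then have \<sigma>: "\<sigma> \<in> carrier HA" "rmap \<sigma> = rmap idH"
    by (simp_all add: kernel_def rmap_id)
  have h: "hauto \<sigma>" using \<sigma> by (simp add: HA_carrier)
  show "\<sigma> \<in> hyper_INF C K F Psi Ks Psis"
  proof (cases "\<sigma> = idH")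
    case True
    then show ?thesis using \<sigma>(1) by (simp add: hyper_INF_def HA_one)
  next
    case False
    obtain N where N: "least_differ idH \<sigma> N" using least_differ_exists[OF h False] .
    have NC: "N \<in> cpow C UNIV" "hyper_differ C K Ks Psis idH \<sigma> N" using N by (simp_all add: least_differ_def)
    have "N \<notin> standard_nats C"
    proof
      assume "N \<in> standard_nats C"
      then obtain n where n: "N = nc (cst n)" by (auto simp: standard_nats_def cconst_def)
      obtain \<nu> f where w: "\<nu> \<in> fN" "N = nc \<nu>" "f \<in> cfuns C (lev \<nu>)"
        "idH (tc (psing (pPsis \<nu> f))) \<noteq> \<sigma> (tc (psing (pPsis \<nu> f)))"
        using differ_witness[OF NC] .
      have nN: "cst n \<in> fN" by (rule cst_cfuns) simp
      have "\<forall>\<^sub>F i in ae C. the (\<nu> i) = the (cst n i)"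
        using n w(2) cclass_eq_ae[OF w(1) nN] by simp
      then have le: "\<forall>\<^sub>F i in ae C. the (\<nu> i) \<le> n" by eventually_elim simp
      have "idH (tc (psing (pPsis \<nu> f))) = \<sigma> (tc (psing (pPsis \<nu> f)))"
        by (rule hauto_eq_on_level[OF hauto_id h _ w(1) le w(3)]) (simp add: \<sigma>(2))
      then show False using w(4) by blast
    qed
    moreover have "hyper_dist C K Ks Psis idH \<sigma> = hyper_half_pow C N"
      using hyper_dist_eq[OF N] False by blast
    ultimately show ?thesis
      using \<sigma>(1) NC(1) by (auto simp: hyper_INF_def HA_one)
  qed
qed

lemma kernel_eq_fixing:
  "kernel HA (gal K k) rmap = {\<sigma> \<in> carrier HA. \<forall>x\<in>carrier K.
     \<sigma> (sing (cconst C (carrier K) x)) = sing (cconst C (carrier K) x)}"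
proof -
  have "rmap \<sigma> = \<one>\<^bsub>gal K k\<^esub> \<longleftrightarrow> (\<forall>x\<in>carrier K. \<sigma> (pt x) = pt x)" if "\<sigma> \<in> carrier HA" for \<sigma>
  proof
    have h: "hauto \<sigma>" using that by (simp add: HA_carrier)
    show "\<forall>x\<in>carrier K. \<sigma> (pt x) = pt x" if "rmap \<sigma> = \<one>\<^bsub>gal K k\<^esub>"
      using rmap_pt(2)[OF h] that by (simp add: gal_one)
    show "rmap \<sigma> = \<one>\<^bsub>gal K k\<^esub>" if "\<forall>x\<in>carrier K. \<sigma> (pt x) = pt x"
      unfolding gal_one using that
      by (intro extensionalityI[of _ "carrier K"]) (auto simp: rmapI, simp add: rmap_def)
  qed
  then show ?thesis
    by (auto simp: kernel_def sing_cconst)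
qed

end

section \<open>Hyper-automorphisms from computable automorphisms, and density\<close>

section \<open>Computable automorphisms and density\<close>

context cohesive_galois
begin

definition pmap :: "(nat \<Rightarrow> nat) \<Rightarrow> (nat \<rightharpoonup> nat) \<Rightarrow> (nat \<rightharpoonup> nat)" where
  "pmap h f i = map_option (\<lambda>a. list_encode (map h (list_decode a))) (f i)"

definition hlift :: "(nat \<Rightarrow> nat) \<Rightarrow> (nat \<rightharpoonup> nat) set \<Rightarrow> (nat \<rightharpoonup> nat) set" where
  "hlift h = (\<lambda>a\<in>H. clift1 C (tuples (carrier K)) (\<lambda>a. list_encode (map h (list_decode a))) a)"

lemma pmap_fT:
  assumes "trec h" "h \<in> carrier K \<rightarrow> carrier K" "f \<in> fT"
  shows "pmap h f \<in> fT"
proof (rule cfuns_constI)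
  have "trec (\<lambda>z. list_encode (map h (list_decode (psnd z))))"
    by (rule trec_map) (intro rec_intros trec_compose[OF assms(1)])+
  then show "partrec (pmap h f)"
    unfolding pmap_def[abs_def] by (intro partrec_map cfunsD[OF assms(3)])
  show "\<forall>\<^sub>F i in ae C. pmap h f i \<noteq> None"
    using cfunsD(2)[OF assms(3)] by eventually_elim (simp add: pmap_def)
  show "x \<in> tuples (carrier K)" if "pmap h f i = Some x" for i x
    using that cfuns_constD[OF assms(3), of i] assms(2) by (auto simp: pmap_def tuples_iff subset_iff Pi_iff)
qed

lemma hlift_tc:
  assumes "trec h" "h \<in> carrier K \<rightarrow> carrier K" "f \<in> fT"
  shows "hlift h (tc f) = tc (pmap h f)"
  using clift1_cclass[OF assms(3)] pmap_fT[OF assms] assms(3)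
  by (simp add: hlift_def pmap_def[abs_def])

text \<open>Every clause is checked index by index for the entrywise action;
  \<open>poly_eval_hom\<close> gives compatibility with polynomials. The inverse has to be
  computable too, so that it acts on hyper-tuples and makes the action bijective.\<close>

lemma hlift_hauto:
  assumes h: "trec h" "h \<in> ring_hom K K" "\<And>e. e \<in> k \<Longrightarrow> h e = e"
    and h': "trec h'" "h' \<in> carrier K \<rightarrow> carrier K"
    and inv: "\<And>x. x \<in> carrier K \<Longrightarrow> h (h' x) = x" "\<And>x. x \<in> carrier K \<Longrightarrow> h' (h x) = x"
  shows "hauto (hlift h)" "x \<in> carrier K \<Longrightarrow> rmap (hlift h) x = h x"
proof -
  have hc: "h \<in> carrier K \<rightarrow> carrier K" using ring_hom_closed[OF h(2)] by blast
  note L = hlift_tc[OF h(1) hc] and L' = hlift_tc[OF h'] and P = pmap_fT[OF h(1) hc] and P' = pmap_fT[OF h']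
  have mem: "set (list_decode a) \<subseteq> carrier K" if "f \<in> fT" "f i = Some a" for f i a
    using cfuns_constD[OF that] by (simp add: tuples_iff)
  have maps: "map h (map h' xs) = xs" "map h' (map h xs) = xs" if "set xs \<subseteq> carrier K" for xs
    using that inv by (auto simp: comp_def subset_iff intro!: map_idI)
  have LL: "hlift h (hlift h' (tc f)) = tc f" "hlift h' (hlift h (tc f)) = tc f" if f: "f \<in> fT" for f
  proof -
    have "pmap h (pmap h' f) = f" "pmap h' (pmap h f) = f"
    proof -
      have "pmap h (pmap h' f) i = f i \<and> pmap h' (pmap h f) i = f i" for i
        using mem[OF f, of i] maps by (cases "f i") (auto simp: pmap_def simp del: map_map)
      then show "pmap h (pmap h' f) = f" "pmap h' (pmap h f) = f" by auto
    qed
    then show "hlift h (hlift h' (tc f)) = tc f" "hlift h' (hlift h (tc f)) = tc f"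
      by (simp_all add: L L' f P P')
  qed
  have bij: "bij_betw (hlift h) H H"
  proof (rule bij_betw_byWitness[where f' = "hlift h'"])
    show "\<forall>a\<in>H. hlift h' (hlift h a) = a" "\<forall>a\<in>H. hlift h (hlift h' a) = a"
      using LL by (auto elim!: H_cases)
    show "hlift h ` H \<subseteq> H" "hlift h' ` H \<subseteq> H"
      using P P' by (auto elim!: H_cases simp: L L')
  qed
  show ha: "hauto (hlift h)"
    unfolding hauto_def
  proof (intro conjI ballI impI)
    show "hlift h \<in> Bij H" using bij by (simp add: Bij_def hlift_def)
    fix a assume "a \<in> H"
    then obtain f where f: "f \<in> fT" "a = tc f" by (rule H_cases)
    {
      fix b assume "b \<in> H"
      then obtain g where g: "g \<in> fT" "b = tc g" by (rule H_cases)
      have "(\<forall>\<^sub>F i in ae C. tup_prefix (the (pmap h f i)) (the (pmap h g i))) \<longleftrightarrow>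
        (\<forall>\<^sub>F i in ae C. tup_prefix (the (f i)) (the (g i)))"
        using cfunsD(2)[OF f(1)] cfunsD(2)[OF g(1)]
      proof (intro eventually_subst, eventually_elim)
        case (elim i)
        then obtain x y where xy: "f i = Some x" "g i = Some y" by auto
        have "prefix (map h (list_decode x)) (map h (list_decode y)) \<longleftrightarrow> prefix (list_decode x) (list_decode y)"
          using map_mono_prefix[of "map h (list_decode x)" "map h (list_decode y)" h']
            map_mono_prefix[of "list_decode x" "list_decode y" h]
            maps(2)[OF mem[OF f(1) xy(1)]] maps(2)[OF mem[OF g(1) xy(2)]] by metis
        then show ?case by (simp add: pmap_def xy tup_prefix_def)
      qed
      then show "hyper_prefix C (hlift h a) (hlift h b) \<longleftrightarrow> hyper_prefix C a b"
        by (simp add: f g L P prefix_iff)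
      have "pmap h (papp f g) = papp (pmap h f) (pmap h g)"
      proof
        fix i show "pmap h (papp f g) i = papp (pmap h f) (pmap h g) i"
          by (cases "f i"; cases "g i") (auto simp: pmap_def papp_def tup_append_def)
      qed
      then show "hlift h (hyper_append C K a b) = hyper_append C K (hlift h a) (hlift h b)"
        by (simp add: f g append_tc L P papp_cfuns)
    }
    have "\<forall>\<^sub>F i in ae C. tup_arity (the (pmap h f i)) = tup_arity (the (f i))"
      using cfunsD(2)[OF f(1)] by eventually_elim (auto simp: pmap_def tup_arity_def)
    then show "hyper_arity C (hlift h a) = hyper_arity C a"
      using arity_eq_iff[OF P[OF f(1)] f(1)] by (simp add: f L)
    fix p assume "p \<in> cpow C UNIV" and ar: "hyper_arity C a = hyper_var C p"
    then obtain q where q: "q \<in> fN" "p = nc q" by (auto simp: cprod_iff)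
    have ev: "\<forall>\<^sub>F i in ae C. tup_arity (the (f i)) = poly_var (the (q i))"
      using ar arity_var_eq_iff[OF f(1) q(1)] f(2) q(2) by simp
    then have ev': "\<forall>\<^sub>F i in ae C. tup_arity (the (pmap h f i)) = poly_var (the (q i))"
      using cfunsD(2)[OF f(1)] by eventually_elim (auto simp: pmap_def tup_arity_def)
    have E: "peval q f \<in> fK" "peval q (pmap h f) \<in> fK"
      by (rule peval_fK[OF q(1) f(1) ev], rule peval_fK[OF q(1) P[OF f(1)] ev'])
    note PE = psing_cfuns[OF E(1)] psing_cfuns[OF E(2)]
    have "tc (psing (peval q (pmap h f))) = tc (pmap h (psing (peval q f)))"
      unfolding tc_eq_iff[OF PE(2) P[OF PE(1)]]
      using ev ev' cfunsD(2)[OF q(1)] cfunsD(2)[OF f(1)]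
    proof eventually_elim
      case (elim i)
      then obtain x r where xr: "f i = Some x" "q i = Some r" by auto
      have len: "tup_arity x = poly_var r" "poly_var r = length (list_decode x)"
        using elim xr by (auto simp: tup_arity_def)
      have "h (poly_eval K r (list_decode x)) = poly_eval K r (map h (list_decode x))"
        by (rule poly_eval_hom[OF K.cring_axioms K.cring_axioms h(2) mem[OF f(1) xr(1)] len(2)])
      then show ?case
        using len by (simp add: psing_def peval_def pmap_def xr tup_arity_def del: list_encode.simps)
    qed
    then show "sing (hyper_eval C K p (hlift h a)) = hlift h (sing (hyper_eval C K p a))"
      by (simp add: f q L P PE E eval_nc_tc[OF q(1) f(1) ev] eval_nc_tc[OF q(1) P[OF f(1)] ev'] sing_kc)
  next
    fix a assume "a \<in> hyper_tuples_base C K F Psi"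
    then obtain f where f: "f \<in> fB" "a = tc (pbase f)" by (auto simp: hyper_base_iff)
    have "pmap h (pbase f) i = pbase f i" for i
      using cfuns_constD[OF f(1), of i] h(3)
      by (cases "f i") (auto simp: pmap_def pbase_def tuples_iff subset_iff intro!: arg_cong[where f = list_encode])
    then have "pmap h (pbase f) = pbase f" by auto
    then show "hlift h a = a" using f by (simp add: L pbase_fT)
  qed
  show "rmap (hlift h) x = h x" if x: "x \<in> carrier K"
  proof (rule rmapI[OF x])
    show "h x \<in> carrier K" using hc x by blast
    have "pmap h (psing (cst x)) = psing (cst (h x))"
      by (auto simp: pmap_def psing_def fun_eq_iff simp del: list_encode.simps)
    then show "hlift h (pt x) = pt (h x)"
      by (simp add: L psing_cfuns cst_cfuns x)
  qed
qed

text \<open>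
  A compatible sequence of elements of the groups \<open>G\<^bsub>n\<^esub>, G\<^bsub>n+1\<^esub>, \<dots>\<close> is found by
  successive search, since the restriction maps are onto; its union is computable.
\<close>

lemma computable_extension:
  assumes g: "g \<in> carrier (G n)"
  obtains h h' where "trec h" "h \<in> ring_hom K K" "\<And>e. e \<in> k \<Longrightarrow> h e = e"
    "trec h'" "h' \<in> carrier K \<rightarrow> carrier K"
    "\<And>x. x \<in> carrier K \<Longrightarrow> h (h' x) = x" "\<And>x. x \<in> carrier K \<Longrightarrow> h' (h x) = x"
    "\<And>x. x \<in> carrier (Ks n) \<Longrightarrow> h (Psis n x) = Psis n (act n g x)"
proof -
  \<comment> \<open>The first disjunct lets the search succeed when \<open>v\<close> is not a group
    element, so \<open>s\<close> is total; for group elements a preimage exists by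
    \<open>resm_surj\<close>.\<close>
  define s where "s j v = (LEAST u. v \<notin> carrier (G (n + j)) \<or>
     u \<in> carrier (G (n + Suc j)) \<and> tresm (n + Suc j) (n + j) u = v)" for j v
  have ex: "\<exists>u. v \<notin> carrier (G (n + j)) \<or> u \<in> carrier (G (n + Suc j)) \<and> tresm (n + Suc j) (n + j) u = v" for j v
    using resm_surj[of "n + j" "n + Suc j" v] by (auto simp: tresm_def)
  have s: "s j v \<in> carrier (G (n + Suc j)) \<and> resm (n + Suc j) (n + j) (s j v) = v"
    if "v \<in> carrier (G (n + j))" for j v
    using LeastI_ex[OF ex[of v j]] that unfolding s_def[symmetric] by (auto simp: tresm_def)
  have s_rec: "trec (\<lambda>z. s (pfst z) (psnd z))"
    unfolding s_def by (rule trec_search[OF _ ex]) (intro rec_intros)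
  define e where "e = (\<lambda>j. rec_nat g (\<lambda>j v. s j v) j)"
  have e_rec: "trec (\<lambda>n. e (f n))" if "trec f" for f
    unfolding e_def by (intro rec_intros trec_compose2[OF s_rec] that)
  have e: "e j \<in> carrier (G (n + j))" for j
    by (induction j) (use g s in \<open>auto simp: e_def\<close>)
  have e_Suc: "resm (n + Suc j) (n + j) (e (Suc j)) = e j" for j
    using s[OF e[of j]] by (simp add: e_def)
  have compat_Suc: "Psis (n + Suc j) (act (n + Suc j) (e (Suc j)) y) = Psis (n + j) (act (n + j) (e j) x)"
    if "x \<in> carrier (Ks (n + j))" "y \<in> carrier (Ks (n + Suc j))" "Psis (n + Suc j) y = Psis (n + j) x" for j x y
    using resm_act[of "n + j" "n + Suc j" "e (Suc j)" x y] that e[of "Suc j"] e_Suc[of j] by simp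
  \<comment> \<open>The image does not depend on the level at which an element of K is represented,
    so the choice made by \<open>c\<close> below does not matter.\<close>
  have compat: "Psis (n + l) (act (n + l) (e l) y) = Psis (n + j) (act (n + j) (e j) x)"
    if "j \<le> l" "x \<in> carrier (Ks (n + j))" "y \<in> carrier (Ks (n + l))" "Psis (n + l) y = Psis (n + j) x" for j l x y
    using that(1,3,4)
  proof (induction l arbitrary: y rule: dec_induct)
    case base
    then have "y = x" using Psis_eqD that(2) by blast
    then show ?case by simp
  next
    case (step l)
    have "Psis (n + j) x \<in> Psis (n + l) ` carrier (Ks (n + l))"
      using Psis_mono[of "n + j" "n + l"] step.hyps that(2) by auto
    then obtain z where z: "z \<in> carrier (Ks (n + l))" "Psis (n + l) z = Psis (n + j) x" by fastforce
    show ?case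
      using compat_Suc[OF z(1) step.prems(1)] step.prems(2) z step.IH by simp
  qed
  \<comment> \<open>\<open>c y\<close> codes a level, counted from n, and a preimage of
    \<open>y\<close> in it.\<close>
  define c where "c y = (LEAST m. y \<notin> carrier K \<or> psnd m \<in> carrier (Ks (n + pfst m)) \<and> tPsis (n + pfst m) (psnd m) = y)" for y
  have exc: "\<exists>m. y \<notin> carrier K \<or> psnd m \<in> carrier (Ks (n + pfst m)) \<and> tPsis (n + pfst m) (psnd m) = y" for y
  proof (cases "y \<in> carrier K")
    case True
    then obtain j where "y \<in> Psis j ` carrier (Ks j)" by (auto simp: K_Union)
    then have "y \<in> Psis (n + j) ` carrier (Ks (n + j))" using Psis_mono[of j "n + j"] by auto
    then obtain x where "x \<in> carrier (Ks (n + j))" "Psis (n + j) x = y" by fastforce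
    then show ?thesis by (intro exI[of _ "prod_encode (j, x)"]) (simp add: tPsis_def)
  qed simp
  have c: "psnd (c y) \<in> carrier (Ks (n + pfst (c y))) \<and> Psis (n + pfst (c y)) (psnd (c y)) = y"
    if "y \<in> carrier K" for y
    using LeastI_ex[OF exc[of y]] that unfolding c_def[symmetric] by (auto simp: tPsis_def)
  have c_rec: "trec (\<lambda>n. c (f n))" if "trec f" for f
    by (rule trec_compose[OF _ that], unfold c_def, rule trec_search[OF _ exc]) (intro rec_intros)
  define h where "h y = tPsis (n + pfst (c y)) (tact (n + pfst (c y)) (e (pfst (c y))) (psnd (c y)))" for y
  have h_rec: "trec (\<lambda>n. h (f n))" if "trec f" for f
    unfolding h_def by (intro rec_intros c_rec e_rec that)
  have h: "h (Psis (n + j) x) = Psis (n + j) (act (n + j) (e j) x)" if x: "x \<in> carrier (Ks (n + j))" for j x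
  proof -
    let ?y = "Psis (n + j) x"
    let ?l = "pfst (c ?y)" and ?z = "psnd (c ?y)"
    have z: "?z \<in> carrier (Ks (n + ?l))" "Psis (n + ?l) ?z = ?y" using c[of ?y] x by auto
    have "h ?y = Psis (n + ?l) (act (n + ?l) (e ?l) ?z)"
      using z(1) e[of ?l] by (simp add: h_def tPsis_def tact_def)
    also have "\<dots> = Psis (n + j) (act (n + j) (e j) x)"
    proof (cases "j \<le> ?l")
      case True
      then show ?thesis by (rule compat[OF _ x z(1) z(2)])
    next
      case False
      then have "?l \<le> j" by simp
      then show ?thesis by (rule compat[OF _ z(1) x z(2)[symmetric], symmetric])
    qed
    finally show ?thesis .
  qed
  have level: "\<exists>j x. x \<in> carrier (Ks (n + j)) \<and> y = Psis (n + j) x" if "y \<in> carrier K" for y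
    using c[OF that] by metis
  have hK: "h y \<in> carrier K" if "y \<in> carrier K" for y
    using level[OF that] h e by fastforce
  have hom: "h \<in> ring_hom K K"
  proof (rule ring_hom_memI)
    fix x y assume xy: "x \<in> carrier K" "y \<in> carrier K"
    obtain m a b where m: "a \<in> carrier (Ks m)" "b \<in> carrier (Ks m)" "x = Psis m a" "y = Psis m b"
      using common_level[OF xy] .
    have "x \<in> Psis (n + m) ` carrier (Ks (n + m))" "y \<in> Psis (n + m) ` carrier (Ks (n + m))"
      using Psis_mono[of m "n + m"] m by auto
    then obtain a b where ab: "a \<in> carrier (Ks (n + m))" "b \<in> carrier (Ks (n + m))"
      "x = Psis (n + m) a" "y = Psis (n + m) b"
      by (elim imageE)
    interpret L: field "Ks (n + m)" by (rule Ks_field)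
    interpret p: ring_hom_cring "Ks (n + m)" K "Psis (n + m)" by (rule Psis_cring_hom)
    note ha = h[of _ m] and A = act_hom[OF e[of m]] and cl = act_closed[OF e[of m]]
    have "h (Psis (n + m) (a \<otimes>\<^bsub>Ks (n + m)\<^esub> b)) = h x \<otimes>\<^bsub>K\<^esub> h y"
      using ha[of "a \<otimes>\<^bsub>Ks (n + m)\<^esub> b"] ring_hom_mult[OF A ab(1,2)] ha[OF ab(1)] ha[OF ab(2)] ab(1,2) cl
      by (simp add: ab(3,4))
    then show "h (x \<otimes>\<^bsub>K\<^esub> y) = h x \<otimes>\<^bsub>K\<^esub> h y" using ab by simp
    have "h (Psis (n + m) (a \<oplus>\<^bsub>Ks (n + m)\<^esub> b)) = h x \<oplus>\<^bsub>K\<^esub> h y"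
      using ha[of "a \<oplus>\<^bsub>Ks (n + m)\<^esub> b"] ring_hom_add[OF A ab(1,2)] ha[OF ab(1)] ha[OF ab(2)] ab(1,2) cl
      by (simp add: ab(3,4))
    then show "h (x \<oplus>\<^bsub>K\<^esub> y) = h x \<oplus>\<^bsub>K\<^esub> h y" using ab by simp
  next
    interpret L: field "Ks (n + 0)" by (rule Ks_field)
    interpret p: ring_hom_cring "Ks (n + 0)" K "Psis (n + 0)" by (rule Psis_cring_hom)
    show "h \<one>\<^bsub>K\<^esub> = \<one>\<^bsub>K\<^esub>"
      using h[of "\<one>\<^bsub>Ks (n + 0)\<^esub>" 0] ring_hom_one[OF act_hom[OF e[of 0]]] p.hom_one L.one_closed by metis
  qed (rule hK)
  have fixk: "h x = x" if x: "x \<in> k" for x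
  proof -
    have "x \<in> Psis (n + 0) ` kn (n + 0)" using x Psis_kn by metis
    then obtain a where a: "a \<in> kn (n + 0)" "x = Psis (n + 0) a" by (elim imageE)
    then have "a \<in> carrier (Ks (n + 0))" by (simp add: base_in_def)
    from h[OF this] show ?thesis using a act_fixes[OF e[of 0] a(1)] by metis
  qed
  have inj: "inj_on h (carrier K)"
    using non_trivial_field_hom_is_inj[OF hom K.field_axioms K.field_axioms] .
  \<comment> \<open>The inverse is found by search: \<open>h\<close> is onto because it permutes
    each level from n on, and injective as a homomorphism of fields.\<close>
  define h' where "h' y = (LEAST x. y \<notin> carrier K \<or> x \<in> carrier K \<and> h x = y)" for y
  have exh: "\<exists>x. y \<notin> carrier K \<or> x \<in> carrier K \<and> h x = y" for y
  proof (cases "y \<in> carrier K")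
    case True
    then obtain j b where b: "b \<in> carrier (Ks (n + j))" "y = Psis (n + j) b" using level by blast
    obtain a where a: "a \<in> carrier (Ks (n + j))" "act (n + j) (e j) a = b"
      using act_bij[OF e[of j]] b(1) unfolding bij_betw_def by (metis imageE)
    have "h (Psis (n + j) a) = y" unfolding h[OF a(1)] a(2) b(2) ..
    then show ?thesis using Psis_closed[OF a(1)] by blast
  qed simp
  have h': "h' y \<in> carrier K \<and> h (h' y) = y" if "y \<in> carrier K" for y
    using LeastI_ex[OF exh[of y]] that unfolding h'_def[symmetric] by blast
  show thesis
  proof (rule that)
    show "trec h" using h_rec[OF trec_id] .
    show "trec h'"
      unfolding h'_def[abs_def] by (rule trec_search[OF _ exh]) (intro rec_intros h_rec)
    show "h' (h x) = x" if "x \<in> carrier K" for x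
      using h'[OF hK[OF that]] inj that by (auto dest: inj_onD)
    show "h (Psis n x) = Psis n (act n g x)" if "x \<in> carrier (Ks n)" for x
      using h[of x 0] that by (simp add: e_def)
  qed (use hom fixk h' in auto)
qed

text \<open>On level n the automorphism g agrees with an element of \<open>G n\<close> by
  \<open>embedding_lift\<close>; \<open>computable_extension\<close> extends that element to K, and
  \<open>hlift\<close> makes it a hyper-automorphism.\<close>

lemma rmap_dense:
  assumes g: "g \<in> carrier (gal K k)"
  obtains \<sigma> where "hauto \<sigma>" "\<And>x. x \<in> carrier (Ks n) \<Longrightarrow> rmap \<sigma> (Psis n x) = g (Psis n x)"
proof -
  have gh: "g \<in> ring_hom (K\<lparr>carrier := carrier K\<rparr>) K" "\<And>e. e \<in> k \<Longrightarrow> g e = e"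
    using g by (auto simp: gal_def)
  obtain u where u: "u \<in> carrier (G n)"
    "\<And>x. x \<in> carrier (Ks n) \<Longrightarrow> Psis n x \<in> carrier K \<Longrightarrow> Psis n (act n u x) = g (Psis n x)"
    using embedding_lift[OF K.carrier_is_subfield k_in_K gh, of n] by blast
  show thesis
  proof (rule computable_extension[OF u(1)])
    fix h h'
    assume h: "trec h" "h \<in> ring_hom K K" "\<And>e. e \<in> k \<Longrightarrow> h e = e"
      "trec h'" "h' \<in> carrier K \<rightarrow> carrier K"
      "\<And>x. x \<in> carrier K \<Longrightarrow> h (h' x) = x" "\<And>x. x \<in> carrier K \<Longrightarrow> h' (h x) = x"
      "\<And>x. x \<in> carrier (Ks n) \<Longrightarrow> h (Psis n x) = Psis n (act n u x)"
    note ha = hlift_hauto[OF h(1-2) _ h(4-5)]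
    show thesis
    proof (rule that)
      show "hauto (hlift h)" by (rule ha(1)) (fact h(3) h(6) h(7))+
      fix x assume x: "x \<in> carrier (Ks n)"
      have "rmap (hlift h) (Psis n x) = h (Psis n x)"
        by (rule ha(2)) (fact h(3) h(6) h(7) Psis_closed[OF x])+
      then show "rmap (hlift h) (Psis n x) = g (Psis n x)"
        using h(8)[OF x] u(2)[OF x Psis_closed[OF x]] by simp
    qed
  qed
qed

text \<open>Finitely many spanning elements lie in a common level, and this level is a k-subspace of
  K.\<close>

lemma finite_dimension_level:
  assumes L: "subfield L K" "k \<subseteq> L" and fd: "K.finite_dimension k L"
  obtains n where "L \<subseteq> Psis n ` carrier (Ks n)"
proof -
  obtain Us where Us: "set Us \<subseteq> carrier K" "K.Span k Us = L"
    using K.exists_base[OF k_subfield K.finite_dimensionE[OF k_subfield fd]] by blast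
  have "\<exists>n. set Us \<subseteq> Psis n ` carrier (Ks n)"
    using Us(1)
  proof (induction Us)
    case (Cons a Us)
    then obtain n where n: "set Us \<subseteq> Psis n ` carrier (Ks n)" by auto
    obtain m where m: "a \<in> Psis m ` carrier (Ks m)" using Cons.prems by (auto simp: K_Union)
    have "set (a # Us) \<subseteq> Psis (max m n) ` carrier (Ks (max m n))"
      using n m Psis_mono[of m "max m n"] Psis_mono[of n "max m n"] by auto
    then show ?case by blast
  qed auto
  then obtain n where n: "set Us \<subseteq> Psis n ` carrier (Ks n)" by blast
  let ?E = "Psis n ` carrier (Ks n)"
  have sr: "subring ?E K" by (rule subfieldE(1)[OF level_subfield])
  have "subalgebra k ?E K"
  proof (rule subalgebra.intro)
    show "subgroup ?E (add_monoid K)" using sr by (rule subring.axioms(1))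
    show "subalgebra_axioms k ?E K"
      by (rule subalgebra_axioms.intro) (use subringE(6)[OF sr] k_subset_Psis in blast)
  qed
  from K.subalgebra_Span_incl[OF k_subfield this n] have "L \<subseteq> ?E" using Us(2) by simp
  then show thesis by (rule that)
qed

text \<open>Every open set around \<open>g\<close> contains the set \<open>V g n\<close> of
  automorphisms agreeing with \<open>g\<close> on some level n. This is proved along the generation
  of the topology from its subbase; on a generating set it is
  \<open>finite_dimension_level\<close>.\<close>

lemma krull_dense:
  assumes H: "H' \<subseteq> carrier (gal K k)"
    and dense: "\<And>g n. g \<in> carrier (gal K k) \<Longrightarrow> \<exists>h\<in>H'. \<forall>x\<in>carrier (Ks n). h (Psis n x) = g (Psis n x)"
  shows "krull_topology K k closure_of H' = carrier (gal K k)"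
proof -
  define B where "B = {{\<tau> \<in> carrier (gal K k). \<forall>x\<in>L. \<tau> x = \<sigma> x} | \<sigma> L.
        \<sigma> \<in> carrier (gal K k) \<and> subfield L K \<and> k \<subseteq> L \<and> K.finite_dimension k L}"
  have top: "krull_topology K k = topology_generated_by B"
    by (simp add: krull_topology_def B_def)
  have "topspace (krull_topology K k) = \<Union> B" unfolding top by simp
  also have "\<Union> B = carrier (gal K k)"
  proof (intro equalityI subsetI)
    fix \<sigma> assume s: "\<sigma> \<in> carrier (gal K k)"
    \<comment> \<open>With k itself as the intermediate field, every automorphism lies in one of the
      generating sets.\<close>
    have "K.finite_dimension k k"
      using K.dimension_one[OF k_subfield] unfolding K.finite_dimension_def by blast
    then have "{\<tau> \<in> carrier (gal K k). \<forall>x\<in>k. \<tau> x = \<sigma> x} \<in> B"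
      unfolding B_def using s k_subfield by blast
    then show "\<sigma> \<in> \<Union> B" using s by blast
  qed (auto simp: B_def)
  finally have ts: "topspace (krull_topology K k) = carrier (gal K k)" .
  define V where "V g n = {\<tau> \<in> carrier (gal K k). \<forall>x\<in>Psis n ` carrier (Ks n). \<tau> x = g x}" for g n
  have V_anti: "V g m \<subseteq> V g n" if "n \<le> m" for g n m
    using Psis_mono[OF that] by (auto simp only: V_def)
  have nbhd: "\<exists>n. V g n \<subseteq> U" if "generate_topology_on B U" "g \<in> U" for U g
    using that
  proof (induction arbitrary: g rule: generate_topology_on.induct)
    case Empty
    then show ?case by simp
  next
    case (Int a b)
    then have "g \<in> a" "g \<in> b" by auto
    then obtain n m where "V g n \<subseteq> a" "V g m \<subseteq> b"
      using Int.IH(1)[of g] Int.IH(2)[of g] by blast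
    then have "V g (max n m) \<subseteq> a \<inter> b"
      using V_anti[of n "max n m" g] V_anti[of m "max n m" g] by auto
    then show ?case by blast
  next
    case (UN U)
    from UN.prems obtain u where u: "u \<in> U" "g \<in> u" by (elim UnionE)
    then obtain n where "V g n \<subseteq> u" using UN.IH[OF u] by (elim exE)
    then show ?case using u(1) by blast
  next
    case (Basis s)
    then obtain \<sigma> L where s: "s = {\<tau> \<in> carrier (gal K k). \<forall>x\<in>L. \<tau> x = \<sigma> x}"
      and L: "subfield L K" "k \<subseteq> L" "K.finite_dimension k L"
      unfolding B_def by blast
    obtain n where n: "L \<subseteq> Psis n ` carrier (Ks n)" using finite_dimension_level[OF L] .
    have "V g n \<subseteq> s"
      using n Basis.prems unfolding s V_def by auto
    then show ?case by blast
  qed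
  show ?thesis
  proof (intro equalityI subsetI)
    fix g assume "g \<in> krull_topology K k closure_of H'"
    then show "g \<in> carrier (gal K k)" unfolding in_closure_of ts by (rule conjunct1)
  next
    fix g assume g: "g \<in> carrier (gal K k)"
    show "g \<in> krull_topology K k closure_of H'"
      unfolding in_closure_of
    proof (intro conjI allI impI)
      show "g \<in> topspace (krull_topology K k)" using g ts by simp
      fix U assume U: "g \<in> U \<and> openin (krull_topology K k) U"
      then have "generate_topology_on B U" unfolding top by (simp add: openin_topology_generated_by_iff)
      then have "\<exists>n. V g n \<subseteq> U" by (rule nbhd) (use U in simp)
      then obtain n where n: "V g n \<subseteq> U" ..
      obtain h where h: "h \<in> H'" "\<forall>x\<in>carrier (Ks n). h (Psis n x) = g (Psis n x)"
        using dense[OF g, of n] by (elim bexE)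
      then have "h \<in> V g n" using H unfolding V_def by auto
      then show "\<exists>y. y \<in> H' \<and> y \<in> U" using n h(1) by blast
    qed
  qed
qed

end

theorem theorem5p26:
  fixes K F :: "nat ring" and Psi :: "nat \<Rightarrow> nat"
    and Ks :: "nat \<Rightarrow> nat ring" and Psis Phis :: "nat \<Rightarrow> nat \<Rightarrow> nat"
    and G :: "nat \<Rightarrow> nat monoid" and res act :: "nat \<Rightarrow> nat \<Rightarrow> nat \<Rightarrow> nat"
    and C :: "nat set"
  assumes "fully_computable_galois K F Psi Ks Psis Phis G res act"
    and "\<not> ring.finite_dimension K (Psi ` carrier F) (carrier K)"
    and "cohesive C"
  shows "hyper_INF C K F Psi Ks Psis \<lhd> HAut C K F Psi \<and>
    hyper_INF C K F Psi Ks Psis =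
      {\<sigma> \<in> carrier (HAut C K F Psi).
         \<forall>x\<in>carrier K. \<sigma> (hyper_singleton C K (cconst C (carrier K) x))
                        = hyper_singleton C K (cconst C (carrier K) x)} \<and>
    (\<exists>H f. subgroup H (gal K (Psi ` carrier F)) \<and>
       krull_topology K (Psi ` carrier F) closure_of H = carrier (gal K (Psi ` carrier F)) \<and>
       f \<in> iso (HAut C K F Psi Mod hyper_INF C K F Psi Ks Psis)
               (gal K (Psi ` carrier F)\<lparr>carrier := H\<rparr>) \<and>
       (\<forall>S\<in>carrier (HAut C K F Psi Mod hyper_INF C K F Psi Ks Psis).
        \<forall>T\<in>carrier (HAut C K F Psi Mod hyper_INF C K F Psi Ks Psis).
          is_coset_dist C K Ks Psis S T (gal_dist Ks Psis (f S) (f T))))"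
proof -
  interpret cohesive_galois K F Psi Ks Psis Phis G res act C
    by unfold_locales (fact assms(1) assms(3))+
  interpret r: group_hom HA "gal K k" rmap by (rule rmap_hom)
  let ?I = "hyper_INF C K F Psi Ks Psis" and ?f = "\<lambda>S. the_elem (rmap ` S)"
  define R where "R = rmap ` carrier HA"
  have sub: "subgroup R (gal K k)" unfolding R_def by (rule r.img_is_subgroup)
  have dense: "krull_topology K k closure_of R = carrier (gal K k)"
  proof (rule krull_dense)
    show "R \<subseteq> carrier (gal K k)" using subgroup.subset[OF sub] .
    fix g n assume g: "g \<in> carrier (gal K k)"
    show "\<exists>h\<in>R. \<forall>x\<in>carrier (Ks n). h (Psis n x) = g (Psis n x)"
    proof (rule rmap_dense[OF g, of n])
      fix \<sigma> assume "hauto \<sigma>" "\<And>x. x \<in> carrier (Ks n) \<Longrightarrow> rmap \<sigma> (Psis n x) = g (Psis n x)"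
      then show ?thesis by (intro bexI[of _ "rmap \<sigma>"]) (auto simp: R_def HA_carrier)
    qed
  qed
  have gR: "group (gal K k\<lparr>carrier := R\<rparr>)" by (rule subgroup.subgroup_is_group[OF sub galK_group])
  \<comment> \<open>With its image as target, restriction is onto, so the quotient by the kernel is
    isomorphic to that image.\<close>
  interpret q: group_hom HA "gal K k\<lparr>carrier := R\<rparr>" rmap
    by (intro group_hom.intro group_hom_axioms.intro HA_group gR homI) (auto simp: R_def)
  have ker: "kernel HA (gal K k\<lparr>carrier := R\<rparr>) rmap = ?I"
    unfolding INF_eq_kernel by (simp add: kernel_def)
  have iso: "?f \<in> iso (HA Mod ?I) (gal K k\<lparr>carrier := R\<rparr>)"
    using q.FactGroup_iso_set unfolding ker by (simp add: R_def)
  \<comment> \<open>Restriction is constant on a coset of its kernel, and \<open>?f\<close> returns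
    this common value.\<close>
  have coset: "S \<subseteq> carrier HA \<and> (\<forall>\<sigma>\<in>S. rmap \<sigma> = ?f S) \<and> S \<noteq> {}" if S: "S \<in> carrier (HA Mod ?I)" for S
  proof -
    obtain g where g: "g \<in> carrier HA" "S = kernel HA (gal K k) rmap #>\<^bsub>HA\<^esub> g"
      using S unfolding INF_eq_kernel by (auto simp: FactGroup_def RCOSETS_def)
    have "rmap ` S = {rmap g}"
      using g by (auto simp: kernel_def r_coset_def intro!: imageI)
    moreover have "S \<subseteq> carrier HA"
      using g by (auto simp: kernel_def r_coset_def)
    ultimately show ?thesis by auto
  qed
  have dist: "is_coset_dist C K Ks Psis S T (gal_dist Ks Psis (?f S) (?f T))"
    if S: "S \<in> carrier (HA Mod ?I)" and T: "T \<in> carrier (HA Mod ?I)" for S T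
  proof (cases "S = T")
    case True
    then show ?thesis by (simp add: is_coset_dist_def gal_dist_def)
  next
    case False
    then have ne: "?f S \<noteq> ?f T"
      using iso S T by (auto simp: iso_def bij_betw_def dest: inj_onD)
    have d: "hyper_dist C K Ks Psis \<sigma> \<tau> = hyper_rat C (1 / 2 ^ n) \<and> gal_dist Ks Psis (?f S) (?f T) = 1 / 2 ^ n"
      if "\<sigma> \<in> S" "\<tau> \<in> T" "least_differ \<sigma> \<tau> (nc (cst n))" "gal_dist Ks Psis (rmap \<sigma>) (rmap \<tau>) = 1 / 2 ^ n" for \<sigma> \<tau> n
    proof -
      have "rmap \<sigma> = ?f S" "rmap \<tau> = ?f T" using coset[OF S] coset[OF T] that(1,2) by blast+
      moreover from this ne have "\<sigma> \<noteq> \<tau>" by metis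
      ultimately show ?thesis using hyper_dist_eq[OF that(3)] that(4) half_pow_standard by simp
    qed
    have ex: "\<exists>n. least_differ \<sigma> \<tau> (nc (cst n)) \<and> gal_dist Ks Psis (rmap \<sigma>) (rmap \<tau>) = 1 / 2 ^ n"
      if "\<sigma> \<in> S" "\<tau> \<in> T" for \<sigma> \<tau>
    proof -
      have "hauto \<sigma>" "hauto \<tau>" using coset[OF S] coset[OF T] that by (auto simp: HA_carrier)
      moreover have "rmap \<sigma> \<noteq> rmap \<tau>" using coset[OF S] coset[OF T] that ne by metis
      ultimately show ?thesis by (rule rmap_differ_level) blast
    qed
    obtain \<sigma> \<tau> where st: "\<sigma> \<in> S" "\<tau> \<in> T" using coset[OF S] coset[OF T] by blast
    obtain n where n: "gal_dist Ks Psis (?f S) (?f T) = 1 / 2 ^ n" using ex[OF st] d[OF st] by blast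
    \<comment> \<open>The exponent could depend on the representatives, but it is also the exponent
      of the distance between the restrictions, which depends on the cosets only.\<close>
    have "hyper_dist C K Ks Psis \<sigma> \<tau> = hyper_rat C (1 / 2 ^ n)" if st: "\<sigma> \<in> S" "\<tau> \<in> T" for \<sigma> \<tau>
    proof -
      obtain m where m: "hyper_dist C K Ks Psis \<sigma> \<tau> = hyper_rat C (1 / 2 ^ m)"
        "gal_dist Ks Psis (?f S) (?f T) = 1 / 2 ^ m"
        using ex[OF st] d[OF st] by blast
      then have "m = n" using n by simp
      then show ?thesis using m by simp
    qed
    then show ?thesis using False n by (auto simp: is_coset_dist_def)
  qed
  have normal: "?I \<lhd> HA" unfolding INF_eq_kernel by (rule r.normal_kernel)
  show ?thesis
    using normal kernel_eq_fixing sub dense iso dist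
    unfolding INF_eq_kernel[symmetric] by blast
qed

end
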